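(* Let $m\ge 1$ and let $\Omega\subsetneq\mathbb{R}^m$ be any domain. (1) If $m\in\{1,2\}$, then the function $x\mapsto -\log(d_{\partial\Omega}(x))$ is subharmonic on $\Omega$. If $m>2$, then the function $x\mapsto (d_{\partial\Omega}(x))^{2-m}$ is subharmonic on $\Omega$. (2) If $m>2$, $\Omega$ is smoothly bounded, and the mean curvature $H$ of $\partial\Omega$ satisfies $H(w)\ge \frac{-1}{(m-2)R}$ for every $w\in\partial\Omega$, where $R$ is the inradius of $\Omega$, then $x\mapsto -\log(d_{\partial\Omega}(x))$ is subharmonic in $\Omega$. (3) If $\Omega$ is smoothly bounded, then $-\log(d_{\partial\Omega}(x))$ is subharmonic near the boundary, i.e. there is a neighborhood $U$ of $\partial\Omega$ such that $-\log(d_{\partial\Omega})$ is subharmonic on $\Omega\cap U$.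
   Context: A domain is a nonempty connected open set. $d_{\partial\Omega}(x)=\inf_{w\in\partial\Omega}\|x-w\|$ is the Euclidean distance to the boundary. "Smoothly bounded" means bounded with smooth ($C^\infty$) boundary. The inradius $R$ of $\Omega$ is the radius of the largest ball contained in $\Omega$. For a domain $\Omega\subset\mathbb{R}^m$, $m\ge 2$, with (at least $C^2$) smooth boundary, let $\nu(w)$ be the inward unit normal to $\partial\Omega$ at $w$. The principal curvatures $\kappa_1,\dots,\kappa_{m-1}$ of $\partial\Omega$ at $w$ are the eigenvalues of the second fundamental form $\mathrm{II}(w)(X,Y)=-\langle d\nu(w)(X),Y\rangle$ on the tangent space $T_w\partial\Omega$ (with the inner product induced from $\mathbb{R}^m$); with this sign convention the unit ball has all principal curvatures equal to $1$. The mean curvature is $H(w)=\frac{\kappa_1+\cdots+\kappa_{m-1}}{m-1}$. *)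

theory Defs
  imports "HOL-Analysis.Analysis"
begin

definition is_domain :: "'a::euclidean_space set \<Rightarrow> bool" where
  "is_domain \<Omega> \<longleftrightarrow> open \<Omega> \<and> connected \<Omega> \<and> \<Omega> \<noteq> {}"

text \<open>For a nonempty proper open subset of a Euclidean space the boundary is nonempty, so
  \<^const>\<open>infdist\<close> is the honest infimum here (its default value for the empty set is not used).\<close>

definition bdist :: "'a::euclidean_space set \<Rightarrow> 'a \<Rightarrow> real" where
  "bdist \<Omega> x = infdist x (frontier \<Omega>)"

definition inradius :: "'a::euclidean_space set \<Rightarrow> real" where
  "inradius \<Omega> = Sup {r. 0 < r \<and> (\<exists>x. ball x r \<subseteq> \<Omega>)}"

text \<open>Upper semicontinuity together with the sub-mean-value inequality over all closed balls in
  the open set \<open>S\<close>. Only finite-valued functions are considered. Integrability is part of the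
  definition because the Bochner integral of a non-integrable function is 0 by convention; it
  excludes nothing, since for a finite-valued upper semicontinuous \<open>u\<close> the integral over a compact
  ball is well defined in \<open>[-\<infinity>, \<infinity>)\<close> and the sub-mean-value inequality forces it to be finite.\<close>

definition upper_semicontinuous_on :: "'a::topological_space set \<Rightarrow> ('a \<Rightarrow> real) \<Rightarrow> bool" where
  "upper_semicontinuous_on S u \<longleftrightarrow>
     (\<forall>x\<in>S. \<forall>a. u x < a \<longrightarrow> (\<forall>\<^sub>F y in at x within S. u y < a))"

definition subharmonic_on :: "'a::euclidean_space set \<Rightarrow> ('a \<Rightarrow> real) \<Rightarrow> bool" where
  "subharmonic_on S u \<longleftrightarrow>
     open S \<and> upper_semicontinuous_on S u \<and>
     (\<forall>x r. 0 < r \<and> cball x r \<subseteq> S \<longrightarrow>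
        set_integrable lborel (cball x r) u \<and>
        u x \<le> (LINT y:cball x r|lborel. u y) / measure lborel (cball x r))"

text \<open>\<open>f\<close> is \<open>C\<^sup>k\<close> on an open set: all iterated directional derivatives up to order \<open>k\<close> exist,
  those of order less than \<open>k\<close> are (totally) differentiable, and those of order \<open>k\<close> are
  continuous.\<close>

primrec Ck_on :: "nat \<Rightarrow> 'a::euclidean_space set \<Rightarrow> ('a \<Rightarrow> real) \<Rightarrow> bool" where
  "Ck_on 0 S f \<longleftrightarrow> continuous_on S f"
| "Ck_on (Suc k) S f \<longleftrightarrow>
     (\<forall>x\<in>S. f differentiable (at x)) \<and> (\<forall>v. Ck_on k S (\<lambda>x. frechet_derivative f (at x) v))"

definition smooth_on :: "'a::euclidean_space set \<Rightarrow> ('a \<Rightarrow> real) \<Rightarrow> bool" where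
  "smooth_on S f \<longleftrightarrow> (\<forall>k. Ck_on k S f)"

text \<open>Local defining functions are taken positive inside \<open>\<Omega>\<close>, so that their gradient points
  inward.\<close>

definition local_defining_function ::
  "'a::euclidean_space set \<Rightarrow> 'a \<Rightarrow> 'a set \<Rightarrow> ('a \<Rightarrow> real) \<Rightarrow> bool" where
  "local_defining_function \<Omega> w U \<rho> \<longleftrightarrow>
     open U \<and> w \<in> U \<and> smooth_on U \<rho> \<and> (\<forall>x\<in>U. \<not> GDERIV \<rho> x :> 0) \<and>
     \<Omega> \<inter> U = {x\<in>U. 0 < \<rho> x}"

definition smoothly_bounded :: "'a::euclidean_space set \<Rightarrow> bool" where
  "smoothly_bounded \<Omega> \<longleftrightarrow>
     bounded \<Omega> \<and> (\<forall>w\<in>frontier \<Omega>. \<exists>U \<rho>. local_defining_function \<Omega> w U \<rho>)"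

text \<open>At a boundary point the normalised gradients of all local defining functions agree.\<close>

definition inward_normal :: "'a::euclidean_space set \<Rightarrow> 'a \<Rightarrow> 'a" where
  "inward_normal \<Omega> w =
     (THE n. \<exists>U \<rho> g. local_defining_function \<Omega> w U \<rho> \<and> GDERIV \<rho> w :> g \<and> n = sgn g)"

definition tangent_space :: "'a::euclidean_space set \<Rightarrow> 'a \<Rightarrow> 'a set" where
  "tangent_space \<Omega> w = {X. X \<bullet> inward_normal \<Omega> w = 0}"

text \<open>The differential of \<open>\<nu>\<close> is its derivative within \<open>\<partial>\<Omega>\<close>. As a linear map on the whole space
  this is determined only on tangent vectors, and it is applied only to those below.\<close>

definition second_fundamental_form ::
  "'a::euclidean_space set \<Rightarrow> 'a \<Rightarrow> 'a \<Rightarrow> 'a \<Rightarrow> real" where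
  "second_fundamental_form \<Omega> w X Y =
     - (frechet_derivative (inward_normal \<Omega>) (at w within frontier \<Omega>) X \<bullet> Y)"

definition curvature_eigenspace :: "'a::euclidean_space set \<Rightarrow> 'a \<Rightarrow> real \<Rightarrow> 'a set" where
  "curvature_eigenspace \<Omega> w \<kappa> =
     {X \<in> tangent_space \<Omega> w.
        \<forall>Y \<in> tangent_space \<Omega> w. second_fundamental_form \<Omega> w X Y = \<kappa> * (X \<bullet> Y)}"

definition principal_curvatures :: "'a::euclidean_space set \<Rightarrow> 'a \<Rightarrow> real set" where
  "principal_curvatures \<Omega> w = {\<kappa>. \<exists>X \<in> curvature_eigenspace \<Omega> w \<kappa>. X \<noteq> 0}"

text \<open>The principal curvatures form a set here, so each is weighted with its multiplicity, the
  dimension of its eigenspace; the multiplicities add up to \<open>m - 1\<close> since the second fundamental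
  form is symmetric.\<close>

definition mean_curvature :: "'a::euclidean_space set \<Rightarrow> 'a \<Rightarrow> real" where
  "mean_curvature \<Omega> w =
     (\<Sum>\<kappa>\<in>principal_curvatures \<Omega> w. real (dim (curvature_eigenspace \<Omega> w \<kappa>)) * \<kappa>)
       / (real DIM('a) - 1)"

end

theory Submission
  imports Defs
begin

text \<open>A continuous function \<open>u\<close> is subharmonic as soon as its second differences along coordinate
  directions are locally bounded below by \<open>- K t\<^sup>2\<close> and, at every point, the lower limit of its
  discrete Laplacian is nonnegative; the latter holds if \<open>u\<close> is touched from below at that point by
  a function with nonnegative Laplacian there. For \<open>u = - ln d\<close> the first condition follows from
  \<open>u \<ge> - ln |x - w|\<close> for every \<open>w\<close> outside \<open>\<Omega>\<close>, with equality at the nearest boundary point. The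
  same functions (or \<open>|x - w|\<close> to the power \<open>2 - m\<close>) also give the second condition in part (1).

  Near a smooth boundary one touches with the distance to a ball of uniform radius lying outside
  \<open>\<Omega>\<close>. For part (2) let \<open>w\<close> be a boundary point nearest to \<open>y\<close> with inward normal \<open>\<nu>\<close>, and let the
  foot point of \<open>y + t e\<close> move along the parabola \<open>w + t a e' + t\<^sup>2 \<tau> \<nu>\<close>, where \<open>e'\<close> is the tangential
  part of \<open>e\<close> and \<open>\<tau>\<close> is chosen just small enough for the parabola to stay outside \<open>\<Omega>\<close>. Summing
  the resulting bounds over an orthonormal basis only involves the trace of the second
  fundamental form, and with a suitable factor \<open>a\<close> the hypothesis on the mean curvature is
  exactly what makes the sum nonnegative.\<close>

section \<open>Second differences of radial functions\<close>

text \<open>\<open>- ln d\<close> need not be differentiable where several boundary points are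
  nearest, and a touching function gives information at one point only. Comparison with harmonic
  functions would call for the Dirichlet problem on balls. Instead an explicit radial function is
  integrated against symmetric second differences, with translation invariance of Lebesgue measure
  in place of integration by parts; the limit under that integral is what calls for a locally
  uniform lower bound.

  Where \<open>d\<close> is smooth, d^2 times the Laplacian of \<open>- ln d\<close> is 1 plus the
  sum of d k_i / (1 - d k_i), the k_i being the principal curvatures at the foot point. A foot point
  moving with velocity \<open>a\<close> in a direction of curvature k yields the lower bound d a^2 k
  - (1 - a)^2, whose maximum over \<open>a\<close>, for d k < 1, is d k / (1 - d k). One common
  \<open>a\<close> for all directions replaces this convex function of k by a tangent line, as in
  Jensen's inequality, and so only the sum of the k_i survives.\<close>

lemma second_difference_tendsto:
  fixes p p' :: "real \<Rightarrow> real"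
  assumes p: "\<forall>\<^sub>F t in nhds 0. (p has_real_derivative p' t) (at t)"
    and p': "(p' has_real_derivative D) (at 0)"
  shows "((\<lambda>t. (p t + p (- t) - 2 * p 0) / t\<^sup>2) \<longlongrightarrow> D) (at_right 0)"
proof -
  obtain d where d: "d > 0" and dp: "\<And>t. \<bar>t\<bar> < d \<Longrightarrow> (p has_real_derivative p' t) (at t)"
    using p by (auto simp: eventually_nhds_metric dist_real_def)
  have ev: "\<forall>\<^sub>F t::real in at_right 0. 0 < t \<and> t < d"
    using d eventually_at_right_field by auto
  have cont: "isCont p 0"
    using dp[of 0] d DERIV_isCont by auto
  have t0: "(p \<longlongrightarrow> p 0) (at_right 0)"
    using cont by (simp add: isCont_def filterlim_at_split)
  have t1: "((\<lambda>t. p (- t)) \<longlongrightarrow> p 0) (at_right 0)"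
    using isCont_tendsto_compose[of "0::real" p "\<lambda>t. - t" "at_right 0"] cont
      tendsto_minus[OF tendsto_ident_at[of "0::real" "{0<..}"]] by simp
  \<comment> \<open>One application of l'Hopital leaves this quotient. It is the mean of two
    difference quotients of \<open>p'\<close> at 0, so differentiability of \<open>p'\<close> at
    that one point suffices.\<close>
  have "((\<lambda>t. (p' t - p' (- t)) / (2 * t)) \<longlongrightarrow> D) (at_right 0)"
  proof -
    have l: "((\<lambda>t. (p' t - p' 0) / t) \<longlongrightarrow> D) (at 0)"
      using p' by (simp add: has_field_derivative_iff)
    have r: "((\<lambda>t. p' (- t)) has_real_derivative - D) (at 0)"
      using DERIV_mirror[of p' D 0] p' by simp
    then have "((\<lambda>t. (p' (- t) - p' 0) / t) \<longlongrightarrow> - D) (at 0)"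
      by (simp add: has_field_derivative_iff)
    from tendsto_divide[OF tendsto_diff[OF l this] tendsto_const, of 2]
    have "((\<lambda>t. ((p' t - p' 0) / t - (p' (- t) - p' 0) / t) / 2) \<longlongrightarrow> D) (at 0)"
      by simp
    then have "((\<lambda>t. (p' t - p' (- t)) / (2 * t)) \<longlongrightarrow> D) (at 0)"
      by (rule Lim_transform_eventually) (auto simp: eventually_at_filter field_simps)
    then show ?thesis by (simp add: filterlim_at_split)
  qed
  then show ?thesis
  proof (rule lhopital_right_0[rotated -1])
    show "((\<lambda>t. p t + p (- t) - 2 * p 0) \<longlongrightarrow> 0) (at_right 0)"
      using tendsto_diff[OF tendsto_add[OF t0 t1] tendsto_const[of "2 * p 0"]] by simp
    show "((\<lambda>t::real. t\<^sup>2) \<longlongrightarrow> 0) (at_right 0)"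
      by (auto intro!: tendsto_eq_intros)
    show "\<forall>\<^sub>F t::real in at_right 0. t\<^sup>2 \<noteq> 0" "\<forall>\<^sub>F t::real in at_right 0. 2 * t \<noteq> 0"
      using ev by (auto elim: eventually_mono)
    show "\<forall>\<^sub>F t in at_right 0. ((\<lambda>t. p t + p (- t) - 2 * p 0) has_real_derivative p' t - p' (- t)) (at t)"
      using ev
    proof (rule eventually_mono)
      fix t :: real assume t: "0 < t \<and> t < d"
      have "((\<lambda>t. p (- t)) has_real_derivative - p' (- t)) (at t)"
        using DERIV_mirror[of p "p' (- t)" t] dp[of "- t"] t by simp
      then show "((\<lambda>t. p t + p (- t) - 2 * p 0) has_real_derivative p' t - p' (- t)) (at t)"
        using dp[of t] t by (auto intro!: derivative_eq_intros)
    qed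
    show "\<forall>\<^sub>F t in at_right 0. ((\<lambda>t::real. t\<^sup>2) has_real_derivative 2 * t) (at t)"
      by (auto intro!: always_eventually derivative_eq_intros)
  qed
qed

lemma composed_second_difference_tendsto:
  fixes G g Q Q' :: "real \<Rightarrow> real"
  assumes G: "\<forall>\<^sub>F q in nhds (Q 0). (G has_real_derivative g q) (at q)"
    and g: "(g has_real_derivative g') (at (Q 0))"
    and Q: "\<And>t. (Q has_real_derivative Q' t) (at t)"
    and Q': "(Q' has_real_derivative Q2) (at 0)"
  shows "((\<lambda>t. (G (Q t) + G (Q (- t)) - 2 * G (Q 0)) / t\<^sup>2) \<longlongrightarrow>
    g' * (Q' 0)\<^sup>2 + g (Q 0) * Q2) (at_right 0)"
proof (rule second_difference_tendsto)
  have "isCont Q 0" using Q DERIV_isCont by blast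
  then have "filterlim Q (nhds (Q 0)) (nhds 0)"
    by (simp add: isCont_def tendsto_at_iff_tendsto_nhds)
  then have "\<forall>\<^sub>F t in nhds 0. (G has_real_derivative g (Q t)) (at (Q t))"
    using G unfolding filterlim_iff by blast
  then show "\<forall>\<^sub>F t in nhds 0. ((\<lambda>t. G (Q t)) has_real_derivative g (Q t) * Q' t) (at t)"
    by (rule eventually_mono) (auto intro: DERIV_chain2 Q)
  show "((\<lambda>t. g (Q t) * Q' t) has_real_derivative g' * (Q' 0)\<^sup>2 + g (Q 0) * Q2) (at 0)"
    using DERIV_mult[OF DERIV_chain2[OF g Q] Q']
    by (simp add: power2_eq_square algebra_simps)
qed

lemma norm_sq_add_scaleR:
  fixes z e :: "'a::real_inner"
  assumes "norm e = 1"
  shows "(norm (z + t *\<^sub>R e))\<^sup>2 = (norm z)\<^sup>2 + 2 * t * (z \<bullet> e) + t\<^sup>2"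
proof -
  have "e \<bullet> e = 1" using assms by (simp add: norm_eq_1)
  then show ?thesis
    unfolding power2_norm_eq_inner
    by (simp add: inner_add_left inner_add_right inner_commute[of e z] power2_eq_square
        algebra_simps)
qed

text \<open>Radial functions are written in the squared norm because it is a quadratic polynomial
  along every line; the centre \<open>z = 0\<close> then needs no separate case.\<close>

lemma radial_second_difference_tendsto:
  fixes z e :: "'a::real_inner" and G g :: "real \<Rightarrow> real"
  assumes G: "\<forall>\<^sub>F q in nhds ((norm z)\<^sup>2). (G has_real_derivative g q) (at q)"
    and g: "(g has_real_derivative g') (at ((norm z)\<^sup>2))"
    and e: "norm e = 1"
  shows "((\<lambda>t. (G ((norm (z + t *\<^sub>R e))\<^sup>2) + G ((norm (z - t *\<^sub>R e))\<^sup>2) - 2 * G ((norm z)\<^sup>2)) / t\<^sup>2)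
    \<longlongrightarrow> 4 * g' * (z \<bullet> e)\<^sup>2 + 2 * g ((norm z)\<^sup>2)) (at_right 0)"
proof -
  define Q where "Q = (\<lambda>t. (norm z)\<^sup>2 + 2 * t * (z \<bullet> e) + t\<^sup>2)"
  have "((\<lambda>t. (G (Q t) + G (Q (- t)) - 2 * G (Q 0)) / t\<^sup>2) \<longlongrightarrow>
      g' * (2 * (z \<bullet> e) + 2 * 0)\<^sup>2 + g (Q 0) * 2) (at_right 0)"
    by (rule composed_second_difference_tendsto[where Q' = "\<lambda>t. 2 * (z \<bullet> e) + 2 * t"])
      (use G g in \<open>auto simp: Q_def intro!: derivative_eq_intros\<close>)
  moreover have "Q t = (norm (z + t *\<^sub>R e))\<^sup>2" for t
    by (simp add: Q_def norm_sq_add_scaleR[OF e])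
  moreover have "Q (- t) = (norm (z - t *\<^sub>R e))\<^sup>2" for t
    using norm_sq_add_scaleR[OF e, of z "- t"] by (simp add: Q_def)
  ultimately show ?thesis
    by (simp add: power_mult_distrib mult_ac)
qed

text \<open>In the variable q = |z|^2 the Laplacian of G(q) is 4 q G'' + 2 m G', since the squares
  of \<open>z \<bullet> e\<close> over the basis add up to q.\<close>

lemma radial_laplacian_tendsto:
  fixes z :: "'a::euclidean_space" and G g :: "real \<Rightarrow> real"
  assumes G: "\<forall>\<^sub>F q in nhds ((norm z)\<^sup>2). (G has_real_derivative g q) (at q)"
    and g: "(g has_real_derivative g') (at ((norm z)\<^sup>2))"
  shows "((\<lambda>t. \<Sum>e\<in>Basis. (G ((norm (z + t *\<^sub>R e))\<^sup>2) + G ((norm (z - t *\<^sub>R e))\<^sup>2) - 2 * G ((norm z)\<^sup>2)) / t\<^sup>2)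
    \<longlongrightarrow> 4 * g' * (norm z)\<^sup>2 + 2 * real DIM('a) * g ((norm z)\<^sup>2)) (at_right 0)"
proof -
  have *: "(\<Sum>e\<in>Basis. 4 * g' * (z \<bullet> e)\<^sup>2 + 2 * g ((norm z)\<^sup>2)) =
     4 * g' * (norm z)\<^sup>2 + 2 * real DIM('a) * g ((norm z)\<^sup>2)"
    unfolding power2_norm_eq_inner[of z] euclidean_inner[of z z]
    by (simp add: sum.distrib sum_distrib_left power2_eq_square)
  show ?thesis
    unfolding *[symmetric]
    by (intro tendsto_sum radial_second_difference_tendsto[OF G g]) auto
qed

section \<open>The radial test function and its Laplacian\<close>

lemma powr_max_lipschitz:
  fixes a p :: real
  assumes a: "a > 0" and p: "p \<ge> 0"
  shows "\<bar>max u a powr (- p) - max v a powr (- p)\<bar> \<le> p * a powr (- p - 1) * \<bar>u - v\<bar>"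
proof -
  have "norm (max u a powr (- p) - max v a powr (- p)) \<le> p * a powr (- p - 1) * norm (max u a - max v a)"
  proof (rule field_differentiable_bound[of "{a..}" _ "\<lambda>q. - p * q powr (- p - 1)"])
    fix q assume q: "q \<in> {a..}"
    show "((\<lambda>q. q powr - p) has_real_derivative - p * q powr (- p - 1)) (at q within {a..})"
      using q a by (auto intro!: derivative_eq_intros simp: field_simps powr_diff)
    \<comment> \<open>Truncation at \<open>a\<close> keeps away from the singularity at 0; beyond
      \<open>a\<close> the derivative is largest in modulus at \<open>a\<close> itself.\<close>
    have "q powr (- p - 1) \<le> a powr (- p - 1)"
      using q a p by (intro powr_mono2') auto
    then show "norm (- p * q powr (- p - 1)) \<le> p * a powr (- p - 1)"
      using p by (simp add: abs_mult mult_left_mono)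
  qed auto
  also have "\<dots> \<le> p * a powr (- p - 1) * \<bar>u - v\<bar>"
    using p by (intro mult_left_mono) auto
  finally show ?thesis by simp
qed

text \<open>\<open>G\<close> is only C^1 with Lipschitz derivative, so the bound comes from
  first-order Taylor expansion with quadratic remainder: the terms linear in \<open>t\<close> cancel
  between the two sides. It will serve as domination in a limit of integrals.\<close>

lemma radial_second_difference_bound:
  fixes z e :: "'a::real_inner" and G k :: "real \<Rightarrow> real"
  assumes G: "\<And>q. (G has_real_derivative - k q) (at q)"
    and M: "\<And>q. \<bar>k q\<bar> \<le> M" and L: "\<And>a b. \<bar>k a - k b\<bar> \<le> L * \<bar>a - b\<bar>"
    and e: "norm e = 1" and t: "\<bar>t\<bar> \<le> 1"
  shows "\<bar>G ((norm (z + t *\<^sub>R e))\<^sup>2) + G ((norm (z - t *\<^sub>R e))\<^sup>2) - 2 * G ((norm z)\<^sup>2)\<bar>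
    \<le> (2 * M + 2 * L * (2 * norm z + 1)\<^sup>2) * t\<^sup>2"
proof -
  have L0: "L \<ge> 0" using order_trans[OF abs_ge_zero L[of 0 1]] by simp
  have taylor: "\<bar>G b - G a + k a * (b - a)\<bar> \<le> L * (b - a)\<^sup>2" for a b
  proof -
    \<comment> \<open>Mean value inequality for \<open>G q + k a * q\<close>, whose derivative
      \<open>k a - k q\<close> is at most \<open>L * \<bar>b - a\<bar>\<close> in modulus between
      \<open>a\<close> and \<open>b\<close>.\<close>
    have "norm ((G b + k a * b) - (G a + k a * a)) \<le> (L * \<bar>b - a\<bar>) * norm (b - a)"
    proof (rule field_differentiable_bound[of "closed_segment a b" _ "\<lambda>q. - k q + k a"])
      fix q assume q: "q \<in> closed_segment a b"
      show "((\<lambda>q. G q + k a * q) has_real_derivative - k q + k a) (at q within closed_segment a b)"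
        by (auto intro!: derivative_eq_intros has_field_derivative_at_within[OF G])
      have "\<bar>q - a\<bar> \<le> \<bar>b - a\<bar>" using q by (auto simp: closed_segment_eq_real_ivl split: if_splits)
      then have "L * \<bar>q - a\<bar> \<le> L * \<bar>b - a\<bar>" using L0 by (intro mult_left_mono)
      moreover have "\<bar>k q - k a\<bar> \<le> L * \<bar>q - a\<bar>" by (rule L)
      ultimately show "norm (- k q + k a) \<le> L * \<bar>b - a\<bar>" by (simp add: abs_minus_commute)
    qed auto
    then show ?thesis by (simp add: power2_eq_square algebra_simps)
  qed
  define a where "a = (norm z)\<^sup>2"
  define bp where "bp = (norm (z + t *\<^sub>R e))\<^sup>2"
  define bm where "bm = (norm (z - t *\<^sub>R e))\<^sup>2"
  have bp: "bp - a = 2 * t * (z \<bullet> e) + t\<^sup>2"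
    unfolding bp_def a_def using norm_sq_add_scaleR[OF e, of z t] by simp
  have bm: "bm - a = - 2 * t * (z \<bullet> e) + t\<^sup>2"
    unfolding bm_def a_def using norm_sq_add_scaleR[OF e, of z "- t"] by simp
  have ze: "\<bar>z \<bullet> e\<bar> \<le> norm z" using Cauchy_Schwarz_ineq2[of z e] e by simp
  have sq: "(2 * t * c + t\<^sup>2)\<^sup>2 \<le> (2 * norm z + 1)\<^sup>2 * t\<^sup>2" if c: "\<bar>c\<bar> \<le> norm z" for c
  proof -
    have "\<bar>2 * c + t\<bar> \<le> 2 * norm z + 1" using c t by linarith
    then have "(2 * c + t)\<^sup>2 \<le> (2 * norm z + 1)\<^sup>2" by (meson abs_le_square_iff abs_ge_self order_trans)
    moreover have "(2 * t * c + t\<^sup>2)\<^sup>2 = (2 * c + t)\<^sup>2 * t\<^sup>2"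
      by (simp add: power2_eq_square algebra_simps)
    ultimately show ?thesis by (simp add: mult_right_mono)
  qed
  have 1: "(bp - a)\<^sup>2 \<le> (2 * norm z + 1)\<^sup>2 * t\<^sup>2" unfolding bp using sq ze by blast
  have 2: "(bm - a)\<^sup>2 \<le> (2 * norm z + 1)\<^sup>2 * t\<^sup>2" unfolding bm using sq[of "- (z \<bullet> e)"] ze by simp
  have "\<bar>G bp - G a + k a * (bp - a)\<bar> \<le> L * ((2 * norm z + 1)\<^sup>2 * t\<^sup>2)"
    using taylor[of bp a] mult_left_mono[OF 1 L0] by linarith
  moreover have "\<bar>G bm - G a + k a * (bm - a)\<bar> \<le> L * ((2 * norm z + 1)\<^sup>2 * t\<^sup>2)"
    using taylor[of bm a] mult_left_mono[OF 2 L0] by linarith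
  moreover have "k a * (bp - a) + k a * (bm - a) = 2 * (k a * t\<^sup>2)"
    unfolding bp bm by (simp add: algebra_simps)
  moreover have "\<bar>k a * t\<^sup>2\<bar> \<le> M * t\<^sup>2"
    using M[of a] by (simp add: abs_mult mult_right_mono)
  ultimately have "\<bar>G bp + G bm - 2 * G a\<bar> \<le> 2 * (M * t\<^sup>2) + 2 * (L * ((2 * norm z + 1)\<^sup>2 * t\<^sup>2))"
    by linarith
  then show ?thesis unfolding a_def bp_def bm_def by (simp add: algebra_simps)
qed

text \<open>With \<open>p = m / 2\<close>, the function \<open>G (|y|\<^sup>2)\<close> is a multiple of the difference of the Newtonian
  potentials of the uniform probability measures on the balls of radius \<open>s\<close> and \<open>r\<close>; prescribing
  \<open>G'\<close> instead of \<open>G\<close> treats all dimensions alike.\<close>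

lemma radial_test_profile:
  fixes r s p :: real
  assumes s: "0 < s" and sr: "s < r" and p: "p \<ge> 0"
  obtains G k :: "real \<Rightarrow> real" and M L where
    "\<And>q. (G has_real_derivative - k q) (at q)"
    "\<And>q. r\<^sup>2 \<le> q \<Longrightarrow> G q = 0" "\<And>q. 0 \<le> G q" "\<And>q. 0 \<le> q \<Longrightarrow> G q \<le> G 0"
    "\<And>q. \<bar>k q\<bar> \<le> M" "\<And>a b. \<bar>k a - k b\<bar> \<le> L * \<bar>a - b\<bar>"
    "\<And>q. k q = max q (s\<^sup>2) powr (- p) - max q (r\<^sup>2) powr (- p)"
proof -
  define k where "k = (\<lambda>q. max q (s\<^sup>2) powr (- p) - max q (r\<^sup>2) powr (- p))"
  define L where "L = p * (s\<^sup>2) powr (- p - 1) + p * (r\<^sup>2) powr (- p - 1)"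
  have s2: "s\<^sup>2 > 0" and r2: "r\<^sup>2 > 0" and sr2: "s\<^sup>2 < r\<^sup>2"
    using s sr by (auto intro: power_strict_mono)
  have k0: "0 \<le> k q" for q
  proof -
    have "max q (r\<^sup>2) powr (- p) \<le> max q (s\<^sup>2) powr (- p)"
      using s2 sr2 p by (intro powr_mono2') (auto simp: less_max_iff_disj)
    then show ?thesis by (simp add: k_def)
  qed
  have kM: "\<bar>k q\<bar> \<le> (s\<^sup>2) powr (- p)" for q
  proof -
    have "max q (s\<^sup>2) powr (- p) \<le> (s\<^sup>2) powr (- p)"
      using s2 p by (intro powr_mono2') auto
    moreover have "max q (r\<^sup>2) powr (- p) \<ge> 0" by simp
    ultimately show ?thesis using k0[of q] unfolding k_def by linarith
  qed
  have kL: "\<bar>k a - k b\<bar> \<le> L * \<bar>a - b\<bar>" for a b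
  proof -
    have tri: "\<bar>(A - B) - (A' - B')\<bar> \<le> \<bar>A - A'\<bar> + \<bar>B - B'\<bar>" for A B A' B' :: real
      by linarith
    show ?thesis
      unfolding k_def L_def distrib_right
      by (rule order_trans[OF tri add_mono[OF powr_max_lipschitz[OF s2 p] powr_max_lipschitz[OF r2 p]]])
  qed
  have kc: "isCont (\<lambda>q. - k q) x" for x
  proof -
    have "max x (s\<^sup>2) \<noteq> 0" "max x (r\<^sup>2) \<noteq> 0" using s2 r2 by linarith+
    then show ?thesis unfolding k_def by (intro continuous_intros) auto
  qed
  \<comment> \<open>Truncation makes \<open>k\<close> continuous on the whole line, so a global
    antiderivative exists. The shift below makes \<open>G\<close> vanish from
    \<open>r\<^sup>2\<close> on, where \<open>k\<close> is 0.\<close>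
  obtain F where F: "\<And>x. (F has_vector_derivative - k x) (at x)"
    using einterval_antiderivative[of "- \<infinity>" \<infinity> "\<lambda>q. - k q"] kc by auto
  define G where "G = (\<lambda>q. F q - F (r\<^sup>2))"
  have G: "(G has_real_derivative - k q) (at q)" for q
    unfolding G_def using F[of q]
    by (auto intro!: derivative_eq_intros simp: has_real_derivative_iff_has_vector_derivative)
  have anti: "G b \<le> G a" if "a \<le> b" for a b
    using that by (rule DERIV_nonpos_imp_nonincreasing) (use G k0 in fastforce)
  have Gz: "G q = 0" if q: "r\<^sup>2 \<le> q" for q
  proof -
    have "G q = G (r\<^sup>2)"
    proof (cases "q = r\<^sup>2")
      case False
      with q have "r\<^sup>2 < q" by simp
      then obtain z where z: "r\<^sup>2 < z" "z < q" "G q - G (r\<^sup>2) = (q - r\<^sup>2) * (- k z)"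
        using MVT2[of "r\<^sup>2" q G "\<lambda>q. - k q"] G by blast
      then have "k z = 0" using sr2 by (simp add: k_def max_def)
      then show ?thesis using z by simp
    qed simp
    then show ?thesis by (simp add: G_def)
  qed
  have "0 \<le> G q" for q
    using anti[of q "max q (r\<^sup>2)"] Gz[of "max q (r\<^sup>2)"] by simp
  then show thesis
    using that[of G k "(s\<^sup>2) powr (- p)" L] G Gz anti kM kL by (simp add: k_def)
qed

text \<open>Inside radius \<open>s\<close> the function is affine in |z|^2, between \<open>s\<close>
  and \<open>r\<close> it is a harmonic function plus a multiple of |z|^2, and outside it is 0. On
  the two spheres \<open>k\<close> has kinks; they are excluded here and are null sets.\<close>

lemma radial_test_laplacian:
  fixes z :: "'a::euclidean_space" and G k :: "real \<Rightarrow> real"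
  assumes s: "0 < s" and sr: "s < r"
    and G: "\<And>q. (G has_real_derivative - k q) (at q)"
    and k: "\<And>q. k q = max q (s\<^sup>2) powr (- (real DIM('a) / 2)) - max q (r\<^sup>2) powr (- (real DIM('a) / 2))"
    and z: "norm z \<noteq> s" "norm z \<noteq> r"
  shows "((\<lambda>t. \<Sum>e\<in>Basis. (G ((norm (z + t *\<^sub>R e))\<^sup>2) + G ((norm (z - t *\<^sub>R e))\<^sup>2) - 2 * G ((norm z)\<^sup>2)) / t\<^sup>2)
    \<longlongrightarrow> 2 * real DIM('a) * (indicator (cball 0 r) z * (r\<^sup>2) powr (- (real DIM('a) / 2))
       - indicator (cball 0 s) z * (s\<^sup>2) powr (- (real DIM('a) / 2)))) (at_right 0)"
proof -
  define p where "p = real DIM('a) / 2"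
  define q where "q = (norm z)\<^sup>2"
  have s2: "s\<^sup>2 > 0" and sr2: "s\<^sup>2 < r\<^sup>2"
    using s sr by (auto intro: power_strict_mono)
  have lim: "((\<lambda>t. \<Sum>e\<in>Basis. (G ((norm (z + t *\<^sub>R e))\<^sup>2) + G ((norm (z - t *\<^sub>R e))\<^sup>2) - 2 * G ((norm z)\<^sup>2)) / t\<^sup>2)
      \<longlongrightarrow> 4 * (- k') * q + 2 * real DIM('a) * (- k q)) (at_right 0)"
    if "(k has_real_derivative k') (at q)" for k'
    unfolding q_def
    by (rule radial_laplacian_tendsto[where g = "\<lambda>q. - k q"])
      (use G that in \<open>auto simp: q_def intro!: derivative_intros\<close>)
  consider "q < s\<^sup>2" | "s\<^sup>2 < q" "q < r\<^sup>2" | "r\<^sup>2 < q"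
    using z s sr unfolding q_def
    by (metis linorder_neqE_linordered_idom norm_ge_zero order.strict_implies_order power2_eq_iff_nonneg order_trans)
  then show ?thesis
  proof cases
    case 1
    have "(k has_real_derivative 0) (at q)"
    proof (rule has_field_derivative_transform_within_open)
      show "((\<lambda>_. (s\<^sup>2) powr (- p) - (r\<^sup>2) powr (- p)) has_real_derivative 0) (at q)" by simp
      show "open {..< s\<^sup>2}" "q \<in> {..< s\<^sup>2}" using 1 by auto
      show "\<And>x. x \<in> {..<s\<^sup>2} \<Longrightarrow> (s\<^sup>2) powr (- p) - (r\<^sup>2) powr (- p) = k x"
        using sr2 by (auto simp: k p_def max_def)
    qed
    moreover have "norm z < s" using 1 s unfolding q_def by (simp add: power2_less_imp_less)
    ultimately show ?thesis using lim[of 0] 1 sr sr2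
      by (simp add: k p_def max_def indicator_def algebra_simps)
  next
    case 2
    have "(k has_real_derivative - p * q powr (- p - 1)) (at q)"
    proof (rule has_field_derivative_transform_within_open)
      show "((\<lambda>q. q powr (- p) - (r\<^sup>2) powr (- p)) has_real_derivative - p * q powr (- p - 1)) (at q)"
        using less_trans[OF s2 2(1)]
        by (auto intro!: derivative_eq_intros simp: field_simps powr_diff)
      show "open {s\<^sup>2<..< r\<^sup>2}" "q \<in> {s\<^sup>2<..< r\<^sup>2}" using 2 by auto
      show "\<And>x. x \<in> {s\<^sup>2<..<r\<^sup>2} \<Longrightarrow> x powr (- p) - (r\<^sup>2) powr (- p) = k x"
        using sr2 by (auto simp: k p_def max_def)
    qed
    note der = this
    have z: "norm z < r" "s < norm z"
      using 2 s sr unfolding q_def by (auto intro: power2_less_imp_less)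
    \<comment> \<open>As \<open>4 * p\<close> is twice the dimension, all contributions of
      \<open>q powr (- p)\<close> cancel. This is harmonicity of the Newtonian part; only the
      constant with \<open>r\<close> remains.\<close>
    have "q powr (- p - 1) * q = q powr (- p)"
      using less_trans[OF s2 2(1)] by (simp add: powr_diff)
    then have "4 * (p * (q powr (- p - 1) * q)) = 2 * real DIM('a) * q powr (- p)"
      unfolding p_def by simp
    then have "4 * - (- p * q powr (- p - 1)) * q = 2 * real DIM('a) * q powr (- p)"
      by (simp add: mult.assoc)
    moreover have "k q = q powr (- p) - (r\<^sup>2) powr (- p)"
      using 2 by (simp add: k p_def max_def)
    ultimately have "4 * - (- p * q powr (- p - 1)) * q + 2 * real DIM('a) * - k q =
      2 * real DIM('a) * (r\<^sup>2) powr (- p)"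
      by (simp add: right_diff_distrib)
    then show ?thesis using lim[OF der] z
      by (simp add: indicator_def flip: p_def)
  next
    case 3
    have "(k has_real_derivative 0) (at q)"
    proof (rule has_field_derivative_transform_within_open)
      show "((\<lambda>_. 0) has_real_derivative 0) (at q)" by simp
      show "open {r\<^sup>2 <..}" "q \<in> {r\<^sup>2 <..}" using 3 by auto
      show "\<And>x. x \<in> {r\<^sup>2<..} \<Longrightarrow> 0 = k x"
        using sr2 by (auto simp: k p_def max_def)
    qed
    moreover have "r < norm z" using 3 s sr unfolding q_def by (simp add: power2_less_imp_less)
    ultimately show ?thesis using lim[of 0] 3 sr sr2
      by (simp add: k p_def max_def indicator_def algebra_simps)
  qed
qed

lemma lborel_translate:
  fixes f :: "'a::euclidean_space \<Rightarrow> real"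
  assumes [measurable]: "f \<in> borel_measurable borel"
  shows "integrable lborel (\<lambda>y. f (y + c)) \<longleftrightarrow> integrable lborel f"
    and "(\<integral>y. f (y + c) \<partial>lborel) = (\<integral>y. f y \<partial>lborel)"
proof -
  have d: "distr lborel borel ((+) c) = lborel" by (rule lborel_distr_plus)
  have "integrable (distr lborel borel ((+) c)) f \<longleftrightarrow> integrable lborel (\<lambda>y. f (c + y))"
    by (rule integrable_distr_eq) auto
  then show "integrable lborel (\<lambda>y. f (y + c)) \<longleftrightarrow> integrable lborel f"
    by (simp add: d add.commute)
  have "(\<integral>y. f y \<partial>(distr lborel borel ((+) c))) = (\<integral>y. f (c + y) \<partial>lborel)"
    by (rule integral_distr) auto
  then show "(\<integral>y. f (y + c) \<partial>lborel) = (\<integral>y. f y \<partial>lborel)"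
    by (simp add: d add.commute)
qed

section \<open>A sub-mean-value criterion\<close>

definition second_difference :: "('a::real_vector \<Rightarrow> real) \<Rightarrow> real \<Rightarrow> 'a \<Rightarrow> 'a \<Rightarrow> real" where
  "second_difference f t e y = f (y + t *\<^sub>R e) + f (y - t *\<^sub>R e) - 2 * f y"

definition discrete_laplacian :: "('a::euclidean_space \<Rightarrow> real) \<Rightarrow> real \<Rightarrow> 'a \<Rightarrow> real" where
  "discrete_laplacian f t y = (\<Sum>e\<in>Basis. second_difference f t e y / t\<^sup>2)"

lemma discrete_laplacian_bound:
  fixes f :: "'a::euclidean_space \<Rightarrow> real"
  assumes "\<And>e. e \<in> Basis \<Longrightarrow> \<bar>second_difference f t e y\<bar> \<le> C * t\<^sup>2" "t > 0"
  shows "\<bar>discrete_laplacian f t y\<bar> \<le> real DIM('a) * C"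
proof -
  have "\<bar>discrete_laplacian f t y\<bar> \<le> (\<Sum>e\<in>(Basis::'a set). \<bar>second_difference f t e y / t\<^sup>2\<bar>)"
    unfolding discrete_laplacian_def by (rule sum_abs)
  also have "\<dots> \<le> (\<Sum>e\<in>(Basis::'a set). C)"
    using assms by (intro sum_mono) (simp add: field_simps)
  finally show ?thesis by simp
qed

lemma discrete_laplacian_lower_bound:
  fixes f :: "'a::euclidean_space \<Rightarrow> real"
  assumes "\<And>e. e \<in> Basis \<Longrightarrow> - C * t\<^sup>2 \<le> second_difference f t e y" "t > 0"
  shows "- (real DIM('a) * C) \<le> discrete_laplacian f t y"
proof -
  have "- (real DIM('a) * C) = (\<Sum>e\<in>(Basis::'a set). - C)" by simp
  also have "\<dots> \<le> discrete_laplacian f t y"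
    unfolding discrete_laplacian_def using assms by (intro sum_mono) (simp add: field_simps)
  finally show ?thesis .
qed

text \<open>A discrete Green identity: each second-difference operator is symmetric with respect to
  Lebesgue measure, which is translation invariant. There are no boundary terms because both
  functions live on the whole space.\<close>

lemma integral_discrete_laplacian_swap:
  fixes v \<psi> :: "'a::euclidean_space \<Rightarrow> real"
  assumes v: "integrable lborel v" and [measurable]: "\<psi> \<in> borel_measurable borel"
    and b: "\<And>y. \<bar>\<psi> y\<bar> \<le> B"
  shows "integrable lborel (\<lambda>y. v y * discrete_laplacian \<psi> t y)"
    "integrable lborel (\<lambda>y. discrete_laplacian v t y * \<psi> y)"
    "(\<integral>y. v y * discrete_laplacian \<psi> t y \<partial>lborel) = (\<integral>y. discrete_laplacian v t y * \<psi> y \<partial>lborel)"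
proof -
  have [measurable]: "v \<in> borel_measurable borel" using v by auto
  have i1: "integrable lborel (\<lambda>y. v y * \<psi> (y + c))" for c
  proof (rule Bochner_Integration.integrable_bound)
    show "integrable lborel (\<lambda>y. B * v y)" using v by simp
    show "AE x in lborel. norm (v x * \<psi> (x + c)) \<le> norm (B * v x)"
    proof (rule AE_I2)
      fix x :: 'a
      have "\<bar>\<psi> (x + c)\<bar> \<le> \<bar>B\<bar>" using b[of "x + c"] by linarith
      then show "norm (v x * \<psi> (x + c)) \<le> norm (B * v x)"
        by (simp add: abs_mult mult.commute[of "\<bar>v x\<bar>"] mult_right_mono)
    qed
  qed measurable
  have i2: "integrable lborel (\<lambda>y. v (y - c) * \<psi> y)"
    and e: "(\<integral>y. v y * \<psi> (y + c) \<partial>lborel) = (\<integral>y. v (y - c) * \<psi> y \<partial>lborel)" for c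
    using lborel_translate[of "\<lambda>y. v (y - c) * \<psi> y" c] i1[of c] by simp_all
  note i = i1[of "- c" for c, simplified] i1[of "0", simplified] i1 i2 i2[of "- c" for c, simplified]
  have L: "v y * discrete_laplacian \<psi> t y = (\<Sum>e\<in>Basis. (v y * \<psi> (y + t *\<^sub>R e) + v y * \<psi> (y - t *\<^sub>R e) - 2 * (v y * \<psi> y)) / t\<^sup>2)"
    for y unfolding discrete_laplacian_def second_difference_def sum_distrib_left
    by (intro sum.cong refl) (simp add: algebra_simps)
  have R: "discrete_laplacian v t y * \<psi> y = (\<Sum>e\<in>Basis. (v (y + t *\<^sub>R e) * \<psi> y + v (y - t *\<^sub>R e) * \<psi> y - 2 * (v y * \<psi> y)) / t\<^sup>2)"
    for y unfolding discrete_laplacian_def second_difference_def sum_distrib_right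
    by (intro sum.cong refl) (simp add: algebra_simps)
  show "integrable lborel (\<lambda>y. v y * discrete_laplacian \<psi> t y)"
    unfolding L by (intro Bochner_Integration.integrable_sum integrable_divide_zero
        Bochner_Integration.integrable_add Bochner_Integration.integrable_diff integrable_mult_right i)
  show "integrable lborel (\<lambda>y. discrete_laplacian v t y * \<psi> y)"
    unfolding R by (intro Bochner_Integration.integrable_sum integrable_divide_zero
        Bochner_Integration.integrable_add Bochner_Integration.integrable_diff integrable_mult_right i)
  have "(\<integral>y. v y * \<psi> (y + c) \<partial>lborel) + (\<integral>y. v y * \<psi> (y - c) \<partial>lborel) =
      (\<integral>y. v (y + c) * \<psi> y \<partial>lborel) + (\<integral>y. v (y - c) * \<psi> y \<partial>lborel)" for c
    using e[of c] e[of "- c"] by simp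
  then show "(\<integral>y. v y * discrete_laplacian \<psi> t y \<partial>lborel) = (\<integral>y. discrete_laplacian v t y * \<psi> y \<partial>lborel)"
    unfolding L R by (simp add: i)
qed

lemma compact_neighbourhood_in_open:
  fixes S K :: "'a::euclidean_space set"
  assumes "open S" "compact K" "K \<subseteq> S"
  obtains \<delta> C where "\<delta> > 0" "compact C" "C \<subseteq> S" "\<And>y z. y \<in> K \<Longrightarrow> dist y z \<le> \<delta> \<Longrightarrow> z \<in> C"
proof -
  obtain e where e: "e > 0" "(\<Union>x\<in>K. ball x e) \<subseteq> S"
    using compact_subset_open_imp_ball_epsilon_subset[OF assms(2,1,3)] by auto
  define C where "C = {y + z | y z. y \<in> K \<and> z \<in> cball 0 (e / 2)}"
  show thesis
  proof (rule that)
    show "e / 2 > 0" using e by simp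
    show "compact C" unfolding C_def by (intro compact_sums assms compact_cball)
    show "C \<subseteq> S"
    proof
      fix w assume "w \<in> C"
      then obtain y z where "w = y + z" "y \<in> K" "norm z \<le> e / 2" by (auto simp: C_def)
      then have "w \<in> ball y e" using e by (simp add: dist_norm)
      then show "w \<in> S" using e \<open>y \<in> K\<close> by blast
    qed
    fix y z assume "y \<in> K" "dist y z \<le> e / 2"
    then show "z \<in> C" unfolding C_def
      by (intro CollectI exI[of _ y] exI[of _ "z - y"]) (auto simp: dist_norm norm_minus_commute)
  qed
qed

text \<open>The second differences are moved from \<open>u\<close> to the radial test function, whose Laplacian is a
  difference of normalised indicators of the two balls. The uniform lower bound \<open>low\<close> is what
  permits passing to the limit in the integral of \<open>u\<close>'s own (only pointwise controlled)
  second differences.\<close>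

lemma scaled_ball_integral_mono:
  fixes u :: "'a::euclidean_space \<Rightarrow> real"
  assumes S: "open S" "continuous_on S u" "cball x r \<subseteq> S"
    and s: "0 < s" "s < r"
    and \<delta>: "\<delta> > 0"
    and low: "\<And>y e t. y \<in> cball x r \<Longrightarrow> e \<in> Basis \<Longrightarrow> 0 < t \<Longrightarrow> t < \<delta> \<Longrightarrow>
      - K * t\<^sup>2 \<le> second_difference u t e y"
    and lap: "\<And>y \<eta>. y \<in> cball x r \<Longrightarrow> \<eta> > 0 \<Longrightarrow> \<forall>\<^sub>F t in at_right 0. - \<eta> \<le> discrete_laplacian u t y"
  shows "(LINT y:cball x s|lborel. u y) * (s\<^sup>2) powr (- (real DIM('a) / 2))
     \<le> (LINT y:cball x r|lborel. u y) * (r\<^sup>2) powr (- (real DIM('a) / 2))"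
proof -
  obtain G k M L where
    G: "\<And>q. (G has_real_derivative - k q) (at q)" and
    Gz: "\<And>q. r\<^sup>2 \<le> q \<Longrightarrow> G q = 0" and G0: "\<And>q. 0 \<le> G q" and GM: "\<And>q. 0 \<le> q \<Longrightarrow> G q \<le> G 0" and
    kM: "\<And>q. \<bar>k q\<bar> \<le> M" and kL: "\<And>a b. \<bar>k a - k b\<bar> \<le> L * \<bar>a - b\<bar>" and
    k: "\<And>q. k q = max q (s\<^sup>2) powr (- (real DIM('a) / 2)) - max q (r\<^sup>2) powr (- (real DIM('a) / 2))"
    by (rule radial_test_profile[OF s, of "real DIM('a) / 2"]) (simp, rule that, assumption+)
  obtain \<delta>1 C where \<delta>1: "\<delta>1 > 0" and C: "compact C" "C \<subseteq> S"
    and CC: "\<And>y z. y \<in> cball x r \<Longrightarrow> dist y z \<le> \<delta>1 \<Longrightarrow> z \<in> C"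
    using compact_neighbourhood_in_open[OF S(1) compact_cball S(3)] by metis
  define d where "d = min (min \<delta> \<delta>1) 1"
  have d: "0 < d" "d \<le> \<delta>" "d \<le> \<delta>1" "d \<le> 1" using \<delta> \<delta>1 by (auto simp: d_def)
  \<comment> \<open>Dominated convergence is stated for sequences, so \<open>t\<close> runs through
    \<open>\<tau>\<close>. The shift by 2 makes \<open>\<tau> n < d\<close> strict from
    \<open>n = 0\<close> on.\<close>
  define \<tau> where "\<tau> = (\<lambda>n. d / real (n + 2))"
  have \<tau>0: "\<tau> n > 0" and \<tau>d: "\<tau> n < d" for n
    using d by (auto simp: \<tau>_def field_simps add_pos_nonneg)
  have \<tau>lim: "filterlim \<tau> (at_right 0) sequentially"
  proof -
    have "\<tau> \<longlonglongrightarrow> 0" unfolding \<tau>_def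
      by (intro real_tendsto_divide_at_top[OF tendsto_const])
        (rule filterlim_compose[OF filterlim_real_sequentially filterlim_add_const_nat_at_top])
    moreover have "\<tau> n \<noteq> 0" for n using \<tau>0[of n] by simp
    ultimately show ?thesis using \<tau>0 by (auto simp: filterlim_at)
  qed
  \<comment> \<open>Extension by zero makes \<open>u\<close> globally integrable. From a point of
    \<open>cball x r\<close>, steps shorter than \<open>d\<close> stay in \<open>C\<close>, so there
    the second differences of \<open>v\<close> and \<open>u\<close> agree.\<close>
  define v where "v = (\<lambda>y. indicator C y * u y)"
  define \<psi> where "\<psi> = (\<lambda>y. G ((norm (y - x))\<^sup>2))"
  have Cr: "cball x r \<subseteq> C" using CC \<delta>1 by (auto intro: CC)
  have v: "integrable lborel v"
    using borel_integrable_compact[OF C(1) continuous_on_subset[OF S(2) C(2)]] by (simp add: v_def)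
  have Gcont: "continuous_on UNIV G"
    using G by (meson DERIV_isCont continuous_at_imp_continuous_on)
  have "continuous_on UNIV \<psi>"
    unfolding \<psi>_def by (intro continuous_on_compose2[OF Gcont] continuous_intros) auto
  then have \<psi>m[measurable]: "\<psi> \<in> borel_measurable borel" by (rule borel_measurable_continuous_onI)
  have vm[measurable]: "v \<in> borel_measurable borel" using v by auto
  have \<psi>b: "\<bar>\<psi> y\<bar> \<le> G 0" for y unfolding \<psi>_def using G0 GM by simp
  note swap = integral_discrete_laplacian_swap[OF v \<psi>m \<psi>b]
  define \<Lambda> where "\<Lambda> = (\<lambda>y. 2 * real DIM('a) * (indicator (cball x r) y * (r\<^sup>2) powr (- (real DIM('a) / 2))
       - indicator (cball x s) y * (s\<^sup>2) powr (- (real DIM('a) / 2))))"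
  have \<Lambda>m[measurable]: "\<Lambda> \<in> borel_measurable borel"
    unfolding \<Lambda>_def by (intro borel_measurable_times borel_measurable_diff
        borel_measurable_const borel_measurable_indicator) auto
  have Lm[measurable]: "(\<lambda>y. discrete_laplacian f t y) \<in> borel_measurable borel"
    if [measurable]: "f \<in> borel_measurable borel" for f :: "'a \<Rightarrow> real" and t
    unfolding discrete_laplacian_def second_difference_def by measurable
  obtain R where R: "\<And>y. y \<in> C \<Longrightarrow> norm (y - x) \<le> R"
  proof -
    have "bounded ((\<lambda>y. y - x) ` C)"
      by (intro compact_imp_bounded compact_continuous_image continuous_intros C)
    then show thesis using that by (auto simp: bounded_iff)
  qed
  have R0: "R \<ge> 0" using R[of x] Cr s by (auto simp: subset_iff)
  have L0: "L \<ge> 0" using order_trans[OF abs_ge_zero kL[of 0 1]] by simp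
  \<comment> \<open>\<open>v\<close> vanishes outside the bounded set \<open>C\<close>, so the bound
    on the second differences of \<open>\<psi>\<close>, which grows with the distance from
    \<open>x\<close>, is needed only up to distance \<open>R\<close>.\<close>
  define B where "B = real DIM('a) * (2 * M + 2 * L * (2 * R + 1)\<^sup>2)"
  have bound: "\<bar>v y * discrete_laplacian \<psi> (\<tau> n) y\<bar> \<le> B * \<bar>v y\<bar>" for y n
  proof (cases "y \<in> C")
    case True
    have "\<bar>discrete_laplacian \<psi> (\<tau> n) y\<bar> \<le> B" unfolding B_def
    proof (rule discrete_laplacian_bound)
      fix e :: 'a assume e: "e \<in> Basis"
      have "\<bar>second_difference \<psi> (\<tau> n) e y\<bar> \<le> (2 * M + 2 * L * (2 * norm (y - x) + 1)\<^sup>2) * (\<tau> n)\<^sup>2"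
        using radial_second_difference_bound[OF G kM kL, of e "\<tau> n" "y - x"] e \<tau>0[of n] \<tau>d[of n] d
        by (simp add: second_difference_def \<psi>_def algebra_simps)
      also have "\<dots> \<le> (2 * M + 2 * L * (2 * R + 1)\<^sup>2) * (\<tau> n)\<^sup>2"
        using R[OF True] L0 by (intro mult_right_mono add_left_mono mult_left_mono power_mono) auto
      finally show "\<bar>second_difference \<psi> (\<tau> n) e y\<bar> \<le> (2 * M + 2 * L * (2 * R + 1)\<^sup>2) * (\<tau> n)\<^sup>2" .
    qed (rule \<tau>0)
    then show ?thesis by (simp add: abs_mult mult.commute[of "\<bar>v y\<bar>"] mult_right_mono)
  qed (simp add: v_def)
  have lim1: "(\<lambda>n. \<integral>y. v y * discrete_laplacian \<psi> (\<tau> n) y \<partial>lborel) \<longlonglongrightarrow> (\<integral>y. v y * \<Lambda> y \<partial>lborel)"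
  proof (rule integral_dominated_convergence)
    show "integrable lborel (\<lambda>y. B * \<bar>v y\<bar>)" using v by simp
    show "AE y in lborel. norm (v y * discrete_laplacian \<psi> (\<tau> n) y) \<le> B * \<bar>v y\<bar>" for n
      using bound by simp
    \<comment> \<open>The Laplacian of the test function is known off the two spheres only, which
      suffices almost everywhere.\<close>
    have "AE y in lborel. y \<notin> sphere x s \<union> sphere x r"
    proof (rule AE_not_in)
      have "negligible (sphere x s \<union> sphere x r)"
        by (intro negligible_Un negligible_sphere)
      then show "sphere x s \<union> sphere x r \<in> null_sets lborel"
        by (simp add: negligible_iff_null_sets null_sets_completion_iff)
    qed
    then show "AE y in lborel. (\<lambda>n. v y * discrete_laplacian \<psi> (\<tau> n) y) \<longlonglongrightarrow> v y * \<Lambda> y"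
    proof (rule AE_mp, intro AE_I2 impI)
      fix y assume y: "y \<notin> sphere x s \<union> sphere x r"
      have "((\<lambda>t. discrete_laplacian \<psi> t y) \<longlongrightarrow> \<Lambda> y) (at_right 0)"
        using radial_test_laplacian[OF s G k, of "y - x"] y
        by (simp add: discrete_laplacian_def second_difference_def \<psi>_def \<Lambda>_def
            indicator_def dist_norm norm_minus_commute algebra_simps)
      from filterlim_compose[OF this \<tau>lim]
      show "(\<lambda>n. v y * discrete_laplacian \<psi> (\<tau> n) y) \<longlonglongrightarrow> v y * \<Lambda> y"
        by (intro tendsto_mult tendsto_const)
    qed
  qed (simp_all add: borel_measurable_times \<Lambda>m Lm)
  have vu: "second_difference v t e y = second_difference u t e y"
    if "y \<in> cball x r" "0 < t" "t < d" "e \<in> Basis" for t e y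
  proof -
    have "y \<in> C" "y + t *\<^sub>R e \<in> C" "y - t *\<^sub>R e \<in> C"
      using that d \<delta>1 by (auto intro!: CC[OF that(1)] simp: dist_norm)
    then show ?thesis by (simp add: second_difference_def v_def)
  qed
  have vuL: "discrete_laplacian v t y = discrete_laplacian u t y"
    if "y \<in> cball x r" "0 < t" "t < d" for t y
    unfolding discrete_laplacian_def using vu[OF that] by simp
  \<comment> \<open>A Fatou argument: only the negative part of the discrete Laplacian must be
    controlled. \<open>low\<close> dominates it and \<open>lap\<close> sends it to 0 pointwise,
    while no upper bound is at hand.\<close>
  define h where "h = (\<lambda>n y. min (discrete_laplacian v (\<tau> n) y) 0 * \<psi> y)"
  have \<psi>z: "\<psi> y = 0" if "y \<notin> cball x r" for y
  proof -
    have "r\<^sup>2 \<le> (norm (y - x))\<^sup>2"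
      using that s by (intro power_mono) (auto simp: dist_norm norm_minus_commute)
    then show ?thesis by (simp add: \<psi>_def Gz)
  qed
  have \<psi>0: "\<psi> y \<ge> 0" for y by (simp add: \<psi>_def G0)
  have Llow: "- (real DIM('a) * K) \<le> discrete_laplacian v (\<tau> n) y" if "y \<in> cball x r" for n y
  proof (rule discrete_laplacian_lower_bound)
    fix e :: 'a assume e: "e \<in> Basis"
    show "- K * (\<tau> n)\<^sup>2 \<le> second_difference v (\<tau> n) e y"
      unfolding vu[OF that \<tau>0 \<tau>d e]
      by (rule low[OF that e \<tau>0 order_less_le_trans[OF \<tau>d d(2)]])
  qed (rule \<tau>0)
  have hb: "\<bar>h n y\<bar> \<le> indicator (cball x r) y * (real DIM('a) * \<bar>K\<bar> * G 0)" for n y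
  proof (cases "y \<in> cball x r")
    case True
    have "real DIM('a) * K \<le> real DIM('a) * \<bar>K\<bar>" by (intro mult_left_mono) auto
    then have "\<bar>min (discrete_laplacian v (\<tau> n) y) 0\<bar> \<le> real DIM('a) * \<bar>K\<bar>"
      using Llow[OF True, of n] mult_nonneg_nonneg[of "real DIM('a)" "\<bar>K\<bar>"]
      unfolding min_def by (smt (verit) abs_ge_zero of_nat_0_le_iff)
    then have "\<bar>min (discrete_laplacian v (\<tau> n) y) 0\<bar> * \<bar>\<psi> y\<bar> \<le> real DIM('a) * \<bar>K\<bar> * G 0"
      using \<psi>b by (intro mult_mono) auto
    then show ?thesis using True by (simp add: h_def abs_mult)
  qed (simp add: h_def \<psi>z)
  have hbi: "integrable lborel (\<lambda>y. indicator (cball x r) y * (real DIM('a) * \<bar>K\<bar> * G 0))"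
    using borel_integrable_compact[of "cball x r" "\<lambda>_. real DIM('a) * \<bar>K\<bar> * G 0"] by simp
  have hm[measurable]: "h n \<in> borel_measurable lborel" for n unfolding h_def by measurable
  have lim2: "(\<lambda>n. \<integral>y. h n y \<partial>lborel) \<longlonglongrightarrow> (\<integral>y. (0::real) \<partial>(lborel :: 'a measure))"
  proof (rule integral_dominated_convergence)
    show "integrable lborel (\<lambda>y. indicator (cball x r) y * (real DIM('a) * \<bar>K\<bar> * G 0))" by (rule hbi)
    show "AE y in lborel. norm (h n y) \<le> indicator (cball x r) y * (real DIM('a) * \<bar>K\<bar> * G 0)" for n
      using hb by simp
    show "AE y in lborel. (\<lambda>n. h n y) \<longlonglongrightarrow> 0"
    proof (rule AE_I2)
      fix y
      show "(\<lambda>n. h n y) \<longlonglongrightarrow> 0"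
      proof (cases "y \<in> cball x r")
        case True
        have "(\<lambda>n. min (discrete_laplacian v (\<tau> n) y) 0) \<longlonglongrightarrow> 0"
        proof (rule tendstoI)
          fix e :: real assume e: "e > 0"
          have "\<forall>\<^sub>F t in at_right 0. - (e / 2) \<le> discrete_laplacian u t y"
            using lap[OF True, of "e / 2"] e by simp
          then have "\<forall>\<^sub>F n in sequentially. - (e / 2) \<le> discrete_laplacian u (\<tau> n) y"
            using \<tau>lim by (auto simp: filterlim_iff)
          then show "\<forall>\<^sub>F n in sequentially. dist (min (discrete_laplacian v (\<tau> n) y) 0) 0 < e"
            by (rule eventually_mono) (use e vuL[OF True \<tau>0 \<tau>d] in \<open>auto simp: dist_real_def min_def\<close>)
        qed
        from tendsto_mult[OF this tendsto_const[of "\<psi> y"]] show ?thesis by (simp add: h_def)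
      qed (simp add: h_def \<psi>z)
    qed
  qed (simp_all add: hm)
  have "(\<integral>y. h n y \<partial>lborel) \<le> (\<integral>y. v y * discrete_laplacian \<psi> (\<tau> n) y \<partial>lborel)" for n
    unfolding swap(3)
  proof (rule integral_mono)
    show "integrable lborel (h n)"
      using hbi by (rule Bochner_Integration.integrable_bound)
        (auto intro!: AE_I2 order_trans[OF hb abs_ge_self])
    show "integrable lborel (\<lambda>y. discrete_laplacian v (\<tau> n) y * \<psi> y)" by (rule swap(2))
    show "\<And>y. h n y \<le> discrete_laplacian v (\<tau> n) y * \<psi> y"
      unfolding h_def using \<psi>0 by (intro mult_right_mono) auto
  qed
  then have "(\<integral>y. (0::real) \<partial>(lborel :: 'a measure)) \<le> (\<integral>y. v y * \<Lambda> y \<partial>lborel)"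
    by (intro LIMSEQ_le[OF lim2 lim1]) auto
  then have nn: "0 \<le> (\<integral>y. v y * \<Lambda> y \<partial>lborel)" by simp
  have ii: "integrable lborel (\<lambda>y. indicator (cball x \<rho>) y * u y)" if "\<rho> \<le> r" for \<rho>
    using borel_integrable_compact[OF compact_cball
        continuous_on_subset[OF S(2) order_trans[OF subset_cball[OF that] S(3)]]] by simp
  have e1: "v y * \<Lambda> y = 2 * real DIM('a) * ((r\<^sup>2) powr (- (real DIM('a) / 2)) * (indicator (cball x r) y * u y)
     - (s\<^sup>2) powr (- (real DIM('a) / 2)) * (indicator (cball x s) y * u y))" for y
  proof -
    have "cball x s \<subseteq> cball x r" using s by auto
    then show ?thesis using Cr unfolding v_def \<Lambda>_def
      by (auto simp: indicator_def algebra_simps)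
  qed
  have "(\<integral>y. v y * \<Lambda> y \<partial>lborel) = 2 * real DIM('a) * ((r\<^sup>2) powr (- (real DIM('a) / 2)) * (LINT y:cball x r|lborel. u y)
     - (s\<^sup>2) powr (- (real DIM('a) / 2)) * (LINT y:cball x s|lborel. u y))"
    unfolding e1 set_lebesgue_integral_def using ii[of r] ii[of s] s by simp
  with nn have "0 \<le> 2 * real DIM('a) * ((r\<^sup>2) powr (- (real DIM('a) / 2)) * (LINT y:cball x r|lborel. u y)
     - (s\<^sup>2) powr (- (real DIM('a) / 2)) * (LINT y:cball x s|lborel. u y))" by simp
  then show ?thesis by (simp add: zero_le_mult_iff mult.commute)
qed

text \<open>Ball averages increase with the radius by the preceding lemma, and by continuity those
  over small balls exceed \<open>u x - \<eta>\<close>.\<close>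

lemma sub_mean_value:
  fixes u :: "'a::euclidean_space \<Rightarrow> real"
  assumes S: "open S" "continuous_on S u" "cball x r \<subseteq> S" and r: "0 < r"
    and \<delta>: "\<delta> > 0"
    and low: "\<And>y e t. y \<in> cball x r \<Longrightarrow> e \<in> Basis \<Longrightarrow> 0 < t \<Longrightarrow> t < \<delta> \<Longrightarrow>
      - K * t\<^sup>2 \<le> second_difference u t e y"
    and lap: "\<And>y \<eta>. y \<in> cball x r \<Longrightarrow> \<eta> > 0 \<Longrightarrow> \<forall>\<^sub>F t in at_right 0. - \<eta> \<le> discrete_laplacian u t y"
  shows "u x \<le> (LINT y:cball x r|lborel. u y) / measure lborel (cball x r)"
proof (rule field_le_epsilon)
  fix \<eta> :: real assume \<eta>: "\<eta> > 0"
  have xS: "x \<in> S" using S r by auto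
  have "isCont u x" using S xS by (simp add: continuous_on_eq_continuous_at)
  then obtain d where d: "d > 0" "\<And>y. dist y x < d \<Longrightarrow> dist (u y) (u x) < \<eta>"
    using \<eta> unfolding continuous_at_eps_delta by (auto simp: dist_norm)
  define s where "s = min (d / 2) (r / 2)"
  have s: "0 < s" "s < r" "s < d" using d r by (auto simp: s_def)
  have vol: "measure lborel (cball x \<rho>) = unit_ball_vol (real DIM('a)) * \<rho> ^ DIM('a)" if "\<rho> \<ge> 0" for \<rho>
    using that by (rule content_cball)
  have V: "unit_ball_vol (real DIM('a)) > 0" by (rule unit_ball_vol_pos) simp
  have pw: "(\<rho>\<^sup>2) powr (- (real DIM('a) / 2)) = 1 / \<rho> ^ DIM('a)" if "\<rho> > 0" for \<rho> :: real
    using that by (simp add: powr_powr powr_minus_divide powr_realpow flip: powr_numeral)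
  have ii: "set_integrable lborel (cball x s) u"
    unfolding set_integrable_def
    using borel_integrable_compact[OF compact_cball
        continuous_on_subset[OF S(2) order_trans[OF subset_cball[OF less_imp_le[OF s(2)]] S(3)]]] by simp
  have "(u x - \<eta>) * measure lborel (cball x s) = (LINT y:cball x s|lborel. u x - \<eta>)"
    using emeasure_lborel_cball_finite[of x s] by (subst set_integral_const) auto
  also have "\<dots> \<le> (LINT y:cball x s|lborel. u y)"
  proof (rule set_integral_mono[OF _ ii])
    show "set_integrable lborel (cball x s) (\<lambda>y. u x - \<eta>)"
      unfolding set_integrable_def
      using borel_integrable_compact[OF compact_cball, of x s "\<lambda>_. u x - \<eta>"] by simp
    fix y assume "y \<in> cball x s"
    then have "dist (u y) (u x) < \<eta>" using s d(2)[of y] by (auto simp: dist_commute)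
    then show "u x - \<eta> \<le> u y" by (simp add: dist_real_def)
  qed
  finally have "(u x - \<eta>) * unit_ball_vol (real DIM('a)) \<le> (LINT y:cball x s|lborel. u y) / s ^ DIM('a)"
    using s by (simp add: vol field_simps)
  also have "\<dots> \<le> (LINT y:cball x r|lborel. u y) / r ^ DIM('a)"
    using scaled_ball_integral_mono[OF S s(1,2) \<delta> low lap] s r by (simp add: pw)
  finally have "u x - \<eta> \<le> (LINT y:cball x r|lborel. u y) / r ^ DIM('a) / unit_ball_vol (real DIM('a))"
    using V by (simp only: pos_le_divide_eq)
  then show "u x \<le> (LINT y:cball x r|lborel. u y) / measure lborel (cball x r) + \<eta>"
    using r by (simp add: vol mult.commute)
qed

text \<open>The two conditions are deliberately unequal: \<open>low\<close> is uniform on compact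
  sets and provides domination, whereas \<open>lap\<close> is pointwise, so it can be verified with
  a touching function that changes from point to point.\<close>

lemma subharmonic_onI:
  fixes u :: "'a::euclidean_space \<Rightarrow> real"
  assumes S: "open S" "continuous_on S u"
    and low: "\<And>C. compact C \<Longrightarrow> C \<subseteq> S \<Longrightarrow> \<exists>\<delta> K. \<delta> > 0 \<and>
       (\<forall>y e t. y \<in> C \<longrightarrow> e \<in> Basis \<longrightarrow> 0 < t \<longrightarrow> t < \<delta> \<longrightarrow> - K * t\<^sup>2 \<le> second_difference u t e y)"
    and lap: "\<And>y \<eta>. y \<in> S \<Longrightarrow> \<eta> > 0 \<Longrightarrow> \<forall>\<^sub>F t in at_right 0. - \<eta> \<le> discrete_laplacian u t y"
  shows "subharmonic_on S u"
  unfolding subharmonic_on_def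
proof (intro conjI allI impI)
  show "open S" by (rule S)
  show "upper_semicontinuous_on S u"
    unfolding upper_semicontinuous_on_def
    using S(2) by (auto simp: continuous_on_def intro: order_tendstoD(2))
  fix x r assume xr: "0 < r \<and> cball x r \<subseteq> S"
  show "set_integrable lborel (cball x r) u"
    unfolding set_integrable_def
    using borel_integrable_compact[OF compact_cball, of x r u] S xr
    by (simp add: continuous_on_subset)
  obtain \<delta> K where "\<delta> > 0"
    "\<And>y e t. y \<in> cball x r \<Longrightarrow> e \<in> Basis \<Longrightarrow> 0 < t \<Longrightarrow> t < \<delta> \<Longrightarrow> - K * t\<^sup>2 \<le> second_difference u t e y"
    using low[OF compact_cball] xr by meson
  then show "u x \<le> (LINT y:cball x r|lborel. u y) / measure lborel (cball x r)"
    using S xr lap by (intro sub_mean_value[of S u x r \<delta> K]) auto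
qed

lemma subharmonic_on_cong:
  fixes u v :: "'a::euclidean_space \<Rightarrow> real"
  assumes "\<And>x. x \<in> S \<Longrightarrow> u x = v x"
  shows "subharmonic_on S u \<longleftrightarrow> subharmonic_on S v"
proof -
  have imp: "subharmonic_on S b" if ab: "\<And>x. x \<in> S \<Longrightarrow> a x = b x" and a: "subharmonic_on S a" for a b :: "'a \<Rightarrow> real"
    unfolding subharmonic_on_def
  proof (intro conjI allI impI)
    show "open S" using a by (simp add: subharmonic_on_def)
    show "upper_semicontinuous_on S b"
      unfolding upper_semicontinuous_on_def
    proof (intro ballI allI impI)
      fix x c assume "x \<in> S" "b x < c"
      then have "\<forall>\<^sub>F y in at x within S. a y < c"
        using a ab unfolding subharmonic_on_def upper_semicontinuous_on_def by auto
      then show "\<forall>\<^sub>F y in at x within S. b y < c"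
        by (auto simp: eventually_at_filter ab elim: eventually_mono)
    qed
    fix x r assume xr: "0 < r \<and> cball x r \<subseteq> S"
    then have "x \<in> S" by auto
    have i: "(\<lambda>y. indicator (cball x r) y *\<^sub>R a y) = (\<lambda>y. indicator (cball x r) y *\<^sub>R b y)"
      using xr ab by (auto simp: indicator_def fun_eq_iff)
    show "set_integrable lborel (cball x r) b"
      using a xr unfolding subharmonic_on_def set_integrable_def i[symmetric] by blast
    show "b x \<le> (LINT y:cball x r|lborel. b y) / measure lborel (cball x r)"
      using a xr ab[OF \<open>x \<in> S\<close>] unfolding subharmonic_on_def set_lebesgue_integral_def i[symmetric] by metis
  qed
  show ?thesis using imp[of u v] imp[of v u] assms by metis
qed

section \<open>Touching from below\<close>

lemma eventually_second_difference_ge: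
  fixes u \<phi> :: "'a::real_normed_vector \<Rightarrow> real"
  assumes le: "\<forall>\<^sub>F y' in nhds y. \<phi> y' \<le> u y'" and eq: "\<phi> y = u y"
  shows "\<forall>\<^sub>F t in at_right 0. second_difference \<phi> t e y \<le> second_difference u t e y"
proof -
  have l: "((\<lambda>t. y + t *\<^sub>R e) \<longlongrightarrow> y) (at_right 0)" "((\<lambda>t. y - t *\<^sub>R e) \<longlongrightarrow> y) (at_right 0)"
    by (auto intro!: tendsto_eq_intros)
  have "\<forall>\<^sub>F t in at_right 0. \<phi> (y + t *\<^sub>R e) \<le> u (y + t *\<^sub>R e)"
    "\<forall>\<^sub>F t in at_right 0. \<phi> (y - t *\<^sub>R e) \<le> u (y - t *\<^sub>R e)"
    using le l unfolding filterlim_iff by blast+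
  then show ?thesis
    by eventually_elim (simp add: second_difference_def eq)
qed

text \<open>Equality at \<open>y\<close> makes the central terms of the second differences agree, so
  the inequality between the functions passes to their discrete Laplacians. The expression in
  \<open>nn\<close> is the Laplacian of the touching function.\<close>

lemma radial_touching_discrete_laplacian:
  fixes u :: "'a::euclidean_space \<Rightarrow> real" and G g :: "real \<Rightarrow> real"
  assumes le: "\<forall>\<^sub>F y' in nhds y. G ((norm (y' - c))\<^sup>2) \<le> u y'" and eq: "G ((norm (y - c))\<^sup>2) = u y"
    and G: "\<forall>\<^sub>F q in nhds ((norm (y - c))\<^sup>2). (G has_real_derivative g q) (at q)"
    and g: "(g has_real_derivative g') (at ((norm (y - c))\<^sup>2))"
    and nn: "4 * g' * (norm (y - c))\<^sup>2 + 2 * real DIM('a) * g ((norm (y - c))\<^sup>2) \<ge> 0"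
    and \<eta>: "\<eta> > 0"
  shows "\<forall>\<^sub>F t in at_right 0. - \<eta> \<le> discrete_laplacian u t y"
proof -
  let ?\<phi> = "\<lambda>y. G ((norm (y - c))\<^sup>2)"
  have "((\<lambda>t. discrete_laplacian ?\<phi> t y) \<longlongrightarrow>
     4 * g' * (norm (y - c))\<^sup>2 + 2 * real DIM('a) * g ((norm (y - c))\<^sup>2)) (at_right 0)"
    using radial_laplacian_tendsto[OF G g]
    by (simp add: discrete_laplacian_def second_difference_def algebra_simps)
  then have 1: "\<forall>\<^sub>F t in at_right 0. - \<eta> < discrete_laplacian ?\<phi> t y"
    using nn \<eta> by (intro order_tendstoD(1)) auto
  have "\<forall>\<^sub>F t in at_right 0. \<forall>e\<in>(Basis::'a set). second_difference ?\<phi> t e y \<le> second_difference u t e y"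
    by (intro eventually_ball_finite finite_Basis ballI eventually_second_difference_ge le eq)
  with 1 show ?thesis
  proof eventually_elim
    case (elim t)
    have "discrete_laplacian ?\<phi> t y \<le> discrete_laplacian u t y"
      unfolding discrete_laplacian_def using elim(2) by (intro sum_mono divide_right_mono) auto
    with elim(1) show ?case by linarith
  qed
qed

section \<open>Distance to the boundary and nearest points\<close>

lemma segment_meets_frontier:
  fixes x y :: "'a::real_normed_vector"
  assumes "x \<in> \<Omega>" "y \<notin> \<Omega>"
  shows "closed_segment x y \<inter> frontier \<Omega> \<noteq> {}"
  by (rule connected_Int_frontier[OF convex_connected[OF convex_closed_segment]]) (use assms in auto)

text \<open>Every point outside the set bounds the distance, not only boundary points, because the
  segment to it crosses the frontier. This lets exterior balls and parabolas serve as
  competitors.\<close>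

lemma bdist_le_dist:
  assumes "x \<in> \<Omega>" "y \<notin> \<Omega>"
  shows "bdist \<Omega> x \<le> dist x y"
proof -
  obtain z where z: "z \<in> closed_segment x y" "z \<in> frontier \<Omega>"
    using segment_meets_frontier[OF assms] by auto
  have "bdist \<Omega> x \<le> dist x z" unfolding bdist_def by (rule infdist_le[OF z(2)])
  also have "\<dots> \<le> dist x y"
    using dist_in_closed_segment[OF z(1)] by (simp add: dist_commute)
  finally show ?thesis .
qed

text \<open>Nonemptiness and properness give a nonempty frontier, hence nearest boundary points;
  openness keeps these points outside \<open>\<Omega>\<close>.\<close>

locale proper_open =
  fixes \<Omega> :: "'a::euclidean_space set"
  assumes open_\<Omega>: "open \<Omega>" and ne_\<Omega>: "\<Omega> \<noteq> {}" and ne_UNIV: "\<Omega> \<noteq> UNIV"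
begin

lemma frontier_nonempty: "frontier \<Omega> \<noteq> {}"
  using ne_\<Omega> ne_UNIV by (simp add: frontier_eq_empty)

lemma frontier_not_in: "w \<in> frontier \<Omega> \<Longrightarrow> w \<notin> \<Omega>"
  using open_\<Omega> by (simp add: frontier_def interior_open)

lemma nearest_boundary_point:
  obtains w where "w \<in> frontier \<Omega>" "bdist \<Omega> x = dist x w"
  using infdist_attains_inf[OF _ frontier_nonempty, of x] by (auto simp: bdist_def)

lemma bdist_pos: "x \<in> \<Omega> \<Longrightarrow> bdist \<Omega> x > 0"
  by (metis nearest_boundary_point frontier_not_in zero_less_dist_iff)

lemma ball_bdist_subset: "x \<in> \<Omega> \<Longrightarrow> ball x (bdist \<Omega> x) \<subseteq> \<Omega>"
  using bdist_le_dist by (force simp: not_less)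

lemma continuous_on_bdist: "continuous_on S (bdist \<Omega>)"
  unfolding bdist_def by (intro continuous_intros)

lemma bdist_ge_on_compact:
  assumes "compact C" "C \<subseteq> \<Omega>"
  obtains d where "d > 0" "\<And>y. y \<in> C \<Longrightarrow> d \<le> bdist \<Omega> y"
proof (cases "C = {}")
  case False
  obtain x where "x \<in> C" "\<And>y. y \<in> C \<Longrightarrow> bdist \<Omega> x \<le> bdist \<Omega> y"
    using continuous_attains_inf[OF assms(1) False continuous_on_bdist] by auto
  then show thesis using that bdist_pos assms by blast
qed (use that[of 1] in auto)

lemma segment_in_domain:
  assumes "y \<in> \<Omega>" "e \<in> Basis" "0 < t" "t < bdist \<Omega> y"
  shows "y + t *\<^sub>R e \<in> \<Omega>" "y - t *\<^sub>R e \<in> \<Omega>"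
  using ball_bdist_subset[OF assms(1)] assms by (auto simp: dist_norm subset_iff)

end

text \<open>The factors are A + B and A - B with A = |z|^2 + t^2 and B =
  \<open>2 * t * (z \<bullet> e)\<close>.\<close>

lemma norm_sq_product_le:
  fixes z e :: "'a::real_inner"
  assumes "norm e = 1"
  shows "(norm (z + t *\<^sub>R e))\<^sup>2 * (norm (z - t *\<^sub>R e))\<^sup>2 \<le> ((norm z)\<^sup>2 + t\<^sup>2)\<^sup>2"
proof -
  have "(norm (z + t *\<^sub>R e))\<^sup>2 * (norm (z - t *\<^sub>R e))\<^sup>2 = ((norm z)\<^sup>2 + t\<^sup>2)\<^sup>2 - (2 * t * (z \<bullet> e))\<^sup>2"
    unfolding norm_sq_add_scaleR[OF assms] norm_sq_add_scaleR[OF assms, of z "- t", simplified]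
    by (simp add: power2_eq_square algebra_simps)
  then show ?thesis by simp
qed

text \<open>Quantitative semiconcavity of the logarithm of the norm, uniform in the direction: the
  product bound is followed by \<open>ln (1 + x) \<le> x\<close>. The restriction on
  \<open>t\<close> keeps the arguments of \<open>ln\<close> positive.\<close>

lemma ln_norm_second_difference:
  fixes z e :: "'a::real_inner"
  assumes e: "norm e = 1" and t: "\<bar>t\<bar> < norm z"
  shows "ln (norm (z + t *\<^sub>R e)) + ln (norm (z - t *\<^sub>R e)) - 2 * ln (norm z) \<le> t\<^sup>2 / (norm z)\<^sup>2"
proof -
  have z: "norm z > 0" using t by linarith
  have p: "norm (z + t *\<^sub>R e) > 0" "norm (z - t *\<^sub>R e) > 0"
    using t e norm_triangle_ineq4[of "z + t *\<^sub>R e" "t *\<^sub>R e"] norm_triangle_ineq[of "z - t *\<^sub>R e" "t *\<^sub>R e"]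
    by (auto simp: add.commute)
  have "2 * (ln (norm (z + t *\<^sub>R e)) + ln (norm (z - t *\<^sub>R e))) =
      ln ((norm (z + t *\<^sub>R e))\<^sup>2 * (norm (z - t *\<^sub>R e))\<^sup>2)"
    using p by (simp add: ln_mult ln_realpow)
  also have "\<dots> \<le> ln (((norm z)\<^sup>2 + t\<^sup>2)\<^sup>2)"
    using p norm_sq_product_le[OF e, of z t]
    by (intro ln_mono mult_pos_pos zero_less_power) auto
  also have "\<dots> = 2 * ln ((norm z)\<^sup>2 * (1 + t\<^sup>2 / (norm z)\<^sup>2))"
  proof -
    have "(norm z)\<^sup>2 + t\<^sup>2 > 0" using z by (simp add: add_pos_nonneg)
    moreover have "(norm z)\<^sup>2 + t\<^sup>2 = (norm z)\<^sup>2 * (1 + t\<^sup>2 / (norm z)\<^sup>2)"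
      using z by (simp add: field_simps)
    ultimately show ?thesis by (metis ln_realpow of_nat_numeral)
  qed
  also have "\<dots> = 2 * (2 * ln (norm z) + ln (1 + t\<^sup>2 / (norm z)\<^sup>2))"
  proof -
    have "0 < 1 + t\<^sup>2 / (norm z)\<^sup>2" by (simp add: add_pos_nonneg)
    then show ?thesis using z by (subst ln_mult) (auto simp: ln_realpow)
  qed
  also have "\<dots> \<le> 2 * (2 * ln (norm z) + t\<^sup>2 / (norm z)\<^sup>2)"
    using ln_add_one_self_le_self[of "t\<^sup>2 / (norm z)\<^sup>2"] by simp
  finally show ?thesis by simp
qed

section \<open>The distance to the boundary\<close>

text \<open>The bound for \<open>- ln d\<close> passes to \<open>d\<close> to the power 2 - m, which
  is the exponential of a positive multiple of it: the arithmetic-geometric mean inequality handles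
  the two outer terms and \<open>1 + x \<le> exp x\<close> the exponent.\<close>

lemma exp_second_difference:
  fixes c K t :: real
  assumes v: "- K * t\<^sup>2 \<le> second_difference v t e y" and c: "c \<ge> 0"
  shows "- (c * exp (c * v y) * K) * t\<^sup>2 \<le> second_difference (\<lambda>x. exp (c * v x)) t e y"
proof -
  define \<alpha> \<beta> where "\<alpha> = c * v (y + t *\<^sub>R e)" and "\<beta> = c * v (y - t *\<^sub>R e)"
  have sq: "exp \<gamma> = (exp (\<gamma> / 2))\<^sup>2" for \<gamma> :: real
    by (simp add: power2_eq_square flip: exp_add)
  have "0 \<le> (exp (\<alpha> / 2) - exp (\<beta> / 2))\<^sup>2" by simp
  also have "\<dots> = exp \<alpha> + exp \<beta> - 2 * exp ((\<alpha> + \<beta>) / 2)"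
    unfolding sq[of \<alpha>] sq[of \<beta>] by (simp add: power2_diff add_divide_distrib exp_add)
  finally have 1: "2 * exp ((\<alpha> + \<beta>) / 2) \<le> exp \<alpha> + exp \<beta>" by simp
  have "c * (- K * t\<^sup>2) \<le> c * second_difference v t e y" by (rule mult_left_mono[OF v c])
  then have "c * v y - c * K * t\<^sup>2 / 2 \<le> (\<alpha> + \<beta>) / 2"
    unfolding \<alpha>_def \<beta>_def second_difference_def by (simp add: field_simps)
  then have "exp (c * v y - c * K * t\<^sup>2 / 2) \<le> exp ((\<alpha> + \<beta>) / 2)" by simp
  moreover have "exp (c * v y) * (1 + - (c * K * t\<^sup>2 / 2)) \<le> exp (c * v y) * exp (- (c * K * t\<^sup>2 / 2))"
    by (intro mult_left_mono exp_ge_add_one_self) auto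
  moreover have "exp (c * v y) * exp (- (c * K * t\<^sup>2 / 2)) = exp (c * v y - c * K * t\<^sup>2 / 2)"
    by (simp flip: exp_add)
  ultimately have "2 * (exp (c * v y) * (1 + - (c * K * t\<^sup>2 / 2))) \<le> exp \<alpha> + exp \<beta>" using 1 by linarith
  then show ?thesis unfolding second_difference_def \<alpha>_def \<beta>_def by (simp add: algebra_simps)
qed

section \<open>Second-difference bounds, dimension-only results and exterior balls\<close>

context proper_open
begin

lemma neg_ln_bdist_ge:
  assumes "x \<in> \<Omega>" "w \<notin> \<Omega>"
  shows "- ln (norm (x - w)) \<le> - ln (bdist \<Omega> x)"
  using bdist_le_dist[OF assms] bdist_pos[OF assms(1)] by (simp add: dist_norm ln_mono)

lemma neg_ln_bdist_second_difference:
  assumes y: "y \<in> \<Omega>" and e: "e \<in> Basis" and t: "0 < t" "t < bdist \<Omega> y"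
  shows "- (t\<^sup>2 / (bdist \<Omega> y)\<^sup>2) \<le> second_difference (\<lambda>x. - ln (bdist \<Omega> x)) t e y"
proof -
  obtain w where w: "w \<in> frontier \<Omega>" "bdist \<Omega> y = dist y w" by (rule nearest_boundary_point)
  have wO: "w \<notin> \<Omega>" using frontier_not_in w by blast
  have "ln (norm (y - w + t *\<^sub>R e)) + ln (norm (y - w - t *\<^sub>R e)) - 2 * ln (norm (y - w)) \<le> t\<^sup>2 / (norm (y - w))\<^sup>2"
    by (rule ln_norm_second_difference) (use e t w in \<open>auto simp: dist_norm\<close>)
  moreover have "- ln (norm (y - w + t *\<^sub>R e)) \<le> - ln (bdist \<Omega> (y + t *\<^sub>R e))"
    using neg_ln_bdist_ge[OF segment_in_domain(1)[OF y e t] wO] by (simp add: algebra_simps)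
  moreover have "- ln (norm (y - w - t *\<^sub>R e)) \<le> - ln (bdist \<Omega> (y - t *\<^sub>R e))"
    using neg_ln_bdist_ge[OF segment_in_domain(2)[OF y e t] wO] by (simp add: algebra_simps)
  ultimately show ?thesis
    unfolding second_difference_def w(2) dist_norm by linarith
qed

text \<open>\<open>K \<ge> 0\<close> is recorded because the exponential version multiplies
  \<open>K\<close> by a factor that is then replaced by an upper bound.\<close>

lemma neg_ln_bdist_second_difference_compact:
  assumes C: "compact C" "C \<subseteq> \<Omega>"
  shows "\<exists>\<delta> K. \<delta> > 0 \<and> K \<ge> 0 \<and> (\<forall>y e t. y \<in> C \<longrightarrow> e \<in> Basis \<longrightarrow> 0 < t \<longrightarrow> t < \<delta> \<longrightarrow>
    - K * t\<^sup>2 \<le> second_difference (\<lambda>x. - ln (bdist \<Omega> x)) t e y)"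
proof -
  obtain d where d: "d > 0" "\<And>y. y \<in> C \<Longrightarrow> d \<le> bdist \<Omega> y"
    using bdist_ge_on_compact[OF C] by metis
  have "- (1 / d\<^sup>2) * t\<^sup>2 \<le> second_difference (\<lambda>x. - ln (bdist \<Omega> x)) t e y"
    if "y \<in> C" "e \<in> Basis" "0 < t" "t < d" for y e t
  proof -
    have "d\<^sup>2 \<le> (bdist \<Omega> y)\<^sup>2" using d(1) d(2)[OF that(1)] by (intro power_mono) auto
    then have "t\<^sup>2 / (bdist \<Omega> y)\<^sup>2 \<le> t\<^sup>2 / d\<^sup>2"
      using d(1) by (intro divide_left_mono mult_pos_pos) (auto intro: order_less_le_trans[of 0 "d\<^sup>2"])
    then show ?thesis
      using neg_ln_bdist_second_difference[of y e t] that d(2)[OF that(1)] C by (auto simp: subset_iff)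
  qed
  then show ?thesis using d(1) by (intro exI[of _ d] exI[of _ "1 / d\<^sup>2"]) auto
qed

lemma continuous_on_ln_bdist:
  assumes "S \<subseteq> \<Omega>"
  shows "continuous_on S (\<lambda>x. - ln (bdist \<Omega> x))"
  by (intro continuous_intros continuous_on_bdist) (use assms bdist_pos in force)

text \<open>The lower bound on second differences holds for every proper open set, so from here on
  only the pointwise Laplacian condition remains to be checked.\<close>

lemma neg_ln_bdist_subharmonicI:
  assumes "open S" "S \<subseteq> \<Omega>"
    and "\<And>y \<eta>. y \<in> S \<Longrightarrow> \<eta> > 0 \<Longrightarrow>
      \<forall>\<^sub>F t in at_right 0. - \<eta> \<le> discrete_laplacian (\<lambda>x. - ln (bdist \<Omega> x)) t y"
  shows "subharmonic_on S (\<lambda>x. - ln (bdist \<Omega> x))"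
proof (rule subharmonic_onI[OF assms(1) continuous_on_ln_bdist[OF assms(2)] _ assms(3)])
  fix C assume "compact C" "C \<subseteq> S"
  then show "\<exists>\<delta> K. \<delta> > 0 \<and> (\<forall>y e t. y \<in> C \<longrightarrow> e \<in> Basis \<longrightarrow> 0 < t \<longrightarrow> t < \<delta> \<longrightarrow>
    - K * t\<^sup>2 \<le> second_difference (\<lambda>x. - ln (bdist \<Omega> x)) t e y)"
    using neg_ln_bdist_second_difference_compact[of C] assms(2) by blast
qed

lemma eventually_in_domain: "y \<in> \<Omega> \<Longrightarrow> \<forall>\<^sub>F y' in nhds y. y' \<in> \<Omega>"
  using open_\<Omega> by (rule eventually_nhds_in_open)

text \<open>The Laplacian of \<open>- ln (norm (x - w))\<close> is (2 - m) / |x - w|^2, whose sign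
  is right exactly for m \<le> 2.\<close>

lemma neg_ln_bdist_subharmonic_low_dim:
  assumes dim: "DIM('a) \<le> 2"
  shows "subharmonic_on \<Omega> (\<lambda>x. - ln (bdist \<Omega> x))"
proof (rule neg_ln_bdist_subharmonicI[OF open_\<Omega> subset_refl])
  fix y and \<eta> :: real assume y: "y \<in> \<Omega>" and \<eta>: "\<eta> > 0"
  obtain w where w: "w \<in> frontier \<Omega>" "bdist \<Omega> y = dist y w" by (rule nearest_boundary_point)
  have wO: "w \<notin> \<Omega>" using frontier_not_in w by blast
  have N: "norm (y - w) > 0" using y wO by auto
  show "\<forall>\<^sub>F t in at_right 0. - \<eta> \<le> discrete_laplacian (\<lambda>x. - ln (bdist \<Omega> x)) t y"
  proof (rule radial_touching_discrete_laplacian[where G = "\<lambda>q. - ln q / 2" and c = w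
        and g = "\<lambda>q. - 1 / (2 * q)" and g' = "1 / (2 * ((norm (y - w))\<^sup>2)\<^sup>2)"])
    show "\<forall>\<^sub>F y' in nhds y. - ln ((norm (y' - w))\<^sup>2) / 2 \<le> - ln (bdist \<Omega> y')"
      using eventually_in_domain[OF y]
    proof eventually_elim
      case (elim y')
      then have "norm (y' - w) > 0" using wO by auto
      then show ?case using neg_ln_bdist_ge[OF elim wO] by (simp add: ln_realpow)
    qed
    show "- ln ((norm (y - w))\<^sup>2) / 2 = - ln (bdist \<Omega> y)"
      using N by (simp add: w dist_norm ln_realpow)
    have "\<forall>\<^sub>F q in nhds ((norm (y - w))\<^sup>2). q \<in> {0<..}"
      using N by (intro eventually_nhds_in_open) auto
    then show "\<forall>\<^sub>F q in nhds ((norm (y - w))\<^sup>2). ((\<lambda>q. - ln q / 2) has_real_derivative - 1 / (2 * q)) (at q)"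
      by eventually_elim (auto intro!: derivative_eq_intros)
    show "((\<lambda>q. - 1 / (2 * q)) has_real_derivative 1 / (2 * ((norm (y - w))\<^sup>2)\<^sup>2)) (at ((norm (y - w))\<^sup>2))"
      using N by (auto intro!: derivative_eq_intros simp: field_simps power2_eq_square)
    define q where "q = (norm (y - w))\<^sup>2"
    have q: "q > 0" using N by (simp add: q_def)
    have "4 * (1 / (2 * q\<^sup>2)) * q + 2 * real DIM('a) * (- 1 / (2 * q)) = (2 - real DIM('a)) / q"
      using q by (simp add: field_simps power2_eq_square)
    also have "\<dots> \<ge> 0" using q dim by simp
    finally show "0 \<le> 4 * (1 / (2 * ((norm (y - w))\<^sup>2)\<^sup>2)) * (norm (y - w))\<^sup>2
        + 2 * real DIM('a) * (- 1 / (2 * (norm (y - w))\<^sup>2))"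
      unfolding q_def .
  qed (rule \<eta>)
qed

text \<open>The touching function is |x - w| to the power 2 - m, harmonic away from
  \<open>w\<close>. The function is written with \<open>exp\<close> so that its second differences
  can be bounded through those of \<open>- ln d\<close>.\<close>

lemma powr_bdist_subharmonic:
  assumes dim: "DIM('a) > 2"
  shows "subharmonic_on \<Omega> (\<lambda>x. exp ((real DIM('a) - 2) * - ln (bdist \<Omega> x)))" (is "subharmonic_on \<Omega> ?u")
proof (rule subharmonic_onI[OF open_\<Omega>])
  define c where "c = real DIM('a) - 2"
  have c: "c > 0" using dim by (simp add: c_def)
  show "continuous_on \<Omega> ?u"
    by (intro continuous_intros continuous_on_bdist) (use bdist_pos in force)
  fix C assume C: "compact C" "C \<subseteq> \<Omega>"
  obtain d where d: "d > 0" "\<And>y. y \<in> C \<Longrightarrow> d \<le> bdist \<Omega> y"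
    using bdist_ge_on_compact[OF C] by metis
  obtain \<delta> K where K: "\<delta> > 0" "K \<ge> 0" "\<And>y e t. y \<in> C \<Longrightarrow> e \<in> Basis \<Longrightarrow> 0 < t \<Longrightarrow> t < \<delta> \<Longrightarrow>
      - K * t\<^sup>2 \<le> second_difference (\<lambda>x. - ln (bdist \<Omega> x)) t e y"
    using neg_ln_bdist_second_difference_compact[OF C] by meson
  have "- (c * exp (c * - ln d) * K) * t\<^sup>2 \<le> second_difference ?u t e y"
    if "y \<in> C" "e \<in> Basis" "0 < t" "t < \<delta>" for y e t
  proof -
    have "c * - ln (bdist \<Omega> y) \<le> c * - ln d"
      using d(1) d(2)[OF that(1)] c by (intro mult_left_mono) (auto simp: ln_mono)
    then have "exp (c * - ln (bdist \<Omega> y)) \<le> exp (c * - ln d)" by (simp only: exp_le_cancel_iff)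
    then have "c * exp (c * - ln (bdist \<Omega> y)) * K * t\<^sup>2 \<le> c * exp (c * - ln d) * K * t\<^sup>2"
      using c K(2) by (intro mult_right_mono mult_left_mono) auto
    then show ?thesis
      using exp_second_difference[OF K(3)[OF that] less_imp_le[OF c]] unfolding c_def mult_minus_left by linarith
  qed
  then show "\<exists>\<delta> K. \<delta> > 0 \<and> (\<forall>y e t. y \<in> C \<longrightarrow> e \<in> Basis \<longrightarrow> 0 < t \<longrightarrow> t < \<delta> \<longrightarrow>
    - K * t\<^sup>2 \<le> second_difference ?u t e y)"
    using K(1) by blast
next
  define p where "p = (real DIM('a) - 2) / 2"
  have p: "p > 0" using dim by (simp add: p_def)
  fix y and \<eta> :: real assume y: "y \<in> \<Omega>" and \<eta>: "\<eta> > 0"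
  obtain w where w: "w \<in> frontier \<Omega>" "bdist \<Omega> y = dist y w" by (rule nearest_boundary_point)
  have wO: "w \<notin> \<Omega>" using frontier_not_in w by blast
  have N: "norm (y - w) > 0" using y wO by auto
  have G: "((norm (y' - w))\<^sup>2) powr (- p) = exp ((real DIM('a) - 2) * - ln (norm (y' - w)))"
    if "y' \<in> \<Omega>" for y'
  proof -
    have "norm (y' - w) > 0" using that wO by auto
    then show ?thesis by (simp add: powr_def ln_realpow p_def)
  qed
  define q where "q = (norm (y - w))\<^sup>2"
  have q: "q > 0" using N by (simp add: q_def)
  show "\<forall>\<^sub>F t in at_right 0. - \<eta> \<le> discrete_laplacian ?u t y"
  proof (rule radial_touching_discrete_laplacian[where G = "\<lambda>q. q powr (- p)" and c = w and y = y
        and g = "\<lambda>q. - p * q powr (- p - 1)" and g' = "p * (p + 1) * q powr (- p - 2)", folded q_def])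
    show "\<forall>\<^sub>F y' in nhds y. (norm (y' - w))\<^sup>2 powr (- p) \<le> ?u y'"
      using eventually_in_domain[OF y]
    proof eventually_elim
      case (elim y')
      then show ?case using neg_ln_bdist_ge[OF elim wO] dim
        by (simp only: G exp_le_cancel_iff) (intro mult_left_mono, auto)
    qed
    show "q powr (- p) = ?u y"
      unfolding q_def G[OF y] by (simp add: w dist_norm)
    have "\<forall>\<^sub>F q in nhds q. q \<in> {0<..}"
      using q by (intro eventually_nhds_in_open) auto
    then show "\<forall>\<^sub>F q in nhds q. ((\<lambda>q. q powr (- p)) has_real_derivative - p * q powr (- p - 1)) (at q)"
      by eventually_elim (auto intro!: derivative_eq_intros simp: powr_diff field_simps)
    have "- p - 1 - 1 = - p - 2" by simp
    moreover have "q powr (- p - 1 - 1) = q powr (- p - 1) / q"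
      unfolding powr_diff[of q "- p - 1" 1] using q by simp
    ultimately have q2: "q powr (- p - 2) = q powr (- p - 1) / q" by (simp only:)
    show "((\<lambda>q. - p * q powr (- p - 1)) has_real_derivative p * (p + 1) * q powr (- p - 2)) (at q)"
      using q by (auto intro!: derivative_eq_intros simp: field_simps)
    have "4 * (p * (p + 1) * q powr (- p - 2)) * q = 4 * p * (p + 1) * q powr (- p - 1)"
      using q by (simp add: q2)
    \<comment> \<open>This identity, which holds because \<open>p + 1\<close> is half the dimension,
      is harmonicity of the touching function.\<close>
    moreover have "4 * p * (p + 1) = 2 * real DIM('a) * p" by (simp add: p_def field_simps)
    ultimately have "4 * (p * (p + 1) * q powr (- p - 2)) * q = 2 * real DIM('a) * p * q powr (- p - 1)"
      by (simp only:)
    moreover have "2 * real DIM('a) * (- p * q powr (- p - 1)) = - (2 * real DIM('a) * p * q powr (- p - 1))"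
      by simp
    ultimately show "0 \<le> 4 * (p * (p + 1) * q powr (- p - 2)) * q + 2 * real DIM('a) * (- p * q powr (- p - 1))"
      by linarith
  qed (rule \<eta>)
qed

lemma bdist_powi_subharmonic:
  assumes dim: "DIM('a) > 2"
  shows "subharmonic_on \<Omega> (\<lambda>x. bdist \<Omega> x powi (2 - int DIM('a)))"
proof -
  have eq: "exp ((real DIM('a) - 2) * - ln (bdist \<Omega> x)) = bdist \<Omega> x powi (2 - int DIM('a))" if "x \<in> \<Omega>" for x
  proof -
    have "bdist \<Omega> x powi (2 - int DIM('a)) = bdist \<Omega> x powr (of_int (2 - int DIM('a)))"
      using bdist_pos[OF that] by (subst powr_real_of_int') auto
    then show ?thesis using bdist_pos[OF that] by (simp add: powr_def algebra_simps)
  qed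
  have "subharmonic_on \<Omega> (\<lambda>x. exp ((real DIM('a) - 2) * - ln (bdist \<Omega> x))) \<longleftrightarrow>
      subharmonic_on \<Omega> (\<lambda>x. bdist \<Omega> x powi (2 - int DIM('a)))"
    by (rule subharmonic_on_cong) (rule eq)
  then show ?thesis using powr_bdist_subharmonic[OF dim] by simp
qed

text \<open>The touching function is \<open>- ln (|x - c| - \<rho>)\<close>, whose Laplacian is
  \<open>(1 - (m - 1) f / (f + \<rho>)) / f\<^sup>2\<close> with \<open>f = |x - c| - \<rho>\<close>.\<close>

lemma exterior_ball_touching:
  assumes \<rho>: "\<rho> > 0" and ext: "cball c \<rho> \<inter> \<Omega> = {}" and y: "y \<in> \<Omega>"
    and touch: "norm (y - c) = bdist \<Omega> y + \<rho>"
    and close: "(real DIM('a) - 2) * bdist \<Omega> y \<le> \<rho>" and \<eta>: "\<eta> > 0"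
  shows "\<forall>\<^sub>F t in at_right 0. - \<eta> \<le> discrete_laplacian (\<lambda>x. - ln (bdist \<Omega> x)) t y"
proof -
  define \<sigma> where "\<sigma> = norm (y - c)"
  define f where "f = bdist \<Omega> y"
  have f: "f > 0" "\<sigma> = f + \<rho>" using bdist_pos[OF y] touch by (auto simp: f_def \<sigma>_def)
  have \<sigma>: "\<sigma> > \<rho>" "\<sigma> > 0" using f \<rho> by auto
  have sqrt\<sigma>: "sqrt (\<sigma>\<^sup>2) = \<sigma>" using \<sigma> by simp
  have nonzero: "\<sigma>\<^sup>2 - \<rho> * \<sigma> = \<sigma> * f" using f by (simp add: power2_eq_square algebra_simps)
  show ?thesis
  proof (rule radial_touching_discrete_laplacian[where G = "\<lambda>q. - ln (sqrt q - \<rho>)" and c = c and y = y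
        and g = "\<lambda>q. - 1 / (2 * (q - \<rho> * sqrt q))" and g' = "(1 - \<rho> / (2 * \<sigma>)) / (2 * (\<sigma> * f)\<^sup>2)", folded \<sigma>_def])
    show "\<forall>\<^sub>F y' in nhds y. - ln (sqrt ((norm (y' - c))\<^sup>2) - \<rho>) \<le> - ln (bdist \<Omega> y')"
      using eventually_in_domain[OF y]
    proof eventually_elim
      case (elim y')
      have n: "norm (y' - c) > \<rho>"
        using ext elim by (auto simp: dist_norm norm_minus_commute not_le[symmetric])
      have "norm (y' - c) \<noteq> 0" using n \<rho> by linarith
      then have "y' \<noteq> c" by simp
      \<comment> \<open>The point of the exterior ball nearest to \<open>y'\<close>, by radial
        projection; it is an admissible competitor for the distance.\<close>
      define z where "z = c + (\<rho> / norm (y' - c)) *\<^sub>R (y' - c)"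
      have "norm (z - c) = \<rho>" using \<open>y' \<noteq> c\<close> \<rho> by (simp add: z_def)
      then have "z \<in> cball c \<rho>" by (simp add: dist_norm norm_minus_commute)
      then have "z \<notin> \<Omega>" using ext by blast
      then have le: "bdist \<Omega> y' \<le> dist y' z" by (rule bdist_le_dist[OF elim])
      have "y' - z = (1 - \<rho> / norm (y' - c)) *\<^sub>R (y' - c)" by (simp add: z_def algebra_simps)
      then have "dist y' z = \<bar>1 - \<rho> / norm (y' - c)\<bar> * norm (y' - c)" by (simp add: dist_norm)
      also have "\<bar>1 - \<rho> / norm (y' - c)\<bar> = 1 - \<rho> / norm (y' - c)"
        using n \<rho> \<open>y' \<noteq> c\<close> by (intro abs_of_nonneg) (simp add: divide_le_eq)
      also have "(1 - \<rho> / norm (y' - c)) * norm (y' - c) = norm (y' - c) - \<rho>"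
        using \<open>y' \<noteq> c\<close> by (simp add: left_diff_distrib)
      finally show ?case using le bdist_pos[OF elim] by (simp add: ln_mono)
    qed
    show "- ln (sqrt (\<sigma>\<^sup>2) - \<rho>) = - ln (bdist \<Omega> y)"
      unfolding sqrt\<sigma> using f by (simp add: f_def)
    have "\<forall>\<^sub>F q in nhds (\<sigma>\<^sup>2). q \<in> {\<rho>\<^sup>2<..}"
      using \<sigma> \<rho> by (intro eventually_nhds_in_open) (auto intro: power_strict_mono)
    then show "\<forall>\<^sub>F q in nhds (\<sigma>\<^sup>2). ((\<lambda>q. - ln (sqrt q - \<rho>)) has_real_derivative - 1 / (2 * (q - \<rho> * sqrt q))) (at q)"
    proof eventually_elim
      case (elim q)
      then have q: "\<rho> < sqrt q" "q > 0"
        using real_less_rsqrt[of \<rho> q] order_le_less_trans[OF zero_le_power2[of \<rho>]] by auto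
      have "q - \<rho> * sqrt q = sqrt q * (sqrt q - \<rho>)" using q by (simp add: algebra_simps)
      then show ?case using q by (auto intro!: derivative_eq_intros simp: field_simps)
    qed
    show "((\<lambda>q. - 1 / (2 * (q - \<rho> * sqrt q))) has_real_derivative (1 - \<rho> / (2 * \<sigma>)) / (2 * (\<sigma> * f)\<^sup>2)) (at (\<sigma>\<^sup>2))"
    proof -
      have D: "((\<lambda>q. q - \<rho> * sqrt q) has_real_derivative 1 - \<rho> / (2 * \<sigma>)) (at (\<sigma>\<^sup>2))"
        using \<sigma> by (auto intro!: derivative_eq_intros simp: sqrt\<sigma> field_simps)
      have nz: "\<sigma>\<^sup>2 - \<rho> * sqrt (\<sigma>\<^sup>2) \<noteq> 0"
        unfolding sqrt\<sigma> nonzero using \<sigma>(2) f(1) by simp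
      have e: "- 1 / (2 * a) = - (1/2) * inverse a" for a :: real
        by (simp add: inverse_eq_divide)
      have "- (1/2) * - (inverse a * b * inverse a) = b / (2 * a\<^sup>2)" for a b :: real
        by (cases "a = 0") (auto simp: field_simps power2_eq_square)
      then show ?thesis
        using DERIV_cmult[OF DERIV_inverse'[OF D nz], of "- (1/2)"] unfolding e sqrt\<sigma> nonzero by metis
    qed
    \<comment> \<open>With \<open>\<sigma> = f + \<rho>\<close> the resulting numerator equals
      \<open>\<rho> - (m - 2) * f\<close>, m being the dimension, so \<open>close\<close> is exactly
      the condition for its sign.\<close>
    have "4 * ((1 - \<rho> / (2 * \<sigma>)) / (2 * (\<sigma> * f)\<^sup>2)) * \<sigma>\<^sup>2 + 2 * real DIM('a) * (- 1 / (2 * (\<sigma>\<^sup>2 - \<rho> * sqrt (\<sigma>\<^sup>2))))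
       = (2 * \<sigma> - \<rho> - real DIM('a) * f) / (\<sigma> * f\<^sup>2)"
      unfolding sqrt\<sigma> nonzero using \<sigma>(2) f(1) by (simp add: field_simps power2_eq_square)
    also have "\<dots> \<ge> 0"
    proof (rule divide_nonneg_pos)
      show "0 \<le> 2 * \<sigma> - \<rho> - real DIM('a) * f"
        using close f by (simp add: f_def algebra_simps)
      show "0 < \<sigma> * f\<^sup>2" using \<sigma>(2) f(1) by simp
    qed
    finally show "0 \<le> 4 * ((1 - \<rho> / (2 * \<sigma>)) / (2 * (\<sigma> * f)\<^sup>2)) * \<sigma>\<^sup>2 + 2 * real DIM('a) * (- 1 / (2 * (\<sigma>\<^sup>2 - \<rho> * sqrt (\<sigma>\<^sup>2))))" .
  qed (rule \<eta>)
qed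

end

section \<open>Traces and eigenvalues\<close>

text \<open>A maximiser of the quadratic form on the unit sphere of \<open>T\<close> is an
  eigenvector; induction on the dimension treats its orthogonal complement in \<open>T\<close>. The
  last clause is the eigenvector equation with eigenvalue \<open>b x x\<close>, tested against
  \<open>T\<close>, so that no operator on \<open>T\<close> has to be introduced.\<close>

lemma orthonormal_eigenbasis:
  fixes T :: "'a::euclidean_space set" and b :: "'a \<Rightarrow> 'a \<Rightarrow> real"
  assumes "subspace T" and bil: "bilinear b" and sym: "\<And>x y. b x y = b y x"
  shows "\<exists>B. B \<subseteq> T \<and> pairwise orthogonal B \<and> (\<forall>x\<in>B. norm x = 1) \<and> span B = T \<and>
    (\<forall>x\<in>B. \<forall>y\<in>T. b x y = b x x * (x \<bullet> y))"
  using assms(1)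
proof (induction "dim T" arbitrary: T rule: less_induct)
  case less
  show ?case
  proof (cases "T = {0}")
    case True
    then show ?thesis by (intro exI[of _ "{}"]) auto
  next
    case False
    have bc: "continuous_on A (\<lambda>x. b x x)" for A
      using bilinear_continuous_on_compose[OF continuous_on_id continuous_on_id bil] by simp
    have 0: "0 \<in> T" using less.prems by (rule subspace_0)
    then obtain z where z: "z \<in> T" "z \<noteq> 0" using False by auto
    have "(1 / norm z) *\<^sub>R z \<in> T \<inter> sphere 0 1"
      using z less.prems by (auto simp: subspace_scale)
    then have ne: "T \<inter> sphere 0 1 \<noteq> {}" by blast
    have "compact (T \<inter> sphere 0 1)"
      using closed_subspace[OF less.prems] by (intro closed_Int_compact) auto
    then obtain x0 where x0: "x0 \<in> T" "norm x0 = 1"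
      and mx: "\<And>x. x \<in> T \<Longrightarrow> norm x = 1 \<Longrightarrow> b x x \<le> b x0 x0"
      using continuous_attains_sup[OF _ ne bc] by auto
    have scale: "b (c *\<^sub>R x) (c *\<^sub>R x) = c\<^sup>2 * b x x" for c x
      by (simp add: bilinear_lmul[OF bil] bilinear_rmul[OF bil] power2_eq_square)
    have mx': "b x x \<le> b x0 x0 * (norm x)\<^sup>2" if "x \<in> T" for x
    proof (cases "x = 0")
      case False
      have "b ((1 / norm x) *\<^sub>R x) ((1 / norm x) *\<^sub>R x) \<le> b x0 x0"
        using that False less.prems by (intro mx) (auto simp: subspace_scale)
      then show ?thesis using False unfolding scale by (simp add: field_simps)
    qed (simp add: bilinear_lzero[OF bil])
    have orth: "b x0 y = 0" if y: "y \<in> T" "x0 \<bullet> y = 0" for y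
    proof (rule ccontr)
      assume ne: "b x0 y \<noteq> 0"
      \<comment> \<open>\<open>C\<close> bounds the coefficient of \<open>t\<^sup>2\<close> in the
        maximality inequality, the added 1 keeping it positive. At \<open>t = b x0 y / C\<close> the
        linear term is twice what the quadratic one can compensate.\<close>
      define C where "C = \<bar>b x0 x0 * (norm y)\<^sup>2 - b y y\<bar> + 1"
      have C: "C > 0" by (simp add: C_def add_nonneg_pos)
      define t where "t = b x0 y / C"
      have "b (x0 + t *\<^sub>R y) (x0 + t *\<^sub>R y) \<le> b x0 x0 * (norm (x0 + t *\<^sub>R y))\<^sup>2"
        using x0 y less.prems by (intro mx') (auto simp: subspace_add subspace_scale)
      moreover have "b (x0 + t *\<^sub>R y) (x0 + t *\<^sub>R y) = b x0 x0 + 2 * t * b x0 y + t\<^sup>2 * b y y"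
        using sym[of y x0]
        by (simp add: bilinear_ladd[OF bil] bilinear_radd[OF bil] bilinear_lmul[OF bil]
            bilinear_rmul[OF bil] power2_eq_square algebra_simps)
      moreover have "(norm (x0 + t *\<^sub>R y))\<^sup>2 = 1 + t\<^sup>2 * (norm y)\<^sup>2"
        using y(2) x0(2) unfolding power2_norm_eq_inner
        by (simp add: inner_add_left inner_add_right inner_commute power2_eq_square norm_eq_1)
      ultimately have "2 * t * b x0 y \<le> t\<^sup>2 * (b x0 x0 * (norm y)\<^sup>2 - b y y)"
        by (simp add: algebra_simps)
      also have "\<dots> \<le> t\<^sup>2 * C" by (intro mult_left_mono) (auto simp: C_def)
      finally have "2 * (b x0 y)\<^sup>2 / C \<le> (b x0 y)\<^sup>2 / C"
        using C by (simp add: t_def power2_eq_square field_simps)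
      then show False using ne C by (simp add: field_simps)
    qed
    define T' where "T' = {y \<in> T. x0 \<bullet> y = 0}"
    have T': "subspace T'"
      using less.prems unfolding T'_def subspace_def by (auto simp: inner_add_right)
    have "x0 \<notin> T'" using x0 by (auto simp: T'_def)
    then have "T' \<noteq> T" using x0 by metis
    then have "T' \<subset> T" unfolding T'_def by blast
    moreover have "span T = T" "span T' = T'" using less.prems T' by (simp_all only: span_eq_iff)
    ultimately have "span T' \<subset> span T" by (simp only:)
    then have "dim T' < dim T" by (rule dim_psubset)
    from less.hyps[OF this T'] obtain B where B: "B \<subseteq> T'" "pairwise orthogonal B"
      "\<And>x. x \<in> B \<Longrightarrow> norm x = 1" "span B = T'"
      "\<And>x y. x \<in> B \<Longrightarrow> y \<in> T' \<Longrightarrow> b x y = b x x * (x \<bullet> y)" by metis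
    have split: "y - (x0 \<bullet> y) *\<^sub>R x0 \<in> T'" if "y \<in> T" for y
      using that x0 less.prems unfolding T'_def
      by (auto simp: subspace_diff subspace_scale inner_diff_right norm_eq_1)
    have "span (insert x0 B) = T"
    proof
      show "span (insert x0 B) \<subseteq> T"
        using B(1) x0 less.prems by (intro span_minimal) (auto simp: T'_def)
      show "T \<subseteq> span (insert x0 B)"
      proof
        fix y assume "y \<in> T"
        then have "y - (x0 \<bullet> y) *\<^sub>R x0 \<in> span B" using split B by simp
        then show "y \<in> span (insert x0 B)" by (auto simp: span_breakdown_eq)
      qed
    qed
    moreover have "b x y = b x x * (x \<bullet> y)" if "x \<in> insert x0 B" "y \<in> T" for x y
    proof -
      define y' where "y' = y - (x0 \<bullet> y) *\<^sub>R x0"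
      have y': "y' \<in> T'" "y = (x0 \<bullet> y) *\<^sub>R x0 + y'" using split[OF that(2)] by (auto simp: y'_def)
      have e: "b x y = (x0 \<bullet> y) * b x x0 + b x y'"
        by (subst y'(2)) (simp add: bilinear_radd[OF bil] bilinear_rmul[OF bil])
      show ?thesis
      proof (cases "x = x0")
        case True
        then show ?thesis using e orth[of y'] y' by (simp add: T'_def mult.commute)
      next
        case False
        then have x: "x \<in> B" using that by simp
        then have "b x x0 = 0" "x0 \<bullet> x = 0" using B(1) orth[of x] sym[of x x0] by (auto simp: T'_def)
        moreover have "x \<bullet> y = x \<bullet> y'" by (subst y'(2)) (simp add: inner_add_right inner_commute \<open>x0 \<bullet> x = 0\<close>)
        ultimately show ?thesis using e B(5)[OF x y'(1)] by simp
      qed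
    qed
    moreover have "pairwise orthogonal (insert x0 B)"
      using B(1,2) by (auto simp: pairwise_insert orthogonal_def T'_def inner_commute subset_iff)
    ultimately show ?thesis
      using B x0 by (intro exI[of _ "insert x0 B"]) (auto simp: T'_def)
  qed
qed

text \<open>Independence of the trace from the basis, connecting eigenvalues counted with
  multiplicity to the ambient basis used by the discrete Laplacian. \<open>P\<close> is the
  orthogonal projection onto \<open>T\<close>, given by its characteristic properties, and each
  \<open>E \<kappa>\<close> is spanned by the members of an orthonormal eigenbasis with eigenvalue
  \<open>\<kappa>\<close>.\<close>

lemma weighted_eigenvalue_sum:
  fixes T :: "'a::euclidean_space set" and b :: "'a \<Rightarrow> 'a \<Rightarrow> real"
  assumes T: "subspace T" and bil: "bilinear b" and sym: "\<And>x y. b x y = b y x"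
    and P: "\<And>e. P e \<in> T" "\<And>e x. x \<in> T \<Longrightarrow> P e \<bullet> x = e \<bullet> x"
  defines "E \<equiv> \<lambda>\<kappa>. {X \<in> T. \<forall>Y\<in>T. b X Y = \<kappa> * (X \<bullet> Y)}"
  shows "(\<Sum>\<kappa> \<in> {\<kappa>. \<exists>X\<in>E \<kappa>. X \<noteq> 0}. real (dim (E \<kappa>)) * \<kappa>) = (\<Sum>e\<in>Basis. b (P e) (P e))"
proof -
  obtain B where B: "B \<subseteq> T" "pairwise orthogonal B" "\<And>x. x \<in> B \<Longrightarrow> norm x = 1" "span B = T"
    and eig: "\<And>x y. x \<in> B \<Longrightarrow> y \<in> T \<Longrightarrow> b x y = b x x * (x \<bullet> y)"
    using orthonormal_eigenbasis[OF T bil sym] by metis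
  have 0: "0 \<notin> B" using B(3) by force
  have ind: "independent B" by (rule pairwise_orthogonal_independent[OF B(2) 0])
  have fin: "finite B" using ind by (rule independent_imp_finite)
  have expand: "(\<Sum>x\<in>B. (x \<bullet> X) *\<^sub>R x) = X" if "X \<in> T" for X
    using orthonormal_basis_expand[OF B(2,3) _ fin, of X] that B(4) by (simp add: inner_commute)
  have E: "E \<kappa> = span {x \<in> B. b x x = \<kappa>}" for \<kappa>
  proof
    have "subspace (E \<kappa>)"
      using T unfolding E_def subspace_def
      by (auto simp: bilinear_ladd[OF bil] bilinear_lmul[OF bil] bilinear_lzero[OF bil] inner_add_left algebra_simps)
    then show "span {x \<in> B. b x x = \<kappa>} \<subseteq> E \<kappa>"
      using B(1) eig by (intro span_minimal) (auto simp: E_def)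
    show "E \<kappa> \<subseteq> span {x \<in> B. b x x = \<kappa>}"
    proof
      fix X assume X: "X \<in> E \<kappa>"
      then have XT: "X \<in> T" by (simp add: E_def)
      have "(x \<bullet> X) *\<^sub>R x \<in> span {x \<in> B. b x x = \<kappa>}" if x: "x \<in> B" for x
      proof (cases "x \<bullet> X = 0")
        case False
        have "\<kappa> * (X \<bullet> x) = b x x * (x \<bullet> X)"
          using X eig[OF x XT] sym[of x X] B(1) x by (auto simp: E_def)
        then have "b x x = \<kappa>" using False by (simp add: inner_commute)
        then show ?thesis using x by (intro span_scale span_base) auto
      qed (simp add: span_zero)
      then have "(\<Sum>x\<in>B. (x \<bullet> X) *\<^sub>R x) \<in> span {x \<in> B. b x x = \<kappa>}" by (rule span_sum)
      then show "X \<in> span {x \<in> B. b x x = \<kappa>}" by (simp add: expand[OF XT])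
    qed
  qed
  have dimE: "dim (E \<kappa>) = card {x \<in> B. b x x = \<kappa>}" for \<kappa>
    unfolding E by (simp add: dim_eq_card_independent independent_mono[OF ind])
  have spec: "{\<kappa>. \<exists>X\<in>E \<kappa>. X \<noteq> 0} = (\<lambda>x. b x x) ` B"
  proof (intro set_eqI iffI)
    fix \<kappa> assume "\<kappa> \<in> {\<kappa>. \<exists>X\<in>E \<kappa>. X \<noteq> 0}"
    then obtain X where "X \<in> span {x \<in> B. b x x = \<kappa>}" "X \<noteq> 0" unfolding E by blast
    then have "{x \<in> B. b x x = \<kappa>} \<noteq> {}" by (metis singletonD span_empty)
    then show "\<kappa> \<in> (\<lambda>x. b x x) ` B" by blast
  next
    fix \<kappa> assume "\<kappa> \<in> (\<lambda>x. b x x) ` B"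
    then obtain x where x: "x \<in> B" "\<kappa> = b x x" by blast
    then have "x \<in> E \<kappa>" unfolding E by (intro span_base) auto
    moreover have "x \<noteq> 0" using x 0 by auto
    ultimately show "\<kappa> \<in> {\<kappa>. \<exists>X\<in>E \<kappa>. X \<noteq> 0}" by blast
  qed
  have "(\<Sum>\<kappa> \<in> {\<kappa>. \<exists>X\<in>E \<kappa>. X \<noteq> 0}. real (dim (E \<kappa>)) * \<kappa>) =
      (\<Sum>\<kappa> \<in> (\<lambda>x. b x x) ` B. \<Sum>x\<in>{x \<in> B. b x x = \<kappa>}. b x x)"
    unfolding spec dimE by (intro sum.cong) auto
  also have "\<dots> = (\<Sum>x\<in>B. b x x)" by (rule sum.image_gen[OF fin, symmetric])
  \<comment> \<open>Inserting |x|^2 = 1 in ambient coordinates and exchanging the sums moves from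
    the eigenbasis to the ambient basis.\<close>
  also have "\<dots> = (\<Sum>x\<in>B. \<Sum>e\<in>Basis. b x x * (x \<bullet> e)\<^sup>2)"
  proof (intro sum.cong refl)
    fix x assume "x \<in> B"
    then have "x \<bullet> x = 1" using B(3) by (simp add: norm_eq_1)
    then have "(\<Sum>e\<in>Basis. (x \<bullet> e)\<^sup>2) = 1" by (simp add: euclidean_inner[of x x] power2_eq_square)
    then show "b x x = (\<Sum>e\<in>Basis. b x x * (x \<bullet> e)\<^sup>2)" by (simp flip: sum_distrib_left)
  qed
  also have "\<dots> = (\<Sum>e\<in>Basis. \<Sum>x\<in>B. b x x * (x \<bullet> e)\<^sup>2)" by (rule sum.swap)
  also have "\<dots> = (\<Sum>e\<in>Basis. b (P e) (P e))"
  proof (intro sum.cong refl)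
    fix e
    have xe: "x \<bullet> P e = x \<bullet> e" if "x \<in> B" for x
      using P(2)[of x e] that B(1) by (auto simp: inner_commute)
    have "b (P e) (P e) = b (\<Sum>x\<in>B. (x \<bullet> P e) *\<^sub>R x) (P e)" by (simp add: expand P)
    also have "\<dots> = (\<Sum>x\<in>B. (x \<bullet> P e) * b x (P e))"
      using bil unfolding bilinear_def by (simp add: linear_sum[of "\<lambda>x. b x (P e)"] bilinear_lmul[OF bil])
    also have "\<dots> = (\<Sum>x\<in>B. b x x * (x \<bullet> e)\<^sup>2)"
    proof (rule sum.cong[OF refl])
      fix x assume x: "x \<in> B"
      show "(x \<bullet> P e) * b x (P e) = b x x * (x \<bullet> e)\<^sup>2"
        unfolding eig[OF x P(1)] xe[OF x] by (simp add: power2_eq_square)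
    qed
    finally show "(\<Sum>x\<in>B. b x x * (x \<bullet> e)\<^sup>2) = b (P e) (P e)" by simp
  qed
  finally show ?thesis .
qed

section \<open>Gradients and Hessians\<close>

text \<open>A function of the point, unlike the relation \<open>GDERIV\<close>, so that its own
  derivative, the Hessian, can be formed.\<close>

definition grad :: "('a::euclidean_space \<Rightarrow> real) \<Rightarrow> 'a \<Rightarrow> 'a" where
  "grad f x = (\<Sum>e\<in>Basis. frechet_derivative f (at x) e *\<^sub>R e)"

lemma inner_grad:
  assumes "f differentiable (at x)"
  shows "grad f x \<bullet> v = frechet_derivative f (at x) v"
proof -
  have l: "linear (frechet_derivative f (at x))"
    using assms by (rule linear_frechet_derivative)
  have "frechet_derivative f (at x) v = frechet_derivative f (at x) (\<Sum>e\<in>Basis. (v \<bullet> e) *\<^sub>R e)"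
    by (simp add: euclidean_representation)
  also have "\<dots> = (\<Sum>e\<in>Basis. (v \<bullet> e) * frechet_derivative f (at x) e)"
    using l by (simp add: linear_sum linear_scale)
  also have "\<dots> = grad f x \<bullet> v"
    by (simp add: grad_def inner_sum_left inner_commute[of v] mult.commute)
  finally show ?thesis ..
qed

lemma has_derivative_grad:
  assumes "f differentiable (at x)"
  shows "(f has_derivative (\<lambda>v. grad f x \<bullet> v)) (at x)"
  using assms by (simp add: inner_grad frechet_derivative_works)

lemma GDERIV_iff_grad:
  assumes "f differentiable (at x)"
  shows "GDERIV f x :> g \<longleftrightarrow> g = grad f x"
proof
  assume "GDERIV f x :> g"
  then have "(\<lambda>v. v \<bullet> g) = (\<lambda>v. grad f x \<bullet> v)"
    unfolding gderiv_def using has_derivative_grad[OF assms] by (rule has_derivative_unique)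
  then have "g \<bullet> v = grad f x \<bullet> v" for v by (metis inner_commute)
  then show "g = grad f x" by (metis vector_eq_rdot)
next
  assume "g = grad f x"
  then show "GDERIV f x :> g"
    unfolding gderiv_def using has_derivative_grad[OF assms] by (simp add: inner_commute)
qed

section \<open>Lipschitz gradients of smooth functions\<close>

lemma smooth_on_Ck: "smooth_on U f \<Longrightarrow> Ck_on k U f"
  by (simp add: smooth_on_def)

lemma smooth_on_differentiable: "smooth_on U f \<Longrightarrow> x \<in> U \<Longrightarrow> f differentiable (at x)"
  using smooth_on_Ck[of U f 1] by simp

lemma smooth_on_directional:
  assumes "open U" "smooth_on U f"
  shows "smooth_on U (\<lambda>x. frechet_derivative f (at x) v)"
  unfolding smooth_on_def
proof
  fix k show "Ck_on k U (\<lambda>x. frechet_derivative f (at x) v)"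
    using smooth_on_Ck[OF assms(2), of "Suc k"] by simp
qed

lemma grad_differentiable:
  assumes "open U" "smooth_on U f" "x \<in> U"
  shows "grad f differentiable (at x)"
proof -
  have "(\<lambda>y. \<Sum>e\<in>Basis. frechet_derivative f (at y) e *\<^sub>R e) differentiable (at x)"
    using smooth_on_differentiable[OF smooth_on_directional[OF assms(1,2)] assms(3)]
    by (intro differentiable_sum differentiable_scaleR) auto
  moreover have "(\<lambda>y. \<Sum>e\<in>Basis. frechet_derivative f (at y) e *\<^sub>R e) = grad f"
    by (simp add: fun_eq_iff grad_def)
  ultimately show ?thesis by simp
qed

lemma smooth_on_continuous: "smooth_on U f \<Longrightarrow> continuous_on U f"
  using smooth_on_Ck[of U f 0] by simp

lemma smooth_on_lipschitz_cball:
  fixes f :: "'a::euclidean_space \<Rightarrow> real"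
  assumes "open U" "smooth_on U f" "cball w \<delta> \<subseteq> U"
  shows "\<exists>L\<ge>0. \<forall>x\<in>cball w \<delta>. \<forall>y\<in>cball w \<delta>. \<bar>f x - f y\<bar> \<le> L * norm (x - y)"
proof -
  have "\<exists>B. \<forall>x\<in>cball w \<delta>. \<bar>frechet_derivative f (at x) e\<bar> \<le> B" for e
  proof -
    have "continuous_on (cball w \<delta>) (\<lambda>x. frechet_derivative f (at x) e)"
      using smooth_on_continuous[OF smooth_on_directional[OF assms(1,2)]] assms(3) continuous_on_subset by blast
    then have "bounded ((\<lambda>x. frechet_derivative f (at x) e) ` cball w \<delta>)"
      by (intro compact_imp_bounded compact_continuous_image) auto
    then show ?thesis by (auto simp: bounded_iff)
  qed
  then obtain B where B: "\<And>e x. x \<in> cball w \<delta> \<Longrightarrow> \<bar>frechet_derivative f (at x) e\<bar> \<le> B e" by metis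
  define L where "L = (\<Sum>e\<in>(Basis::'a set). \<bar>B e\<bar>)"
  have "\<bar>f x - f y\<bar> \<le> L * norm (x - y)" if "x \<in> cball w \<delta>" "y \<in> cball w \<delta>" for x y
  proof -
    have "norm (f x - f y) \<le> L * norm (x - y)"
    proof (rule differentiable_bound[OF convex_cball[of w \<delta>] _ _ that])
      fix z assume z: "z \<in> cball w \<delta>"
      have d: "f differentiable (at z)"
        using smooth_on_differentiable[OF assms(2)] z assms(3) by blast
      show "(f has_derivative (\<lambda>v. grad f z \<bullet> v)) (at z within cball w \<delta>)"
        using has_derivative_grad[OF d] by (rule has_derivative_at_withinI)
      have "norm (grad f z) \<le> (\<Sum>e\<in>(Basis::'a set). \<bar>grad f z \<bullet> e\<bar>)" by (rule norm_le_l1)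
      also have "\<dots> \<le> L" unfolding L_def
        using B[OF z] by (intro sum_mono) (auto simp: inner_grad[OF d] intro: order_trans[OF _ abs_ge_self])
      finally have g: "norm (grad f z) \<le> L" .
      show "onorm (\<lambda>v. grad f z \<bullet> v) \<le> L"
      proof (rule onorm_bound)
        show "0 \<le> L" by (simp add: L_def sum_nonneg)
        fix v have "\<bar>grad f z \<bullet> v\<bar> \<le> norm (grad f z) * norm v" by (rule Cauchy_Schwarz_ineq2)
        also have "\<dots> \<le> L * norm v" using g by (rule mult_right_mono) simp
        finally show "norm (grad f z \<bullet> v) \<le> L * norm v" by simp
      qed
    qed
    then show ?thesis by simp
  qed
  moreover have "L \<ge> 0" by (simp add: L_def sum_nonneg)
  ultimately show ?thesis by blast
qed

lemma grad_lipschitz_cball: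
  fixes f :: "'a::euclidean_space \<Rightarrow> real"
  assumes "open U" "smooth_on U f" "cball w \<delta> \<subseteq> U"
  shows "\<exists>L\<ge>0. \<forall>x\<in>cball w \<delta>. \<forall>y\<in>cball w \<delta>. norm (grad f x - grad f y) \<le> L * norm (x - y)"
proof -
  have "\<exists>L\<ge>0. \<forall>x\<in>cball w \<delta>. \<forall>y\<in>cball w \<delta>.
      \<bar>frechet_derivative f (at x) e - frechet_derivative f (at y) e\<bar> \<le> L * norm (x - y)" for e
    by (rule smooth_on_lipschitz_cball[OF assms(1) smooth_on_directional[OF assms(1,2)] assms(3)])
  then obtain L where L: "\<And>e. L e \<ge> 0" "\<And>e x y. x\<in>cball w \<delta> \<Longrightarrow> y\<in>cball w \<delta> \<Longrightarrow>
      \<bar>frechet_derivative f (at x) e - frechet_derivative f (at y) e\<bar> \<le> L e * norm (x - y)" by metis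
  have "norm (grad f x - grad f y) \<le> (\<Sum>e\<in>Basis. L e) * norm (x - y)"
    if "x \<in> cball w \<delta>" "y \<in> cball w \<delta>" for x y
  proof -
    have d: "f differentiable (at x)" "f differentiable (at y)"
      using smooth_on_differentiable[OF assms(2)] that assms(3) by blast+
    have "norm (grad f x - grad f y) \<le> (\<Sum>e\<in>(Basis::'a set). \<bar>(grad f x - grad f y) \<bullet> e\<bar>)" by (rule norm_le_l1)
    also have "\<dots> \<le> (\<Sum>e\<in>Basis. L e * norm (x - y))"
      using L(2)[OF that] by (intro sum_mono) (simp add: inner_diff_left inner_grad[OF d(1)] inner_grad[OF d(2)])
    finally show ?thesis by (simp add: sum_distrib_right)
  qed
  then show ?thesis using L(1) by (intro exI[of _ "\<Sum>e\<in>Basis. L e"]) (auto simp: sum_nonneg)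
qed

text \<open>The mean value inequality for \<open>f z - grad f x \<bullet> z\<close> on the segment;
  it gives \<open>L\<close> rather than the sharp \<open>L / 2\<close>, which is enough for
  constructing exterior balls.\<close>

lemma quadratic_upper_bound:
  fixes f :: "'a::euclidean_space \<Rightarrow> real"
  assumes U: "smooth_on U f" "cball w \<delta> \<subseteq> U"
    and L: "\<And>x y. x \<in> cball w \<delta> \<Longrightarrow> y \<in> cball w \<delta> \<Longrightarrow> norm (grad f x - grad f y) \<le> L * norm (x - y)" "L \<ge> 0"
    and xy: "x \<in> cball w \<delta>" "y \<in> cball w \<delta>"
  shows "f y \<le> f x + grad f x \<bullet> (y - x) + L * (norm (y - x))\<^sup>2"
proof -
  have cs: "closed_segment x y \<subseteq> cball w \<delta>"
    using xy by (intro closed_segment_subset) auto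
  have "norm ((f y - grad f x \<bullet> y) - (f x - grad f x \<bullet> x)) \<le> (L * norm (y - x)) * norm (y - x)"
  proof (rule differentiable_bound[of "closed_segment x y"])
    fix z assume z: "z \<in> closed_segment x y"
    have d: "f differentiable (at z)"
      using smooth_on_differentiable[OF U(1)] z cs U(2) by blast
    show "((\<lambda>z. f z - grad f x \<bullet> z) has_derivative (\<lambda>v. (grad f z - grad f x) \<bullet> v)) (at z within closed_segment x y)"
      using has_derivative_at_withinI[OF has_derivative_grad[OF d]]
      by (auto intro!: derivative_eq_intros simp: inner_diff_left)
    have "norm (grad f z - grad f x) \<le> L * norm (z - x)" using L(1) z cs xy by blast
    also have "\<dots> \<le> L * norm (y - x)"
      using dist_in_closed_segment[OF z] L(2) by (intro mult_left_mono) (auto simp: dist_norm norm_minus_commute)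
    finally have g: "norm (grad f z - grad f x) \<le> L * norm (y - x)" .
    show "onorm (\<lambda>v. (grad f z - grad f x) \<bullet> v) \<le> L * norm (y - x)"
    proof (rule onorm_bound)
      show "0 \<le> L * norm (y - x)" using L(2) by simp
      fix v have "\<bar>(grad f z - grad f x) \<bullet> v\<bar> \<le> norm (grad f z - grad f x) * norm v" by (rule Cauchy_Schwarz_ineq2)
      also have "\<dots> \<le> L * norm (y - x) * norm v" using g by (rule mult_right_mono) simp
      finally show "norm ((grad f z - grad f x) \<bullet> v) \<le> L * norm (y - x) * norm v" by simp
    qed
  qed auto
  then show ?thesis by (simp add: inner_diff_right power2_eq_square mult.assoc)
qed

text \<open>The mixed second difference of \<open>f\<close> at \<open>w\<close> is symmetric in its
  two directions, and differentiability of the gradient at the single point \<open>w\<close>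
  determines it up to o(t^2).\<close>

lemma hessian_symmetric:
  fixes f :: "'a::euclidean_space \<Rightarrow> real"
  assumes U: "open U" "w \<in> U" "\<And>x. x \<in> U \<Longrightarrow> f differentiable (at x)"
    and H: "(grad f has_derivative H) (at w)"
  shows "H u \<bullet> v = H v \<bullet> u"
proof -
  define N where "N = norm u + norm v"
  have lin: "linear H" using H has_derivative_linear by blast
  have est: "\<exists>d>0. \<forall>t. 0 < t \<and> t < d \<longrightarrow>
     \<bar>(f (w + t *\<^sub>R a + t *\<^sub>R b) - f (w + t *\<^sub>R a) - f (w + t *\<^sub>R b) + f w) - t\<^sup>2 * (H b \<bullet> a)\<bar> \<le> 2 * \<epsilon> * t\<^sup>2 * N * N"
    if \<epsilon>: "\<epsilon> > 0" and ab: "norm a + norm b = N" for a b \<epsilon>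
  proof -
    have "\<exists>d>0. \<forall>y. norm (y - w) < d \<longrightarrow> norm (grad f y - grad f w - H (y - w)) \<le> \<epsilon> * norm (y - w)"
      using H \<epsilon> unfolding has_derivative_at_alt by blast
    then obtain d1 where d1: "d1 > 0" "\<And>y. norm (y - w) < d1 \<Longrightarrow> norm (grad f y - grad f w - H (y - w)) \<le> \<epsilon> * norm (y - w)"
      by blast
    obtain d2 where d2: "d2 > 0" "ball w d2 \<subseteq> U" using U(1,2) openE by blast
    define d where "d = min d1 d2 / (N + 1)"
    have N: "N \<ge> 0" by (simp add: N_def)
    have d: "d > 0" using d1 d2 N by (simp add: d_def)
    have "\<bar>(f (w + t *\<^sub>R a + t *\<^sub>R b) - f (w + t *\<^sub>R a) - f (w + t *\<^sub>R b) + f w) - t\<^sup>2 * (H b \<bullet> a)\<bar> \<le> 2 * \<epsilon> * t\<^sup>2 * N * N"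
      if t: "0 < t" "t < d" for t
    proof -
      have tN: "t * N < min d1 d2"
      proof -
        have "t * N \<le> t * (N + 1)" using t by simp
        also have "\<dots> < min d1 d2" using t(2) N by (simp add: d_def field_simps)
        finally show ?thesis .
      qed
      have small: "norm (s *\<^sub>R a + r *\<^sub>R b) \<le> t * N" if "0 \<le> s" "s \<le> t" "0 \<le> r" "r \<le> t" for s r
      proof -
        have "norm (s *\<^sub>R a + r *\<^sub>R b) \<le> s * norm a + r * norm b"
          using that norm_triangle_ineq[of "s *\<^sub>R a" "r *\<^sub>R b"] by simp
        also have "\<dots> \<le> t * norm a + t * norm b" using that by (intro add_mono mult_right_mono) auto
        finally show ?thesis using ab by (simp flip: distrib_left)
      qed
      have inU: "w + s *\<^sub>R a + r *\<^sub>R b \<in> U" if "0 \<le> s" "s \<le> t" "0 \<le> r" "r \<le> t" for s r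
      proof -
        have "w + s *\<^sub>R a + r *\<^sub>R b \<in> ball w d2"
          using small[OF that] tN by (simp add: dist_norm norm_minus_commute algebra_simps)
        then show ?thesis using d2 by blast
      qed
      \<comment> \<open>\<open>\<phi>\<close> is the increment by \<open>t *\<^sub>R b\<close>. The
        mean value theorem in direction \<open>a\<close> turns the mixed difference into an
        increment of the gradient, which \<open>H\<close> approximates.\<close>
      define \<phi> where "\<phi> = (\<lambda>s. f (w + s *\<^sub>R a + t *\<^sub>R b) - f (w + s *\<^sub>R a))"
      define \<phi>' where "\<phi>' = (\<lambda>s. grad f (w + s *\<^sub>R a + t *\<^sub>R b) \<bullet> a - grad f (w + s *\<^sub>R a) \<bullet> a)"
      have "(\<phi> has_real_derivative \<phi>' s) (at s)" if s: "0 \<le> s" "s \<le> t" for s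
      proof -
        have 1: "((\<lambda>s. w + s *\<^sub>R a + t *\<^sub>R b) has_derivative (\<lambda>h. h *\<^sub>R a)) (at s)"
          and 2: "((\<lambda>s. w + s *\<^sub>R a) has_derivative (\<lambda>h. h *\<^sub>R a)) (at s)"
          by (auto intro!: derivative_eq_intros)
        have "f differentiable (at (w + s *\<^sub>R a + t *\<^sub>R b))" "f differentiable (at (w + s *\<^sub>R a))"
          using inU[OF s, of t] inU[OF s, of 0] t U(3) by auto
        from has_derivative_diff[OF has_derivative_compose[OF 1 has_derivative_grad[OF this(1)]]
            has_derivative_compose[OF 2 has_derivative_grad[OF this(2)]]]
        show ?thesis unfolding \<phi>_def \<phi>'_def has_field_derivative_def
          by (rule has_derivative_eq_rhs) (simp add: fun_eq_iff algebra_simps)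
      qed
      then obtain s where s: "0 < s" "s < t" "\<phi> t - \<phi> 0 = (t - 0) * \<phi>' s"
        using MVT2[of 0 t \<phi> \<phi>'] t by auto
      define g1 where "g1 = grad f (w + s *\<^sub>R a + t *\<^sub>R b) - grad f w - H (s *\<^sub>R a + t *\<^sub>R b)"
      define g2 where "g2 = grad f (w + s *\<^sub>R a) - grad f w - H (s *\<^sub>R a)"
      have "norm g1 \<le> \<epsilon> * norm (s *\<^sub>R a + t *\<^sub>R b)"
        unfolding g1_def using d1(2)[of "w + s *\<^sub>R a + t *\<^sub>R b"] small[of s t] s t tN by (simp add: add.assoc)
      moreover have "norm g2 \<le> \<epsilon> * norm (s *\<^sub>R a)"
        unfolding g2_def using d1(2)[of "w + s *\<^sub>R a"] small[of s 0] s t tN by simp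
      moreover have "\<epsilon> * norm (s *\<^sub>R a + t *\<^sub>R b) \<le> \<epsilon> * (t * N)" "\<epsilon> * norm (s *\<^sub>R a) \<le> \<epsilon> * (t * N)"
        using small[of s t] small[of s 0] s t \<epsilon> by (auto intro!: mult_left_mono)
      ultimately have "norm (g1 - g2) \<le> 2 * \<epsilon> * t * N" using norm_triangle_ineq4[of g1 g2] by linarith
      moreover have "norm a \<le> N" using ab norm_ge_zero[of b] by linarith
      ultimately have "norm (g1 - g2) * norm a \<le> (2 * \<epsilon> * t * N) * N"
        using \<epsilon> t N by (intro mult_mono) auto
      then have ga: "\<bar>(g1 - g2) \<bullet> a\<bar> \<le> (2 * \<epsilon> * t * N) * N"
        using Cauchy_Schwarz_ineq2[of "g1 - g2" a] by linarith
      have "g1 - g2 = grad f (w + s *\<^sub>R a + t *\<^sub>R b) - grad f (w + s *\<^sub>R a) - t *\<^sub>R H b"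
        unfolding g1_def g2_def by (simp add: linear_add[OF lin] linear_scale[OF lin])
      then have "\<phi>' s - t * (H b \<bullet> a) = (g1 - g2) \<bullet> a"
        unfolding \<phi>'_def by (simp add: inner_diff_left)
      moreover have "t * \<phi>' s - t\<^sup>2 * (H b \<bullet> a) = t * (\<phi>' s - t * (H b \<bullet> a))"
        by (simp add: power2_eq_square algebra_simps)
      ultimately have "t * \<phi>' s - t\<^sup>2 * (H b \<bullet> a) = t * ((g1 - g2) \<bullet> a)" by simp
      then have "\<bar>t * \<phi>' s - t\<^sup>2 * (H b \<bullet> a)\<bar> = t * \<bar>(g1 - g2) \<bullet> a\<bar>"
        using t by (simp add: abs_mult)
      also have "\<dots> \<le> t * ((2 * \<epsilon> * t * N) * N)" using ga t by (intro mult_left_mono) auto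
      finally show ?thesis using s(3) by (simp add: \<phi>_def power2_eq_square algebra_simps)
    qed
    then show ?thesis using d by blast
  qed
  have "\<bar>H u \<bullet> v - H v \<bullet> u\<bar> \<le> 0 + e" if e: "e > 0" for e
  proof -
    define M where "M = N * N + 1"
    define \<epsilon> where "\<epsilon> = e / (4 * M)"
    have N1: "M > 0" by (simp add: M_def add_nonneg_pos)
    have \<epsilon>: "\<epsilon> > 0" using e N1 by (simp add: \<epsilon>_def)
    obtain d1 d2 where d: "d1 > 0" "d2 > 0" and
      1: "\<And>t. 0 < t \<Longrightarrow> t < d1 \<Longrightarrow> \<bar>(f (w + t *\<^sub>R u + t *\<^sub>R v) - f (w + t *\<^sub>R u) - f (w + t *\<^sub>R v) + f w) - t\<^sup>2 * (H v \<bullet> u)\<bar> \<le> 2 * \<epsilon> * t\<^sup>2 * N * N"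
      and 2: "\<And>t. 0 < t \<Longrightarrow> t < d2 \<Longrightarrow> \<bar>(f (w + t *\<^sub>R v + t *\<^sub>R u) - f (w + t *\<^sub>R v) - f (w + t *\<^sub>R u) + f w) - t\<^sup>2 * (H u \<bullet> v)\<bar> \<le> 2 * \<epsilon> * t\<^sup>2 * N * N"
      using est[OF \<epsilon>, of u v] est[OF \<epsilon>, of v u] by (auto simp: N_def add.commute)
    define t where "t = min d1 d2 / 2"
    have t: "0 < t" "t < d1" "t < d2" using d by (auto simp: t_def)
    have c: "w + t *\<^sub>R v + t *\<^sub>R u = w + t *\<^sub>R u + t *\<^sub>R v" by simp
    have "\<bar>t\<^sup>2 * (H u \<bullet> v) - t\<^sup>2 * (H v \<bullet> u)\<bar> \<le> 4 * (\<epsilon> * t\<^sup>2 * N * N)"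
      using 1[OF t(1,2)] 2[OF t(1,3)] unfolding c by linarith
    also have "\<bar>t\<^sup>2 * (H u \<bullet> v) - t\<^sup>2 * (H v \<bullet> u)\<bar> = t\<^sup>2 * \<bar>H u \<bullet> v - H v \<bullet> u\<bar>"
      by (simp add: abs_mult flip: right_diff_distrib)
    finally have "t\<^sup>2 * \<bar>H u \<bullet> v - H v \<bullet> u\<bar> \<le> t\<^sup>2 * (4 * \<epsilon> * (N * N))" by (simp add: algebra_simps)
    then have "\<bar>H u \<bullet> v - H v \<bullet> u\<bar> \<le> 4 * \<epsilon> * (N * N)" using t by simp
    also have "\<dots> \<le> 4 * \<epsilon> * M" using \<epsilon> by (simp add: M_def)
    also have "\<dots> = e" using N1 by (simp add: \<epsilon>_def)
    finally show ?thesis by simp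
  qed
  then have "\<bar>H u \<bullet> v - H v \<bullet> u\<bar> \<le> 0" by (rule field_le_epsilon)
  then show ?thesis by simp
qed

text \<open>Within a hypersurface a derivative is not unique as a linear map, and
  \<open>frechet_derivative\<close> merely selects one. Its value on a tangent vector is determined
  all the same: at points w + t X + o(t) of \<open>S\<close> the difference \<open>L\<close> of two
  derivatives is o(t), but also \<open>t *\<^sub>R L X\<close> up to o(t).\<close>

lemma has_derivative_within_tangent_unique:
  fixes f :: "'a::real_normed_vector \<Rightarrow> 'b::real_normed_vector"
  assumes D: "(f has_derivative D1) (at w within S)" "(f has_derivative D2) (at w within S)"
    and X: "\<And>\<eta>. \<eta> > 0 \<Longrightarrow> \<forall>\<^sub>F t in at_right 0. \<exists>p\<in>S. norm (p - w - t *\<^sub>R X) \<le> \<eta> * t"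
  shows "D1 X = D2 X"
proof -
  define L where "L = (\<lambda>h. D1 h - D2 h)"
  have L0: "((\<lambda>_. 0) has_derivative L) (at w within S)"
    using has_derivative_diff[OF D] by (simp add: L_def)
  then have bl: "bounded_linear L" by (rule has_derivative_bounded_linear)
  then obtain K where K: "K > 0" "\<And>x. norm (L x) \<le> norm x * K" using bounded_linear.pos_bounded by blast
  have lin: "linear L" using bl by (rule bounded_linear.linear)
  have "norm (L X) \<le> 0 + e" if e: "e > 0" for e
  proof -
    \<comment> \<open>The minimum with 1 gives \<open>norm (p - w) \<le> t * (norm X + 1)\<close>;
      the other entry makes both error terms together at most \<open>e * t\<close>.\<close>
    define \<epsilon> where "\<epsilon> = min 1 (e / (norm X + 1 + K))"
    have den: "norm X + 1 + K > 0" using K norm_ge_zero[of X] by linarith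
    have \<epsilon>: "\<epsilon> > 0" "\<epsilon> \<le> 1" "\<epsilon> * (norm X + 1 + K) \<le> e"
    proof -
      show "\<epsilon> > 0" "\<epsilon> \<le> 1" using e den by (auto simp: \<epsilon>_def)
      have "\<epsilon> \<le> e / (norm X + 1 + K)" by (simp add: \<epsilon>_def)
      then show "\<epsilon> * (norm X + 1 + K) \<le> e" using den by (simp only: pos_le_divide_eq)
    qed
    obtain d where d: "d > 0" "\<And>p. p \<in> S \<Longrightarrow> norm (p - w) < d \<Longrightarrow> norm (L (p - w)) \<le> \<epsilon> * norm (p - w)"
      using L0 \<epsilon>(1) unfolding has_derivative_within_alt by auto
    have "\<forall>\<^sub>F t::real in at_right 0. t \<in> {0<..<d / (norm X + 1)}"
      using d(1) by (intro eventually_at_rightI[of 0 "d / (norm X + 1)"]) (auto intro!: divide_pos_pos add_nonneg_pos)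
    then have "\<forall>\<^sub>F t in at_right 0. (\<exists>p\<in>S. norm (p - w - t *\<^sub>R X) \<le> \<epsilon> * t) \<and> t \<in> {0<..<d / (norm X + 1)}"
      using X[OF \<epsilon>(1)] by (rule eventually_conj[rotated])
    then have "\<exists>t. (\<exists>p\<in>S. norm (p - w - t *\<^sub>R X) \<le> \<epsilon> * t) \<and> t \<in> {0<..<d / (norm X + 1)}"
      by (intro eventually_happens'[of "at_right (0::real)"]) auto
    then obtain t p where t: "0 < t" "t < d / (norm X + 1)" and p: "p \<in> S" "norm (p - w - t *\<^sub>R X) \<le> \<epsilon> * t"
      by auto
    have pw: "norm (p - w) \<le> t * (norm X + \<epsilon>)"
      using norm_triangle_ineq[of "p - w - t *\<^sub>R X" "t *\<^sub>R X"] p(2) t by (simp add: algebra_simps)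
    also have "\<dots> \<le> t * (norm X + 1)" using t \<epsilon> by (intro mult_left_mono) auto
    finally have pw1: "norm (p - w) \<le> t * (norm X + 1)" .
    also have "\<dots> < d" using t(2) norm_ge_zero[of X] by (simp add: pos_less_divide_eq add_nonneg_pos)
    finally have "norm (L (p - w)) \<le> \<epsilon> * norm (p - w)" by (rule d(2)[OF p(1)])
    also have "\<dots> \<le> \<epsilon> * (t * (norm X + 1))" using pw1 \<epsilon> by (intro mult_left_mono) auto
    finally have 1: "norm (L (p - w)) \<le> \<epsilon> * (t * (norm X + 1))" .
    have 2: "norm (L (p - w - t *\<^sub>R X)) \<le> \<epsilon> * t * K"
      using K(2)[of "p - w - t *\<^sub>R X"] p(2) K(1) by (meson mult_right_mono less_imp_le order_trans)
    have "t *\<^sub>R L X = L (p - w) - L (p - w - t *\<^sub>R X)"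
      by (simp add: linear_diff[OF lin] linear_scale[OF lin])
    then have "norm (t *\<^sub>R L X) \<le> norm (L (p - w)) + norm (L (p - w - t *\<^sub>R X))"
      by (simp only: norm_triangle_ineq4)
    then have "norm (t *\<^sub>R L X) \<le> \<epsilon> * (t * (norm X + 1)) + \<epsilon> * t * K"
      using 1 2 by linarith
    also have "\<dots> = t * (\<epsilon> * (norm X + 1 + K))" by (simp add: algebra_simps)
    finally have "norm (L X) \<le> \<epsilon> * (norm X + 1 + K)" using t by simp
    then show ?thesis using \<epsilon> by simp
  qed
  then have "norm (L X) \<le> 0" by (rule field_le_epsilon)
  then show ?thesis by (simp add: L_def)
qed

text \<open>If the directions differed, the vector \<open>sgn z - sgn g\<close> would have positive
  product with \<open>z\<close> and negative product with \<open>g\<close>.\<close>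

lemma sgn_eq_if_halfspace_le:
  fixes g z :: "'a::real_inner"
  assumes "g \<noteq> 0" "z \<noteq> 0" and h: "\<And>v. z \<bullet> v > 0 \<Longrightarrow> g \<bullet> v \<ge> 0"
  shows "sgn g = sgn z"
proof (rule ccontr)
  assume ne: "sgn g \<noteq> sgn z"
  define c where "c = sgn z \<bullet> sgn g"
  have u: "sgn g \<bullet> sgn g = 1" "sgn z \<bullet> sgn z = 1"
    using assms by (auto simp: norm_sgn simp flip: norm_eq_1)
  have "0 < (sgn z - sgn g) \<bullet> (sgn z - sgn g)" using ne by simp
  also have "\<dots> = 2 - 2 * c" using u by (simp add: inner_diff_left inner_diff_right inner_commute c_def)
  finally have c: "c < 1" by simp
  have gz: "g = norm g *\<^sub>R sgn g" "z = norm z *\<^sub>R sgn z" using assms by (simp_all add: sgn_div_norm)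
  have "z \<bullet> (sgn z - sgn g) = norm z * (1 - c)"
    by (subst gz(2)) (simp only: inner_scaleR_left inner_diff_right u c_def right_diff_distrib)
  moreover have "g \<bullet> (sgn z - sgn g) = norm g * (c - 1)"
    by (subst gz(1)) (simp only: inner_scaleR_left inner_diff_right u c_def inner_commute[of "sgn g" "sgn z"] right_diff_distrib)
  moreover have "norm z > 0" "norm g > 0" using assms by auto
  moreover have "norm z * (1 - c) > 0" "norm g * (c - 1) < 0"
    using c calculation(3,4) by (auto simp: mult_pos_neg)
  ultimately show False using h[of "sgn z - sgn g"] by simp
qed

lemma has_derivative_directional:
  fixes f :: "'a::real_normed_vector \<Rightarrow> real"
  assumes "(f has_derivative D) (at w)"
  shows "((\<lambda>t. f (w + t *\<^sub>R v)) has_real_derivative D v) (at 0)"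
proof -
  have 1: "((\<lambda>t. w + t *\<^sub>R v) has_derivative (\<lambda>h. h *\<^sub>R v)) (at 0)"
    by (auto intro!: derivative_eq_intros)
  have lin: "linear D" using assms by (rule has_derivative_linear)
  have "(f has_derivative D) (at (w + 0 *\<^sub>R v))" using assms by simp
  from has_derivative_compose[OF 1 this] show ?thesis
    unfolding has_field_derivative_def
    by (rule has_derivative_eq_rhs) (simp add: fun_eq_iff linear_scale[OF lin] mult.commute)
qed

lemma eventually_directional_pos:
  fixes f :: "'a::real_normed_vector \<Rightarrow> real"
  assumes "(f has_derivative D) (at w)" "D v > 0"
  shows "\<forall>\<^sub>F t in at_right 0. f w < f (w + t *\<^sub>R v)"
proof -
  obtain d where "d > 0" "\<And>h. 0 < h \<Longrightarrow> h < d \<Longrightarrow> f w < f (w + h *\<^sub>R v)"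
    using DERIV_pos_inc_right[OF has_derivative_directional[OF assms(1)] assms(2)] by auto
  then show ?thesis by (intro eventually_at_rightI[of 0 d]) auto
qed

lemma eventually_directional_neg:
  fixes f :: "'a::real_normed_vector \<Rightarrow> real"
  assumes "(f has_derivative D) (at w)" "D v < 0"
  shows "\<forall>\<^sub>F t in at_right 0. f (w + t *\<^sub>R v) < f w"
proof -
  obtain d where "d > 0" "\<And>h. 0 < h \<Longrightarrow> h < d \<Longrightarrow> f (w + h *\<^sub>R v) < f w"
    using DERIV_neg_dec_right[OF has_derivative_directional[OF assms(1)] assms(2)] by auto
  then show ?thesis by (intro eventually_at_rightI[of 0 d]) auto
qed

section \<open>Boundary geometry\<close>

lemma at_right_witness:
  assumes "\<forall>\<^sub>F t::real in at_right 0. P t" "\<forall>\<^sub>F t in at_right 0. \<not> P t"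
  shows False
proof -
  have "\<forall>\<^sub>F t::real in at_right 0. False" using assms by eventually_elim simp
  then show False by simp
qed

lemma local_defining_functionD:
  assumes "local_defining_function \<Omega> w U \<rho>"
  shows "open U" "w \<in> U" "smooth_on U \<rho>" "\<And>x. x \<in> U \<Longrightarrow> x \<in> \<Omega> \<longleftrightarrow> 0 < \<rho> x"
    "\<And>x. x \<in> U \<Longrightarrow> \<rho> differentiable (at x)" "\<And>x. x \<in> U \<Longrightarrow> grad \<rho> x \<noteq> 0"
proof -
  show U: "open U" "w \<in> U" "smooth_on U \<rho>"
    using assms by (simp_all add: local_defining_function_def)
  show "x \<in> \<Omega> \<longleftrightarrow> 0 < \<rho> x" if "x \<in> U" for x
    using assms that unfolding local_defining_function_def by blast
  show d: "\<rho> differentiable (at x)" if "x \<in> U" for x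
    using U(3) that by (rule smooth_on_differentiable)
  show "grad \<rho> x \<noteq> 0" if "x \<in> U" for x
    using assms that GDERIV_iff_grad[OF d[OF that], of 0] by (auto simp: local_defining_function_def)
qed

lemma local_defining_function_at:
  "local_defining_function \<Omega> w U \<rho> \<Longrightarrow> w' \<in> U \<Longrightarrow> local_defining_function \<Omega> w' U \<rho>"
  by (simp add: local_defining_function_def)

section \<open>Inward normals, nearest points and exterior balls\<close>

context proper_open
begin

text \<open>Only the positivity set of \<open>\<rho>\<close> is prescribed. A negative value would
  persist nearby and separate \<open>w'\<close> from \<open>\<Omega>\<close>, although
  \<open>w'\<close> lies in its closure.\<close>

lemma defining_function_zero:
  assumes l: "local_defining_function \<Omega> w U \<rho>" and w: "w' \<in> frontier \<Omega>" "w' \<in> U"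
  shows "\<rho> w' = 0"
proof (rule antisym)
  note D = local_defining_functionD[OF l]
  show "\<rho> w' \<le> 0" using D(4) w frontier_not_in[OF w(1)] by (auto simp: not_le[symmetric])
  show "0 \<le> \<rho> w'"
  proof (rule ccontr)
    assume "\<not> 0 \<le> \<rho> w'"
    then have neg: "\<rho> w' < 0" by simp
    have "isCont \<rho> w'" using D(5)[OF w(2)] by (rule differentiable_imp_continuous_within)
    then have "\<forall>\<^sub>F x in nhds w'. \<rho> x < 0"
      using neg unfolding isCont_def tendsto_at_iff_tendsto_nhds by (rule order_tendstoD(2))
    moreover have "\<forall>\<^sub>F x in nhds w'. x \<in> U" using D(1) w(2) by (rule eventually_nhds_in_open)
    ultimately have "\<forall>\<^sub>F x in nhds w'. x \<notin> \<Omega>"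
      by eventually_elim (use D(4) in auto)
    then obtain S where "open S" "w' \<in> S" "S \<inter> \<Omega> = {}" by (auto simp: eventually_nhds)
    then have "w' \<notin> closure \<Omega>" using open_Int_closure_eq_empty[of S \<Omega>] by blast
    then show False using w(1) by (simp add: frontier_def)
  qed
qed

text \<open>Expresses the sign of the gradient in a direction through membership in
  \<open>\<Omega>\<close> alone, which makes different defining functions comparable.\<close>

lemma grad_direction:
  assumes l: "local_defining_function \<Omega> w U \<rho>" and w: "w \<in> frontier \<Omega>"
  shows "grad \<rho> w \<bullet> v > 0 \<Longrightarrow> \<forall>\<^sub>F t in at_right 0. w + t *\<^sub>R v \<in> \<Omega>"
    and "grad \<rho> w \<bullet> v < 0 \<Longrightarrow> \<forall>\<^sub>F t in at_right 0. w + t *\<^sub>R v \<notin> \<Omega>"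
proof -
  note D = local_defining_functionD[OF l]
  note der = has_derivative_grad[OF D(5)[OF D(2)]]
  have z: "\<rho> w = 0" by (rule defining_function_zero[OF l w D(2)])
  have "((\<lambda>t. w + t *\<^sub>R v) \<longlongrightarrow> w) (at_right 0)" by (auto intro!: tendsto_eq_intros)
  then have inU: "\<forall>\<^sub>F t in at_right 0. w + t *\<^sub>R v \<in> U"
    using D(1,2) by (rule topological_tendstoD)
  show "\<forall>\<^sub>F t in at_right 0. w + t *\<^sub>R v \<in> \<Omega>" if "grad \<rho> w \<bullet> v > 0"
    using eventually_directional_pos[OF der that] inU by eventually_elim (use D(4) z in auto)
  show "\<forall>\<^sub>F t in at_right 0. w + t *\<^sub>R v \<notin> \<Omega>" if "grad \<rho> w \<bullet> v < 0"
    using eventually_directional_neg[OF der that] inU by eventually_elim (use D(4) z in auto)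
qed

lemma sgn_grad_unique:
  assumes l: "local_defining_function \<Omega> w U \<rho>" "local_defining_function \<Omega> w U' \<rho>'" and w: "w \<in> frontier \<Omega>"
  shows "sgn (grad \<rho>' w) = sgn (grad \<rho> w)"
proof (rule sgn_eq_if_halfspace_le)
  show "grad \<rho>' w \<noteq> 0" "grad \<rho> w \<noteq> 0"
    using local_defining_functionD(2,6)[OF l(1)] local_defining_functionD(2,6)[OF l(2)] by auto
  fix v assume "0 < grad \<rho> w \<bullet> v"
  then have "\<forall>\<^sub>F t in at_right 0. w + t *\<^sub>R v \<in> \<Omega>" by (rule grad_direction(1)[OF l(1) w])
  then show "0 \<le> grad \<rho>' w \<bullet> v"
    using grad_direction(2)[OF l(2) w] at_right_witness[of "\<lambda>t. w + t *\<^sub>R v \<in> \<Omega>"] by (auto simp: not_le[symmetric])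
qed

lemma inward_normal_eq:
  assumes l: "local_defining_function \<Omega> w U \<rho>" and w: "w \<in> frontier \<Omega>"
  shows "inward_normal \<Omega> w = sgn (grad \<rho> w)"
  unfolding inward_normal_def
proof (rule the_equality)
  note D = local_defining_functionD[OF l]
  show "\<exists>U \<rho>' g. local_defining_function \<Omega> w U \<rho>' \<and> GDERIV \<rho>' w :> g \<and> sgn (grad \<rho> w) = sgn g"
    using l GDERIV_iff_grad[OF D(5)[OF D(2)]] by blast
  fix n assume "\<exists>U \<rho>' g. local_defining_function \<Omega> w U \<rho>' \<and> GDERIV \<rho>' w :> g \<and> n = sgn g"
  then obtain U' \<rho>' g where l': "local_defining_function \<Omega> w U' \<rho>'" and g: "GDERIV \<rho>' w :> g" "n = sgn g" by blast
  note D' = local_defining_functionD[OF l']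
  show "n = sgn (grad \<rho> w)"
    using sgn_grad_unique[OF l l' w] g GDERIV_iff_grad[OF D'(5)[OF D'(2)]] by simp
qed

text \<open>The ball about \<open>y\<close> through \<open>w\<close> lies in
  \<open>\<Omega>\<close>, so every direction having positive product with \<open>y - w\<close>
  enters \<open>\<Omega>\<close>.\<close>

lemma nearest_point_normal:
  assumes l: "local_defining_function \<Omega> w U \<rho>" and w: "w \<in> frontier \<Omega>"
    and y: "y \<in> \<Omega>" "bdist \<Omega> y = dist y w"
  shows "sgn (grad \<rho> w) = sgn (y - w)"
proof (rule sgn_eq_if_halfspace_le)
  show "grad \<rho> w \<noteq> 0" using local_defining_functionD(2,6)[OF l] by auto
  show z: "y - w \<noteq> 0" using y frontier_not_in[OF w] by auto
  fix v assume v: "0 < (y - w) \<bullet> v"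
  then have "v \<noteq> 0" by auto
  \<comment> \<open>The ray from \<open>w\<close> in direction \<open>v\<close> leaves the ball
    about \<open>y\<close> at \<open>t0\<close>: |y - w - t v|^2 differs from |y - w|^2 by t^2 |v|^2
    - 2 t \<open>((y - w) \<bullet> v)\<close>.\<close>
  define t0 where "t0 = 2 * ((y - w) \<bullet> v) / (v \<bullet> v)"
  have "v \<bullet> v > 0" using \<open>v \<noteq> 0\<close> by simp
  then have t0: "t0 > 0" using v by (simp add: t0_def)
  have "w + t *\<^sub>R v \<in> \<Omega>" if t: "0 < t" "t < t0" for t
  proof -
    have "t * (v \<bullet> v) < 2 * ((y - w) \<bullet> v)" using t(2) \<open>v \<bullet> v > 0\<close> by (simp add: t0_def pos_less_divide_eq)
    then have "t * (t * (v \<bullet> v)) < t * (2 * ((y - w) \<bullet> v))" using t(1) by (rule mult_strict_left_mono)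
    then have "(norm (y - (w + t *\<^sub>R v)))\<^sup>2 < (norm (y - w))\<^sup>2"
      unfolding power2_norm_eq_inner
      by (simp add: inner_diff_left inner_diff_right inner_add_left inner_add_right inner_commute algebra_simps)
    then have "norm (y - (w + t *\<^sub>R v)) < norm (y - w)" by (rule power2_less_imp_less) simp
    then have "w + t *\<^sub>R v \<in> ball y (bdist \<Omega> y)" by (simp add: y(2) dist_norm)
    then show ?thesis using ball_bdist_subset[OF y(1)] by blast
  qed
  then have "\<forall>\<^sub>F t in at_right 0. w + t *\<^sub>R v \<in> \<Omega>"
    using t0 by (intro eventually_at_rightI[of 0 t0]) auto
  then show "0 \<le> grad \<rho> w \<bullet> v"
    using grad_direction(2)[OF l w] at_right_witness[of "\<lambda>t. w + t *\<^sub>R v \<in> \<Omega>"] by (auto simp: not_le[symmetric])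
qed

text \<open>A point \<open>p\<close> of the ball satisfies |p - w'|^2 \<le> - 2 s
  \<open>((p - w') \<bullet> \<nu>)\<close>, so for small \<open>s\<close> the linear term of
  \<open>\<rho>\<close> outweighs the quadratic error. All radii up to \<open>r\<close> are provided
  so that a common one can be chosen later.\<close>

lemma local_exterior_ball:
  assumes l: "local_defining_function \<Omega> w U \<rho>"
  shows "\<exists>\<delta>>0. \<exists>r>0. \<forall>w'\<in>frontier \<Omega> \<inter> ball w \<delta>. \<forall>s. 0 < s \<and> s \<le> r \<longrightarrow>
    w' \<in> U \<and> cball (w' - s *\<^sub>R sgn (grad \<rho> w')) s \<inter> \<Omega> = {}"
proof -
  note D = local_defining_functionD[OF l]
  have gw: "norm (grad \<rho> w) > 0" using D(6)[OF D(2)] by simp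
  obtain \<delta>0 where \<delta>0: "\<delta>0 > 0" "cball w \<delta>0 \<subseteq> U" using D(1,2) open_contains_cball by blast
  obtain L where L: "L \<ge> 0" "\<And>x y. x \<in> cball w \<delta>0 \<Longrightarrow> y \<in> cball w \<delta>0 \<Longrightarrow> norm (grad \<rho> x - grad \<rho> y) \<le> L * norm (x - y)"
    using grad_lipschitz_cball[OF D(1,3) \<delta>0(2)] by blast
  \<comment> \<open>Within \<open>\<delta>\<close> of \<open>w\<close> the gradient keeps norm at
    least \<open>\<gamma>\<close>. The choice of \<open>r\<close> ensures
    \<open>2 * s * L \<le> \<gamma>\<close> and keeps the exterior ball where the Lipschitz bound is
    valid; \<open>L + 1\<close> avoids division by 0.\<close>
  define \<gamma> where "\<gamma> = norm (grad \<rho> w) / 2"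
  define \<delta> where "\<delta> = min (\<delta>0 / 2) (\<gamma> / (L + 1))"
  define r where "r = min (\<delta>0 / 4) (\<gamma> / (2 * (L + 1)))"
  have pos: "\<gamma> > 0" "\<delta> > 0" "r > 0" using gw \<delta>0 L(1) by (auto simp: \<gamma>_def \<delta>_def r_def)
  have "w' \<in> U \<and> cball (w' - s *\<^sub>R sgn (grad \<rho> w')) s \<inter> \<Omega> = {}"
    if w': "w' \<in> frontier \<Omega>" "w' \<in> ball w \<delta>" and s: "0 < s" "s \<le> r" for w' s
  proof
    have w'b: "w' \<in> cball w \<delta>0" "norm (w' - w) < \<delta>" using w'(2) \<delta>0 pos by (auto simp: \<delta>_def dist_norm norm_minus_commute)
    then show w'U: "w' \<in> U" using \<delta>0 by blast
    have "norm (grad \<rho> w' - grad \<rho> w) \<le> L * norm (w' - w)" using L(2) w'b(1) \<delta>0(1) by auto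
    also have "\<dots> \<le> (L + 1) * \<delta>" using L(1) w'b(2) by (intro mult_mono) auto
    also have "\<dots> \<le> (L + 1) * (\<gamma> / (L + 1))" using L(1) by (intro mult_left_mono) (auto simp: \<delta>_def)
    also have "\<dots> = \<gamma>" using L(1) by simp
    finally have "norm (grad \<rho> w' - grad \<rho> w) \<le> \<gamma>" .
    then have g: "norm (grad \<rho> w') \<ge> \<gamma>"
      using norm_triangle_ineq2[of "grad \<rho> w" "grad \<rho> w'"] unfolding \<gamma>_def by (simp add: norm_minus_commute)
    have g0: "grad \<rho> w' \<noteq> 0" using g pos by auto
    define \<nu> where "\<nu> = sgn (grad \<rho> w')"
    have \<nu>: "norm \<nu> = 1" "grad \<rho> w' = norm (grad \<rho> w') *\<^sub>R \<nu>" using g0 by (simp_all add: \<nu>_def norm_sgn sgn_div_norm)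
    have "p \<notin> \<Omega>" if p: "p \<in> cball (w' - s *\<^sub>R \<nu>) s" for p
    proof
      assume pO: "p \<in> \<Omega>"
      have ns: "norm (p - w' + s *\<^sub>R \<nu>) \<le> s" using p by (simp add: dist_norm norm_minus_commute algebra_simps)
      then have "(norm (p - w' + s *\<^sub>R \<nu>))\<^sup>2 \<le> s\<^sup>2" by (intro power_mono) auto
      also have "(norm (p - w' + s *\<^sub>R \<nu>))\<^sup>2 = (norm (p - w'))\<^sup>2 + 2 * s * ((p - w') \<bullet> \<nu>) + s\<^sup>2"
        by (rule norm_sq_add_scaleR[OF \<nu>(1)])
      finally have q: "(norm (p - w'))\<^sup>2 \<le> - 2 * s * ((p - w') \<bullet> \<nu>)" by simp
      have "norm (p - w') \<le> 2 * s"
        using norm_triangle_ineq4[of "p - w' + s *\<^sub>R \<nu>" "s *\<^sub>R \<nu>"] ns \<nu>(1) s by simp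
      also have "\<dots> \<le> \<delta>0 / 2" using s by (simp add: r_def)
      finally have "norm (p - w') \<le> \<delta>0 / 2" .
      moreover have "norm (w' - w) \<le> \<delta>0 / 2" using w'b(2) by (simp add: \<delta>_def)
      ultimately have "p \<in> cball w \<delta>0"
        using norm_triangle_ineq[of "p - w'" "w' - w"] by (simp add: dist_norm norm_minus_commute)
      have "p \<in> U" using \<open>p \<in> cball w \<delta>0\<close> \<delta>0(2) by blast
      have "p \<noteq> w'" using pO frontier_not_in[OF w'(1)] by auto
      then have n0: "(norm (p - w'))\<^sup>2 > 0" by simp
      have "\<rho> p \<le> \<rho> w' + grad \<rho> w' \<bullet> (p - w') + L * (norm (p - w'))\<^sup>2"
        by (rule quadratic_upper_bound[OF D(3) \<delta>0(2) L(2,1) w'b(1) \<open>p \<in> cball w \<delta>0\<close>])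
      also have "\<rho> w' = 0" by (rule defining_function_zero[OF l w'(1) w'U])
      finally have "\<rho> p \<le> grad \<rho> w' \<bullet> (p - w') + L * (norm (p - w'))\<^sup>2" by simp
      moreover have "grad \<rho> w' \<bullet> (p - w') = norm (grad \<rho> w') * ((p - w') \<bullet> \<nu>)"
        by (subst \<nu>(2)) (simp add: inner_commute)
      ultimately have "2 * s * \<rho> p \<le> 2 * s * (norm (grad \<rho> w') * ((p - w') \<bullet> \<nu>) + L * (norm (p - w'))\<^sup>2)"
        using s by (intro mult_left_mono) auto
      also have "\<dots> = norm (grad \<rho> w') * (2 * s * ((p - w') \<bullet> \<nu>)) + 2 * s * L * (norm (p - w'))\<^sup>2"
        by (simp add: algebra_simps)
      also have "\<dots> \<le> norm (grad \<rho> w') * (- (norm (p - w'))\<^sup>2) + 2 * s * L * (norm (p - w'))\<^sup>2"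
        using q by (intro add_right_mono mult_left_mono) auto
      also have "\<dots> \<le> \<gamma> * (- (norm (p - w'))\<^sup>2) + 2 * s * L * (norm (p - w'))\<^sup>2"
        using g by (simp add: mult_right_mono)
      also have "\<dots> = (2 * s * L - \<gamma>) * (norm (p - w'))\<^sup>2" by (simp add: algebra_simps)
      also have "\<dots> \<le> 0"
      proof (rule mult_nonpos_nonneg)
        have "s \<le> \<gamma> / (2 * (L + 1))" using s by (simp add: r_def)
        then have "s * (2 * (L + 1)) \<le> \<gamma>" using L(1) by (simp add: pos_le_divide_eq)
        then show "2 * s * L - \<gamma> \<le> 0" using s by (simp add: algebra_simps)
      qed simp
      finally have "\<rho> p \<le> 0" using s by (simp add: mult_le_0_iff)
      then show False using D(4) \<open>p \<in> U\<close> pO by auto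
    qed
    then show "cball (w' - s *\<^sub>R sgn (grad \<rho> w')) s \<inter> \<Omega> = {}" unfolding \<nu>_def by blast
  qed
  then show ?thesis using pos by (intro exI[of _ \<delta>] conjI exI[of _ r]) auto
qed

text \<open>Compactness of the boundary reduces the radius to a finite minimum. The normal is
  expressed by \<open>y - w\<close>, so the conclusion no longer refers to a local defining
  function.\<close>

lemma uniform_exterior_ball:
  assumes sb: "smoothly_bounded \<Omega>"
  obtains r where "r > 0" "\<And>w y. w \<in> frontier \<Omega> \<Longrightarrow> y \<in> \<Omega> \<Longrightarrow> bdist \<Omega> y = dist y w \<Longrightarrow>
    cball (w - r *\<^sub>R sgn (y - w)) r \<inter> \<Omega> = {}"
proof -
  have cpt: "compact (frontier \<Omega>)"
    using sb by (simp add: smoothly_bounded_def compact_frontier_bounded)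
  have "\<exists>\<delta> r. \<delta> > 0 \<and> r > 0 \<and> (\<forall>w'\<in>frontier \<Omega> \<inter> ball w \<delta>. \<forall>s y. 0 < s \<and> s \<le> r \<and> y \<in> \<Omega> \<and> bdist \<Omega> y = dist y w' \<longrightarrow>
    cball (w' - s *\<^sub>R sgn (y - w')) s \<inter> \<Omega> = {})" if w: "w \<in> frontier \<Omega>" for w
  proof -
    obtain U \<rho> where l: "local_defining_function \<Omega> w U \<rho>"
      using sb w by (auto simp: smoothly_bounded_def)
    obtain \<delta> r where "\<delta> > 0" "r > 0" and *: "\<And>w' s. w'\<in>frontier \<Omega> \<inter> ball w \<delta> \<Longrightarrow> 0 < s \<and> s \<le> r \<Longrightarrow>
      w' \<in> U \<and> cball (w' - s *\<^sub>R sgn (grad \<rho> w')) s \<inter> \<Omega> = {}"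
      using local_exterior_ball[OF l] by blast
    moreover have "cball (w' - s *\<^sub>R sgn (y - w')) s \<inter> \<Omega> = {}"
      if "w' \<in> frontier \<Omega> \<inter> ball w \<delta>" "0 < s \<and> s \<le> r" "y \<in> \<Omega>" "bdist \<Omega> y = dist y w'" for w' s y
      using *[OF that(1,2)] nearest_point_normal[OF local_defining_function_at[OF l, of w'] _ that(3,4)] that(1) by auto
    ultimately show ?thesis by blast
  qed
  then obtain \<delta> r where dr: "\<And>w. w \<in> frontier \<Omega> \<Longrightarrow> \<delta> w > 0" "\<And>w. w \<in> frontier \<Omega> \<Longrightarrow> r w > 0"
    "\<And>w w' s y. w \<in> frontier \<Omega> \<Longrightarrow> w' \<in> frontier \<Omega> \<inter> ball w (\<delta> w) \<Longrightarrow> 0 < s \<Longrightarrow> s \<le> r w \<Longrightarrow> y \<in> \<Omega> \<Longrightarrow>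
      bdist \<Omega> y = dist y w' \<Longrightarrow> cball (w' - s *\<^sub>R sgn (y - w')) s \<inter> \<Omega> = {}" by metis
  obtain D where D: "D \<subseteq> frontier \<Omega>" "finite D" "frontier \<Omega> \<subseteq> (\<Union>w\<in>D. ball w (\<delta> w))"
    by (rule compactE_image[OF cpt, of "frontier \<Omega>" "\<lambda>w. ball w (\<delta> w)"]) (use dr(1) in auto)
  have ne: "D \<noteq> {}" using D(3) frontier_nonempty by auto
  show thesis
  proof (rule that[of "Min (r ` D)"])
    show "Min (r ` D) > 0" using D ne dr(2) by (auto simp: subset_iff)
    fix w y assume w: "w \<in> frontier \<Omega>" and y: "y \<in> \<Omega>" "bdist \<Omega> y = dist y w"
    then obtain v where v: "v \<in> D" "w \<in> ball v (\<delta> v)" using D(3) by blast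
    show "cball (w - Min (r ` D) *\<^sub>R sgn (y - w)) (Min (r ` D)) \<inter> \<Omega> = {}"
    proof (rule dr(3)[of v w])
      show "0 < Min (r ` D)" using D ne dr(2) by (auto simp: subset_iff)
      show "Min (r ` D) \<le> r v" using D v by auto
    qed (use v D w y in auto)
  qed
qed

lemma neg_ln_bdist_subharmonic_near_boundary:
  assumes sb: "smoothly_bounded \<Omega>"
  shows "\<exists>U. open U \<and> frontier \<Omega> \<subseteq> U \<and> subharmonic_on (\<Omega> \<inter> U) (\<lambda>x. - ln (bdist \<Omega> x))"
proof -
  obtain r where r: "r > 0" "\<And>w y. w \<in> frontier \<Omega> \<Longrightarrow> y \<in> \<Omega> \<Longrightarrow> bdist \<Omega> y = dist y w \<Longrightarrow>
    cball (w - r *\<^sub>R sgn (y - w)) r \<inter> \<Omega> = {}" using uniform_exterior_ball[OF sb] by metis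
  \<comment> \<open>Dividing by the full dimension m instead of m - 2 keeps the width positive for m
    \<le> 2 too, and still yields the closeness condition of the exterior ball lemma.\<close>
  define U where "U = {x. bdist \<Omega> x < r / real DIM('a)}"
  have oU: "open U" unfolding U_def
    by (intro open_Collect_less continuous_on_bdist continuous_intros)
  have fU: "frontier \<Omega> \<subseteq> U" using r(1) by (auto simp: U_def bdist_def)
  have "subharmonic_on (\<Omega> \<inter> U) (\<lambda>x. - ln (bdist \<Omega> x))"
  proof (rule neg_ln_bdist_subharmonicI)
    fix y and \<eta> :: real assume y: "y \<in> \<Omega> \<inter> U" and \<eta>: "\<eta> > 0"
    obtain w where w: "w \<in> frontier \<Omega>" "bdist \<Omega> y = dist y w" by (rule nearest_boundary_point)
    have "y - w \<noteq> 0" using y frontier_not_in[OF w(1)] by auto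
    show "\<forall>\<^sub>F t in at_right 0. - \<eta> \<le> discrete_laplacian (\<lambda>x. - ln (bdist \<Omega> x)) t y"
    proof (rule exterior_ball_touching[OF r(1) r(2)[OF w(1) _ w(2)] _ _ _ \<eta>])
      have "y - (w - r *\<^sub>R sgn (y - w)) = (norm (y - w) + r) *\<^sub>R sgn (y - w)"
      proof -
        have "norm (y - w) *\<^sub>R sgn (y - w) = y - w"
          using \<open>y - w \<noteq> 0\<close> by (simp add: sgn_div_norm)
        then show ?thesis by (simp add: scaleR_left_distrib)
      qed
      then show "norm (y - (w - r *\<^sub>R sgn (y - w))) = bdist \<Omega> y + r"
        using \<open>y - w \<noteq> 0\<close> r(1) by (simp add: norm_sgn w(2) dist_norm)
      have "bdist \<Omega> y * real DIM('a) \<le> r" using y by (simp add: U_def pos_less_divide_eq)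
      then show "(real DIM('a) - 2) * bdist \<Omega> y \<le> r"
        using bdist_pos[of y] y by (simp add: algebra_simps)
    qed (use y in auto)
  qed (use open_\<Omega> oU in auto)
  then show ?thesis using oU fU by blast
qed

end

section \<open>Mean curvature\<close>

lemma second_derivative_neg_imp_less:
  fixes p p' :: "real \<Rightarrow> real"
  assumes p: "\<forall>\<^sub>F t in nhds 0. (p has_real_derivative p' t) (at t)"
    and p': "p' 0 = 0" "(p' has_real_derivative D) (at 0)" "D < 0"
  shows "\<forall>\<^sub>F t in at_right 0. p t < p 0"
proof -
  obtain d1 where d1: "d1 > 0" "\<And>t. \<bar>t\<bar> < d1 \<Longrightarrow> (p has_real_derivative p' t) (at t)"
    using p by (auto simp: eventually_nhds_metric dist_real_def)
  obtain d2 where d2: "d2 > 0" "\<And>h. 0 < h \<Longrightarrow> h < d2 \<Longrightarrow> p' h < 0"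
    using DERIV_neg_dec_right[OF p'(2,3)] p'(1) by auto
  have "p t < p 0" if t: "0 < t" "t < min d1 d2" for t
  proof -
    obtain z where z: "0 < z" "z < t" "p t - p 0 = (t - 0) * p' z"
      using MVT2[of 0 t p p'] t d1(2) by auto
    then have "(t - 0) * p' z < 0" using d2(2)[of z] t by (intro mult_pos_neg) auto
    then show ?thesis using z by simp
  qed
  then show ?thesis using d1(1) d2(1) by (intro eventually_at_rightI[of 0 "min d1 d2"]) auto
qed

context proper_open
begin

text \<open>Tilting \<open>X\<close> slightly inward and outward gives one point in
  \<open>\<Omega>\<close> and one outside; the short segment between them meets the frontier. This
  takes the place of the implicit function theorem.\<close>

lemma tangent_approximation:
  assumes l: "local_defining_function \<Omega> w U \<rho>" and w: "w \<in> frontier \<Omega>"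
    and X: "grad \<rho> w \<bullet> X = 0" and \<eta>: "\<eta> > 0"
  shows "\<forall>\<^sub>F t in at_right 0. \<exists>p\<in>frontier \<Omega>. norm (p - w - t *\<^sub>R X) \<le> \<eta> * t"
proof -
  have g: "grad \<rho> w \<noteq> 0" using local_defining_functionD(2,6)[OF l] by auto
  define \<nu> where "\<nu> = sgn (grad \<rho> w)"
  have \<nu>: "norm \<nu> = 1" "grad \<rho> w \<bullet> \<nu> > 0" using g by (auto simp: \<nu>_def norm_sgn sgn_div_norm)
  have "\<forall>\<^sub>F t in at_right 0. w + t *\<^sub>R (X + \<eta> *\<^sub>R \<nu>) \<in> \<Omega>"
    by (rule grad_direction(1)[OF l w]) (simp add: inner_add_right X \<nu> \<eta>)
  moreover have "\<forall>\<^sub>F t in at_right 0. w + t *\<^sub>R (X - \<eta> *\<^sub>R \<nu>) \<notin> \<Omega>"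
    by (rule grad_direction(2)[OF l w]) (simp add: inner_diff_right X \<nu> \<eta>)
  moreover have "\<forall>\<^sub>F t::real in at_right 0. 0 < t" by (simp add: eventually_at_right_less)
  ultimately show ?thesis
  proof eventually_elim
    case (elim t)
    obtain p where p: "p \<in> closed_segment (w + t *\<^sub>R (X + \<eta> *\<^sub>R \<nu>)) (w + t *\<^sub>R (X - \<eta> *\<^sub>R \<nu>))" "p \<in> frontier \<Omega>"
      using segment_meets_frontier[OF elim(1,2)] by blast
    have "closed_segment (w + t *\<^sub>R (X + \<eta> *\<^sub>R \<nu>)) (w + t *\<^sub>R (X - \<eta> *\<^sub>R \<nu>)) \<subseteq> cball (w + t *\<^sub>R X) (\<eta> * t)"
      using elim(3) \<eta> \<nu> by (intro closed_segment_subset) (auto simp: dist_norm scaleR_right_distrib scaleR_right_diff_distrib)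
    then have "norm (p - w - t *\<^sub>R X) \<le> \<eta> * t" using p by (auto simp: dist_norm norm_minus_commute algebra_simps)
    then show ?case using p by blast
  qed
qed

text \<open>The derivative of the normalising factor contributes only a multiple of the gradient,
  which is orthogonal to \<open>Y\<close>.\<close>

lemma second_fundamental_form_eq:
  assumes l: "local_defining_function \<Omega> w U \<rho>" and w: "w \<in> frontier \<Omega>"
    and H: "(grad \<rho> has_derivative H) (at w)"
    and X: "grad \<rho> w \<bullet> X = 0" and Y: "grad \<rho> w \<bullet> Y = 0"
  shows "second_fundamental_form \<Omega> w X Y = - (H X \<bullet> Y) / norm (grad \<rho> w)"
proof -
  note D = local_defining_functionD[OF l]
  define g where "g = grad \<rho> w"
  have g: "g \<noteq> 0" using D(2,6) by (auto simp: g_def)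
  have "(\<lambda>x. inverse (norm (grad \<rho> x))) differentiable (at w)"
    using H g by (intro differentiable_inverse differentiable_compose[OF differentiable_norm_at])
      (auto simp: g_def differentiable_def)
  then obtain c where c: "((\<lambda>x. inverse (norm (grad \<rho> x))) has_derivative c) (at w)"
    by (auto simp: differentiable_def)
  define N' where "N' = (\<lambda>v. inverse (norm g) *\<^sub>R H v + c v *\<^sub>R g)"
  have "((\<lambda>x. inverse (norm (grad \<rho> x)) *\<^sub>R grad \<rho> x) has_derivative N') (at w)"
    unfolding N'_def g_def by (rule has_derivative_scaleR[OF c H])
  then have "((\<lambda>x. sgn (grad \<rho> x)) has_derivative N') (at w within frontier \<Omega>)"
    unfolding sgn_div_norm by (rule has_derivative_at_withinI)
  moreover have "\<forall>\<^sub>F x in at w within frontier \<Omega>. sgn (grad \<rho> x) = inward_normal \<Omega> x"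
  proof -
    have "\<forall>\<^sub>F x in nhds w. x \<in> U" using D(1,2) by (rule eventually_nhds_in_open)
    then show ?thesis unfolding eventually_at_filter
      by eventually_elim (metis inward_normal_eq local_defining_function_at l)
  qed
  ultimately have N: "(inward_normal \<Omega> has_derivative N') (at w within frontier \<Omega>)"
    by (rule has_derivative_transform_eventually) (use w inward_normal_eq[OF l w] in auto)
  then have "(inward_normal \<Omega> has_derivative frechet_derivative (inward_normal \<Omega>) (at w within frontier \<Omega>)) (at w within frontier \<Omega>)"
    using frechet_derivative_works differentiable_def by blast
  then have "frechet_derivative (inward_normal \<Omega>) (at w within frontier \<Omega>) X = N' X"
    by (rule has_derivative_within_tangent_unique[OF _ N tangent_approximation[OF l w X]])
  then show ?thesis using Y
    by (simp add: second_fundamental_form_def N'_def g_def inner_add_left divide_inverse mult.commute)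
qed

text \<open>Rewrites the eigenvalue definition as a trace of projected ambient basis vectors, the
  very directions that occur in the discrete Laplacian.\<close>

lemma mean_curvature_eq:
  assumes l: "local_defining_function \<Omega> w U \<rho>" and w: "w \<in> frontier \<Omega>"
    and H: "(grad \<rho> has_derivative H) (at w)" and \<nu>: "\<nu> = sgn (grad \<rho> w)"
  shows "mean_curvature \<Omega> w =
    - (\<Sum>e\<in>Basis. H (e - (e \<bullet> \<nu>) *\<^sub>R \<nu>) \<bullet> (e - (e \<bullet> \<nu>) *\<^sub>R \<nu>)) / norm (grad \<rho> w) / (real DIM('a) - 1)"
proof -
  note D = local_defining_functionD[OF l]
  define g where "g = grad \<rho> w"
  have g: "g \<noteq> 0" using D(2,6) by (auto simp: g_def)
  have "norm \<nu> = 1" using g by (simp add: \<nu> g_def norm_sgn)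
  then have \<nu>1: "\<nu> \<bullet> \<nu> = 1" by (simp only: norm_eq_1)
  have g\<nu>: "g = norm g *\<^sub>R \<nu>" using g by (simp add: \<nu> g_def sgn_div_norm)
  define T where "T = tangent_space \<Omega> w"
  have T: "X \<in> T \<longleftrightarrow> X \<bullet> \<nu> = 0" for X
    by (simp add: T_def tangent_space_def inward_normal_eq[OF l w] \<nu>)
  have Tg: "g \<bullet> X = 0" if "X \<in> T" for X
    using that by (subst g\<nu>) (simp add: T inner_commute)
  define b where "b = (\<lambda>X Y. - (H X \<bullet> Y) / norm g)"
  define P where "P = (\<lambda>e. e - (e \<bullet> \<nu>) *\<^sub>R \<nu>)"
  have linH: "linear H" using H by (rule has_derivative_linear)
  have bil: "bilinear b"
    unfolding bilinear_def b_def
    by (auto intro!: linearI simp: linear_add[OF linH] linear_scale[OF linH] inner_add_left inner_add_right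
        add_divide_distrib diff_divide_distrib)
  have sym: "b X Y = b Y X" for X Y
    using hessian_symmetric[OF D(1,2,5) H, of X Y] by (simp add: b_def)
  have sff: "second_fundamental_form \<Omega> w X Y = b X Y" if "X \<in> T" "Y \<in> T" for X Y
    unfolding b_def g_def by (rule second_fundamental_form_eq[OF l w H]) (use Tg that in \<open>auto simp: g_def\<close>)
  have E: "curvature_eigenspace \<Omega> w \<kappa> = {X \<in> T. \<forall>Y\<in>T. b X Y = \<kappa> * (X \<bullet> Y)}" for \<kappa>
    unfolding curvature_eigenspace_def T_def[symmetric] using sff by auto
  have "subspace T" by (auto simp: subspace_def T inner_add_left)
  moreover have "P e \<in> T" for e unfolding T P_def using \<nu>1 by (simp add: inner_diff_left)
  moreover have "P e \<bullet> X = e \<bullet> X" if "X \<in> T" for e X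
    using that unfolding T P_def by (simp add: inner_diff_left inner_commute[of \<nu>])
  ultimately have "(\<Sum>\<kappa>\<in>principal_curvatures \<Omega> w. real (dim (curvature_eigenspace \<Omega> w \<kappa>)) * \<kappa>) = (\<Sum>e\<in>Basis. b (P e) (P e))"
    unfolding principal_curvatures_def E by (intro weighted_eigenvalue_sum bil sym)
  also have "\<dots> = - (\<Sum>e\<in>Basis. H (P e) \<bullet> P e) / norm g"
    unfolding b_def by (simp add: sum_negf flip: sum_divide_distrib)
  finally show ?thesis unfolding mean_curvature_def P_def g_def by simp
qed

text \<open>Up to o(t^2), \<open>\<rho>\<close> along the parabola is t^2 / 2 times the left side of
  \<open>neg\<close>: the bending \<open>\<zeta>\<close> has to outweigh the Hessian.\<close>

lemma parabola_outside:
  assumes l: "local_defining_function \<Omega> w U \<rho>" and w: "w \<in> frontier \<Omega>"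
    and H: "(grad \<rho> has_derivative H) (at w)"
    and \<xi>: "grad \<rho> w \<bullet> \<xi> = 0" and neg: "H \<xi> \<bullet> \<xi> + 2 * (grad \<rho> w \<bullet> \<zeta>) < 0"
  shows "\<forall>\<^sub>F t in at_right 0. w + t *\<^sub>R \<xi> + t\<^sup>2 *\<^sub>R \<zeta> \<notin> \<Omega>"
proof -
  note D = local_defining_functionD[OF l]
  define \<gamma> where "\<gamma> = (\<lambda>t. w + t *\<^sub>R \<xi> + t\<^sup>2 *\<^sub>R \<zeta>)"
  define \<gamma>' where "\<gamma>' = (\<lambda>t. \<xi> + (2 * t) *\<^sub>R \<zeta>)"
  have \<gamma>: "(\<gamma> has_derivative (\<lambda>h. h *\<^sub>R \<gamma>' t)) (at t)" for t
    unfolding \<gamma>_def \<gamma>'_def by (auto intro!: derivative_eq_intros simp: fun_eq_iff algebra_simps)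
  have \<gamma>': "(\<gamma>' has_derivative (\<lambda>h. h *\<^sub>R (2 *\<^sub>R \<zeta>))) (at t)" for t
    unfolding \<gamma>'_def by (auto intro!: derivative_eq_intros simp: fun_eq_iff algebra_simps)
  have \<gamma>0: "\<gamma> 0 = w" "\<gamma>' 0 = \<xi>" by (simp_all add: \<gamma>_def \<gamma>'_def)
  have linH: "linear H" using H by (rule has_derivative_linear)
  have z: "\<rho> w = 0" by (rule defining_function_zero[OF l w D(2)])
  have "(\<gamma> \<longlongrightarrow> \<gamma> 0) (nhds 0)"
    using has_derivative_continuous[OF \<gamma>, of 0] by (simp only: isCont_def tendsto_at_iff_tendsto_nhds)
  then have "(\<gamma> \<longlongrightarrow> w) (nhds 0)" by (simp only: \<gamma>0)
  then have inU: "\<forall>\<^sub>F t in nhds 0. \<gamma> t \<in> U" using D(1,2) by (rule topological_tendstoD)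
  have "\<forall>\<^sub>F t in at_right 0. \<rho> (\<gamma> t) < \<rho> (\<gamma> 0)"
  proof (rule second_derivative_neg_imp_less)
    show "\<forall>\<^sub>F t in nhds 0. ((\<lambda>t. \<rho> (\<gamma> t)) has_real_derivative grad \<rho> (\<gamma> t) \<bullet> \<gamma>' t) (at t)"
      using inU
    proof eventually_elim
      case (elim t)
      show ?case unfolding has_field_derivative_def
        using has_derivative_compose[OF \<gamma> has_derivative_grad[OF D(5)[OF elim]]]
        by (rule has_derivative_eq_rhs) (simp add: fun_eq_iff mult.commute)
    qed
    show "grad \<rho> (\<gamma> 0) \<bullet> \<gamma>' 0 = 0" using \<xi> by (simp add: \<gamma>0)
    have "(grad \<rho> has_derivative H) (at (\<gamma> 0))" using H by (simp add: \<gamma>0)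
    from has_derivative_inner[OF has_derivative_compose[OF \<gamma> this] \<gamma>']
    show "((\<lambda>t. grad \<rho> (\<gamma> t) \<bullet> \<gamma>' t) has_real_derivative H \<xi> \<bullet> \<xi> + 2 * (grad \<rho> w \<bullet> \<zeta>)) (at 0)"
      unfolding has_field_derivative_def
      by (rule has_derivative_eq_rhs) (simp add: fun_eq_iff \<gamma>0 linear_scale[OF linH] algebra_simps)
  qed (rule neg)
  moreover have "\<forall>\<^sub>F t in at_right 0. \<gamma> t \<in> U"
    using inU by (rule filter_leD[rotated]) (simp add: at_within_def)
  ultimately show ?thesis
    unfolding \<gamma>0 z
    by eventually_elim (use D(4) in \<open>auto simp: \<gamma>_def not_less[symmetric]\<close>)
qed

text \<open>Moving the foot point along parabolas outside \<open>\<Omega>\<close> bounds the distance from above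
  without any regularity of the nearest-point projection, so focal points need no special
  treatment. The tangential velocity of the foot point is \<open>a\<close> times that of \<open>x\<close>.\<close>

lemma parabola_touching:
  fixes \<tau> :: "'a \<Rightarrow> real"
  assumes y: "y \<in> \<Omega>" and w: "w \<in> frontier \<Omega>" and d: "bdist \<Omega> y = d" and \<nu>: "y - w = d *\<^sub>R \<nu>" "norm \<nu> = 1"
    and out: "\<And>e. e \<in> Basis \<Longrightarrow> \<forall>\<^sub>F t in at_right 0. w + t *\<^sub>R (a *\<^sub>R (e - (e \<bullet> \<nu>) *\<^sub>R \<nu>)) + t\<^sup>2 *\<^sub>R (\<tau> e *\<^sub>R \<nu>) \<notin> \<Omega>"
      "\<And>e. e \<in> Basis \<Longrightarrow> \<forall>\<^sub>F t in at_right 0. w + t *\<^sub>R (- a *\<^sub>R (e - (e \<bullet> \<nu>) *\<^sub>R \<nu>)) + t\<^sup>2 *\<^sub>R (\<tau> e *\<^sub>R \<nu>) \<notin> \<Omega>"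
    and pos: "- \<eta> * d\<^sup>2 < 1 + 2 * d * (\<Sum>e\<in>Basis. \<tau> e) - (1 - a)\<^sup>2 * (real DIM('a) - 1)"
  shows "\<forall>\<^sub>F t in at_right 0. - \<eta> \<le> discrete_laplacian (\<lambda>x. - ln (bdist \<Omega> x)) t y"
proof -
  have d0: "d > 0" using bdist_pos[OF y] d by simp
  have \<nu>1: "\<nu> \<bullet> \<nu> = 1" using \<nu>(2) by (simp add: norm_eq_1)
  define u where "u = (\<lambda>x. - ln (bdist \<Omega> x))"
  \<comment> \<open>\<open>F e t\<close> is the squared distance from
    \<open>y + t *\<^sub>R e\<close> to its foot point, split into normal and tangential parts;
    \<open>lap e\<close> is the limit of the second-difference quotients of
    \<open>- ln (F e t) / 2\<close>.\<close>
  define F where "F = (\<lambda>e t. (d + t * (e \<bullet> \<nu>) - t\<^sup>2 * \<tau> e)\<^sup>2 + t\<^sup>2 * ((1 - a)\<^sup>2 * (1 - (e \<bullet> \<nu>)\<^sup>2)))"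
  define lap where "lap = (\<lambda>e. ((e \<bullet> \<nu>)\<^sup>2 + 2 * d * \<tau> e - (1 - a)\<^sup>2 * (1 - (e \<bullet> \<nu>)\<^sup>2)) / d\<^sup>2)"
  have F0: "F e 0 = d\<^sup>2" for e by (simp add: F_def)
  have normF: "(norm (y + t *\<^sub>R e - (w + t *\<^sub>R (a *\<^sub>R (e - (e \<bullet> \<nu>) *\<^sub>R \<nu>)) + t\<^sup>2 *\<^sub>R (\<tau> e *\<^sub>R \<nu>))))\<^sup>2 = F e t"
    if e: "e \<in> Basis" for e t
  proof -
    define eT where "eT = e - (e \<bullet> \<nu>) *\<^sub>R \<nu>"
    have eT: "eT \<bullet> \<nu> = 0" "eT \<bullet> eT = 1 - (e \<bullet> \<nu>)\<^sup>2"
      using e \<nu>1 by (simp_all add: eT_def inner_diff_left inner_diff_right inner_commute power2_eq_square)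
    have "y + t *\<^sub>R e - (w + t *\<^sub>R (a *\<^sub>R eT) + t\<^sup>2 *\<^sub>R (\<tau> e *\<^sub>R \<nu>)) =
        (y - w) + t *\<^sub>R e - t *\<^sub>R (a *\<^sub>R eT) - t\<^sup>2 *\<^sub>R (\<tau> e *\<^sub>R \<nu>)" by simp
    also have "\<dots> = (d + t * (e \<bullet> \<nu>) - t\<^sup>2 * \<tau> e) *\<^sub>R \<nu> + (t * (1 - a)) *\<^sub>R eT"
      unfolding \<nu>(1) by (simp add: eT_def algebra_simps)
    finally show ?thesis unfolding eT_def[symmetric] power2_norm_eq_inner F_def
      using eT \<nu>1 by (simp add: inner_add_left inner_add_right inner_commute power2_eq_square)
  qed
  have lim: "((\<lambda>t. (- ln (F e t) / 2 + - ln (F e (- t)) / 2 - 2 * (- ln (F e 0) / 2)) / t\<^sup>2) \<longlongrightarrow> lap e) (at_right 0)" for e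
  proof -
    define Q' where "Q' = (\<lambda>t. 2 * (d + t * (e \<bullet> \<nu>) - t\<^sup>2 * \<tau> e) * ((e \<bullet> \<nu>) - 2 * t * \<tau> e) + 2 * t * ((1 - a)\<^sup>2 * (1 - (e \<bullet> \<nu>)\<^sup>2)))"
    define Q2 where "Q2 = 2 * (e \<bullet> \<nu>)\<^sup>2 - 4 * d * \<tau> e + 2 * ((1 - a)\<^sup>2 * (1 - (e \<bullet> \<nu>)\<^sup>2))"
    have "((\<lambda>t. (- ln (F e t) / 2 + - ln (F e (- t)) / 2 - 2 * (- ln (F e 0) / 2)) / t\<^sup>2)
        \<longlongrightarrow> 1 / (2 * (F e 0)\<^sup>2) * (Q' 0)\<^sup>2 + (- 1 / (2 * F e 0)) * Q2) (at_right 0)"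
    proof (rule composed_second_difference_tendsto[where G = "\<lambda>q. - ln q / 2" and g = "\<lambda>q. - 1 / (2 * q)"])
      have "\<forall>\<^sub>F q in nhds (F e 0). q \<in> {0<..}"
        using d0 by (intro eventually_nhds_in_open) (auto simp: F0)
      then show "\<forall>\<^sub>F q in nhds (F e 0). ((\<lambda>q. - ln q / 2) has_real_derivative - 1 / (2 * q)) (at q)"
        by eventually_elim (auto intro!: derivative_eq_intros)
      show "((\<lambda>q. - 1 / (2 * q)) has_real_derivative 1 / (2 * (F e 0)\<^sup>2)) (at (F e 0))"
        using d0 by (auto intro!: derivative_eq_intros simp: F0 field_simps power2_eq_square)
      show "(F e has_real_derivative Q' t) (at t)" for t
        unfolding F_def Q'_def by (auto intro!: derivative_eq_intros simp: power2_eq_square)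
      show "(Q' has_real_derivative Q2) (at 0)"
        unfolding Q'_def Q2_def by (auto intro!: derivative_eq_intros simp: power2_eq_square)
    qed
    moreover have "1 / (2 * (F e 0)\<^sup>2) * (Q' 0)\<^sup>2 + (- 1 / (2 * F e 0)) * Q2 = lap e"
      unfolding F0 using d0 by (simp add: Q'_def Q2_def lap_def field_simps power2_eq_square)
    ultimately show ?thesis by simp
  qed
  have ge: "\<forall>\<^sub>F t in at_right 0. - ln (F e t) / 2 + - ln (F e (- t)) / 2 - 2 * (- ln (F e 0) / 2) \<le> second_difference u t e y"
    if e: "e \<in> Basis" for e
  proof -
    have "\<forall>\<^sub>F t in at_right 0. t \<in> {0<..<bdist \<Omega> y}"
      using bdist_pos[OF y] by (intro eventually_at_rightI[of 0 "bdist \<Omega> y"]) auto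
    with out(1)[OF e] out(2)[OF e] show ?thesis
    proof eventually_elim
      case (elim t)
      have *: "- ln (F e s) / 2 \<le> u (y + s *\<^sub>R e)"
        if s: "y + s *\<^sub>R e \<in> \<Omega>" "w + s *\<^sub>R (a *\<^sub>R (e - (e \<bullet> \<nu>) *\<^sub>R \<nu>)) + s\<^sup>2 *\<^sub>R (\<tau> e *\<^sub>R \<nu>) \<notin> \<Omega>" for s
      proof -
        define z where "z = y + s *\<^sub>R e - (w + s *\<^sub>R (a *\<^sub>R (e - (e \<bullet> \<nu>) *\<^sub>R \<nu>)) + s\<^sup>2 *\<^sub>R (\<tau> e *\<^sub>R \<nu>))"
        have "z \<noteq> 0" using s by (auto simp: z_def)
        moreover have "F e s = (norm z)\<^sup>2" using normF[OF e, of s] by (simp add: z_def)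
        ultimately have "- ln (F e s) / 2 = - ln (norm z)" by (simp add: ln_realpow)
        also have "\<dots> \<le> u (y + s *\<^sub>R e)" unfolding u_def z_def by (rule neg_ln_bdist_ge[OF s])
        finally show ?thesis .
      qed
      have t: "0 < t" "t < bdist \<Omega> y" using elim by auto
      have "- ln (F e t) / 2 \<le> u (y + t *\<^sub>R e)"
        using elim segment_in_domain(1)[OF y e t] by (intro *) auto
      \<comment> \<open>The parabola with velocity \<open>- a\<close> at time \<open>t\<close> is
        the one with velocity \<open>a\<close> at time \<open>- t\<close>.\<close>
      moreover have "- ln (F e (- t)) / 2 \<le> u (y + (- t) *\<^sub>R e)"
        using elim segment_in_domain(2)[OF y e t] by (intro *) auto
      moreover have "- ln (F e 0) / 2 = u y" using d0 d by (simp add: F0 u_def ln_realpow)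
      ultimately show ?case by (simp add: second_difference_def)
    qed
  qed
  have "((\<lambda>t. \<Sum>e\<in>Basis. (- ln (F e t) / 2 + - ln (F e (- t)) / 2 - 2 * (- ln (F e 0) / 2)) / t\<^sup>2) \<longlongrightarrow> (\<Sum>e\<in>Basis. lap e)) (at_right 0)"
    by (intro tendsto_sum lim)
  moreover have "- \<eta> < (\<Sum>e\<in>Basis. lap e)"
  proof -
    \<comment> \<open>Parseval for the unit normal; hence the squared tangential parts of the basis
      vectors add up to the dimension minus 1.\<close>
    have s1: "(\<Sum>e\<in>Basis. (e \<bullet> \<nu>)\<^sup>2) = 1"
      using \<nu>1 unfolding euclidean_inner[of \<nu> \<nu>] by (simp add: power2_eq_square inner_commute)
    have "(\<Sum>e\<in>Basis. lap e) = (\<Sum>e\<in>Basis. (e \<bullet> \<nu>)\<^sup>2 + 2 * d * \<tau> e - (1 - a)\<^sup>2 * (1 - (e \<bullet> \<nu>)\<^sup>2)) / d\<^sup>2"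
      unfolding lap_def by (rule sum_divide_distrib[symmetric])
    also have "(\<Sum>e\<in>Basis. (e \<bullet> \<nu>)\<^sup>2 + 2 * d * \<tau> e - (1 - a)\<^sup>2 * (1 - (e \<bullet> \<nu>)\<^sup>2)) =
        1 + 2 * d * (\<Sum>e\<in>Basis. \<tau> e) - (1 - a)\<^sup>2 * (real DIM('a) - 1)"
      by (simp add: sum.distrib sum_subtractf s1 flip: sum_distrib_left)
    finally show ?thesis using pos d0 by (simp add: pos_less_divide_eq)
  qed
  ultimately have "\<forall>\<^sub>F t in at_right 0. - \<eta> < (\<Sum>e\<in>Basis. (- ln (F e t) / 2 + - ln (F e (- t)) / 2 - 2 * (- ln (F e 0) / 2)) / t\<^sup>2)"
    by (rule order_tendstoD(1))
  moreover have "\<forall>\<^sub>F t in at_right 0. \<forall>e\<in>Basis. - ln (F e t) / 2 + - ln (F e (- t)) / 2 - 2 * (- ln (F e 0) / 2) \<le> second_difference u t e y"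
    using ge by (intro eventually_ball_finite finite_Basis ballI)
  ultimately have "\<forall>\<^sub>F t in at_right 0. - \<eta> \<le> discrete_laplacian u t y"
  proof eventually_elim
    case (elim t)
    have "(\<Sum>e\<in>Basis. (- ln (F e t) / 2 + - ln (F e (- t)) / 2 - 2 * (- ln (F e 0) / 2)) / t\<^sup>2) \<le> discrete_laplacian u t y"
      unfolding discrete_laplacian_def using elim(2) by (intro sum_mono divide_right_mono) auto
    then show ?case using elim(1) by linarith
  qed
  then show ?thesis unfolding u_def .
qed

text \<open>An inscribed ball has at most the diameter of \<open>\<Omega>\<close>, so boundedness
  makes the supremum in \<open>inradius\<close> genuine rather than an unspecified value.\<close>

lemma bdist_le_inradius:
  assumes "bounded \<Omega>" "y \<in> \<Omega>"
  shows "bdist \<Omega> y \<le> inradius \<Omega>"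
  unfolding inradius_def
proof (rule cSup_upper)
  show "bdist \<Omega> y \<in> {r. 0 < r \<and> (\<exists>x. ball x r \<subseteq> \<Omega>)}"
    using bdist_pos[OF assms(2)] ball_bdist_subset[OF assms(2)] by blast
  show "bdd_above {r. 0 < r \<and> (\<exists>x. ball x r \<subseteq> \<Omega>)}"
  proof (rule bdd_aboveI)
    fix r assume "r \<in> {r. 0 < r \<and> (\<exists>x. ball x r \<subseteq> \<Omega>)}"
    then obtain x where x: "0 < r" "ball x r \<subseteq> \<Omega>" by auto
    have "diameter (ball x r) \<le> diameter \<Omega>" by (rule diameter_subset[OF x(2) assms(1)])
    then show "r \<le> diameter \<Omega>" using x(1) by (simp add: diameter_ball)
  qed
qed

text \<open>The optimal velocity for a boundary whose principal curvatures all equal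
  \<open>- 1 / ((m - 2) R)\<close> is \<open>a = 1 / (1 + d / ((m - 2) R))\<close>.\<close>

lemma mean_curvature_laplacian_inequality:
  fixes m d R h :: real
  assumes m: "m > 2" and d: "0 < d" "d \<le> R" and h: "h \<ge> - 1 / ((m - 2) * R)"
  obtains a where "0 \<le> 1 + d * a\<^sup>2 * ((m - 1) * h) - (1 - a)\<^sup>2 * (m - 1)"
proof -
  define q where "q = d / ((m - 2) * R)"
  have mR: "(m - 2) * R > 0" using m d by simp
  have "(m - 2) * q = d / R" using m by (simp add: q_def)
  then have q: "q > 0" "(m - 2) * q \<le> 1" using d mR by (auto simp: q_def)
  define a where "a = 1 / (1 + q)"
  have "d * h \<ge> - q"
    using mult_left_mono[OF h, of d] d(1) by (simp add: q_def)
  then have "a\<^sup>2 * (m - 1) * (d * h) \<ge> a\<^sup>2 * (m - 1) * (- q)" using m by (intro mult_left_mono) auto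
  \<comment> \<open>With the extreme value \<open>- q\<close> inserted for \<open>d * h\<close>, the
    sign depends on \<open>(m - 2) * q = d / R\<close> being at most 1. This explains the constant
    in the curvature hypothesis.\<close>
  moreover have "a\<^sup>2 * (m - 1) * (- q) + 1 - (1 - a)\<^sup>2 * (m - 1) = (1 - (m - 2) * q) / (1 + q)"
  proof -
    have "(1 + q) * a = 1" using q by (simp add: a_def)
    then have "1 - a = q * a" by (simp add: algebra_simps)
    then have "a\<^sup>2 * (m - 1) * (- q) + 1 - (1 - a)\<^sup>2 * (m - 1) = 1 - (m - 1) * q * a * ((1 + q) * a)"
      unfolding \<open>1 - a = q * a\<close> by (simp add: power2_eq_square algebra_simps)
    also have "\<dots> = 1 - (m - 1) * q * a" using \<open>(1 + q) * a = 1\<close> by simp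
    also have "\<dots> = (1 - (m - 2) * q) / (1 + q)" using q by (simp add: a_def field_simps)
    finally show ?thesis .
  qed
  moreover have "(1 - (m - 2) * q) / (1 + q) \<ge> 0" using q by simp
  ultimately have "0 \<le> 1 + d * a\<^sup>2 * ((m - 1) * h) - (1 - a)\<^sup>2 * (m - 1)"
    by (simp add: algebra_simps)
  then show thesis by (rule that)
qed

lemma neg_ln_bdist_subharmonic_mean_curvature:
  assumes dim: "DIM('a) > 2" and sb: "smoothly_bounded \<Omega>"
    and mc: "\<And>w. w \<in> frontier \<Omega> \<Longrightarrow> mean_curvature \<Omega> w \<ge> - 1 / ((real DIM('a) - 2) * inradius \<Omega>)"
  shows "subharmonic_on \<Omega> (\<lambda>x. - ln (bdist \<Omega> x))"
proof (rule neg_ln_bdist_subharmonicI[OF open_\<Omega> subset_refl])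
  fix y and \<eta> :: real assume y: "y \<in> \<Omega>" and \<eta>: "\<eta> > 0"
  obtain w where w: "w \<in> frontier \<Omega>" "bdist \<Omega> y = dist y w" by (rule nearest_boundary_point)
  obtain U \<rho> where l: "local_defining_function \<Omega> w U \<rho>"
    using sb w by (auto simp: smoothly_bounded_def)
  note D = local_defining_functionD[OF l]
  obtain H where H: "(grad \<rho> has_derivative H) (at w)"
    using grad_differentiable[OF D(1,3,2)] by (auto simp: differentiable_def)
  have linH: "linear H" using H by (rule has_derivative_linear)
  define g where "g = grad \<rho> w"
  have g: "norm g > 0" using D(2,6) by (auto simp: g_def)
  define \<nu> where "\<nu> = sgn g"
  define d where "d = bdist \<Omega> y"
  have d0: "d > 0" using bdist_pos[OF y] by (simp add: d_def)
  have "\<nu> = sgn (y - w)" unfolding \<nu>_def g_def by (rule nearest_point_normal[OF l w(1) y w(2)])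
  then have yw: "y - w = d *\<^sub>R \<nu>" using d0 by (simp add: d_def w(2) dist_norm sgn_div_norm)
  have \<nu>1: "norm \<nu> = 1" "g = norm g *\<^sub>R \<nu>" using g by (simp_all add: \<nu>_def norm_sgn sgn_div_norm)
  have g\<nu>: "g \<bullet> \<nu> = norm g" using \<nu>1(1) by (subst \<nu>1(2)) (simp add: norm_eq_1)
  define P where "P = (\<lambda>e. e - (e \<bullet> \<nu>) *\<^sub>R \<nu>)"
  have gP: "g \<bullet> P e = 0" for e
    using \<nu>1(1) by (subst \<nu>1(2)) (simp add: P_def inner_diff_right norm_eq_1 inner_commute)
  define h where "h = mean_curvature \<Omega> w"
  have tr: "(\<Sum>e\<in>Basis. H (P e) \<bullet> P e) / norm g = - ((real DIM('a) - 1) * h)"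
  proof -
    have "h = - (\<Sum>e\<in>Basis. H (P e) \<bullet> P e) / norm g / (real DIM('a) - 1)"
      unfolding h_def P_def \<nu>_def g_def by (rule mean_curvature_eq[OF l w(1) H refl])
    moreover have "real DIM('a) - 1 \<noteq> 0" using dim by simp
    ultimately show ?thesis by simp
  qed
  have "d \<le> inradius \<Omega>"
    unfolding d_def using sb y by (intro bdist_le_inradius) (auto simp: smoothly_bounded_def)
  then obtain a where a: "0 \<le> 1 + d * a\<^sup>2 * ((real DIM('a) - 1) * h) - (1 - a)\<^sup>2 * (real DIM('a) - 1)"
    using mean_curvature_laplacian_inequality[of "real DIM('a)" d "inradius \<Omega>" h] d0 dim mc[OF w(1)]
    unfolding h_def by auto
  \<comment> \<open>The parabola criterion is strict and costs \<open>\<epsilon>\<close> in each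
    direction. Over the whole basis the loss is \<open>\<eta> * d\<^sup>2 / 2\<close>, within the
    admissible \<open>\<eta> * d\<^sup>2\<close>.\<close>
  define \<epsilon> where "\<epsilon> = \<eta> * d / (4 * real DIM('a))"
  have \<epsilon>: "\<epsilon> > 0" using \<eta> d0 by (simp add: \<epsilon>_def)
  \<comment> \<open>The equality case of the parabola criterion for velocity \<open>a\<close>,
    lowered by \<open>\<epsilon>\<close>. It depends on \<open>a\<close> only through its square and
    so serves both orientations.\<close>
  define \<tau> where "\<tau> = (\<lambda>e. - (a\<^sup>2 * (H (P e) \<bullet> P e) / (2 * norm g) + \<epsilon>))"
  have out: "\<forall>\<^sub>F t in at_right 0. w + t *\<^sub>R (c *\<^sub>R P e) + t\<^sup>2 *\<^sub>R (\<tau> e *\<^sub>R \<nu>) \<notin> \<Omega>" if c: "c\<^sup>2 = a\<^sup>2" for c e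
  proof (rule parabola_outside[OF l w(1) H, folded g_def])
    show "g \<bullet> (c *\<^sub>R P e) = 0" by (simp add: gP)
    have "H (c *\<^sub>R P e) \<bullet> (c *\<^sub>R P e) = a\<^sup>2 * (H (P e) \<bullet> P e)"
      unfolding c[symmetric] by (simp add: linear_scale[OF linH] power2_eq_square)
    moreover have "2 * (g \<bullet> (\<tau> e *\<^sub>R \<nu>)) = - (a\<^sup>2 * (H (P e) \<bullet> P e)) - 2 * \<epsilon> * norm g"
      using g by (simp add: g\<nu> \<tau>_def field_simps)
    ultimately show "H (c *\<^sub>R P e) \<bullet> (c *\<^sub>R P e) + 2 * (g \<bullet> (\<tau> e *\<^sub>R \<nu>)) < 0"
      using \<epsilon> g by simp
  qed
  have \<tau>sum: "2 * d * (\<Sum>e\<in>Basis. \<tau> e) = d * a\<^sup>2 * ((real DIM('a) - 1) * h) - \<eta> * d\<^sup>2 / 2"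
  proof -
    have "(\<Sum>e\<in>Basis. \<tau> e) = - (a\<^sup>2 / 2 * ((\<Sum>e\<in>Basis. H (P e) \<bullet> P e) / norm g) + real DIM('a) * \<epsilon>)"
      unfolding \<tau>_def by (simp add: sum_negf sum_subtractf sum.distrib sum_distrib_left sum_divide_distrib mult_ac)
    also have "real DIM('a) * \<epsilon> = \<eta> * d / 4" by (simp add: \<epsilon>_def)
    finally have sum: "(\<Sum>e\<in>Basis. \<tau> e) = - (a\<^sup>2 / 2 * - ((real DIM('a) - 1) * h) + \<eta> * d / 4)"
      unfolding tr .
    show ?thesis unfolding sum by (simp add: power2_eq_square field_simps)
  qed
  show "\<forall>\<^sub>F t in at_right 0. - \<eta> \<le> discrete_laplacian (\<lambda>x. - ln (bdist \<Omega> x)) t y"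
  proof (rule parabola_touching[OF y w(1) d_def[symmetric] yw \<nu>1(1)])
    show "\<forall>\<^sub>F t in at_right 0. w + t *\<^sub>R (a *\<^sub>R (e - (e \<bullet> \<nu>) *\<^sub>R \<nu>)) + t\<^sup>2 *\<^sub>R (\<tau> e *\<^sub>R \<nu>) \<notin> \<Omega>"
      "\<forall>\<^sub>F t in at_right 0. w + t *\<^sub>R (- a *\<^sub>R (e - (e \<bullet> \<nu>) *\<^sub>R \<nu>)) + t\<^sup>2 *\<^sub>R (\<tau> e *\<^sub>R \<nu>) \<notin> \<Omega>" for e
      using out[of a e] out[of "- a" e] by (simp_all add: P_def)
    have "\<eta> * d\<^sup>2 > 0" using \<eta> d0 by simp
    then show "- \<eta> * d\<^sup>2 < 1 + 2 * d * (\<Sum>e\<in>Basis. \<tau> e) - (1 - a)\<^sup>2 * (real DIM('a) - 1)"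
      using a unfolding \<tau>sum by simp
  qed
qed

end

theorem theorem0p3:
  fixes \<Omega> :: "'a::euclidean_space set"
  assumes "is_domain \<Omega>" and "\<Omega> \<noteq> UNIV"
  shows "(DIM('a) \<in> {1, 2} \<longrightarrow> subharmonic_on \<Omega> (\<lambda>x. - ln (bdist \<Omega> x))) \<and>
     (DIM('a) > 2 \<longrightarrow> subharmonic_on \<Omega> (\<lambda>x. bdist \<Omega> x powi (2 - int DIM('a)))) \<and>
     (DIM('a) > 2 \<and> smoothly_bounded \<Omega> \<and>
        (\<forall>w\<in>frontier \<Omega>. mean_curvature \<Omega> w \<ge> - 1 / ((real DIM('a) - 2) * inradius \<Omega>))
        \<longrightarrow> subharmonic_on \<Omega> (\<lambda>x. - ln (bdist \<Omega> x))) \<and>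
     (smoothly_bounded \<Omega> \<longrightarrow>
        (\<exists>U. open U \<and> frontier \<Omega> \<subseteq> U \<and>
           subharmonic_on (\<Omega> \<inter> U) (\<lambda>x. - ln (bdist \<Omega> x))))"
proof -
  interpret proper_open \<Omega>
    using assms by unfold_locales (auto simp: is_domain_def)
  show ?thesis
    using neg_ln_bdist_subharmonic_low_dim bdist_powi_subharmonic
      neg_ln_bdist_subharmonic_mean_curvature neg_ln_bdist_subharmonic_near_boundary
    by (intro conjI impI) auto
qed

end
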